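(* Let $\mathsf{N}^{(1)}, \mathsf{N}^{(2)} \in \mathsf{NFI}_{\mathrm{PB}_4}(\mathrm{B}_4)$, let $[m,f] \in \mathsf{GTSh}(\mathsf{N}^{(2)},\mathsf{N}^{(1)})$ (i.e. a $\mathsf{GT}$-shadow with source $\mathsf{N}^{(2)}$ and target $\mathsf{N}^{(1)}$), and let $[\psi] \in \mathsf{Dessin}(\mathsf{N}^{(1)})$ be a child's drawing of degree $d$ represented by a homomorphism $\psi : \mathsf{F}_2 \to S_d$. Let $\psi^{(m,f)}: \mathsf{F}_2 \to S_d$ be the homomorphism defined by $$\psi^{(m,f)}(x) := \psi(x^{2m+1}), \qquad \psi^{(m,f)}(y) := \psi(f^{-1} y^{2m+1} f).$$ Then - $\psi^{(m,f)}$ does not depend on the choice of the pair $(m,f) \in \mathbb{Z}\times \mathsf{F}_2$ representing the $\mathsf{GT}$-shadow $[m,f]$; - $\psi^{(m,f)}$ represents a child's drawing of degree $d$ subordinate to $\mathsf{N}^{(2)}$. Moreover, the formulas $$\mathscr{A}^{sh}(\mathsf{N}) := \mathsf{N}, \qquad \mathscr{A}^{sh}([m,f])([\psi]) := [\psi^{(m,f)}]$$ define a contravariant functor $\mathscr{A}^{sh} : \mathsf{GTSh} \to \mathsf{Dessin}$.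
   Context: Braid groups. $\mathrm{B}_n$ is the Artin braid group on $n$ strands with standard generators $\sigma_1,\dots,\sigma_{n-1}$; $\mathrm{PB}_n\le \mathrm{B}_n$ is the pure braid group with generators $x_{ij} := \sigma_{j-1}\cdots\sigma_{i+1}\sigma_i^2\sigma_{i+1}^{-1}\cdots\sigma_{j-1}^{-1}$, $1\le i<j\le n$. Set $c := x_{23}x_{12}x_{13}\in \mathrm{PB}_3$; it generates the center of $\mathrm{PB}_3$. The elements $x:=x_{12}$, $y:=x_{23}$ generate a free subgroup of rank 2 in $\mathrm{PB}_3$, which is identified with the free group $\mathsf{F}_2$, and $\mathrm{PB}_3=\mathsf{F}_2\times\langle c\rangle$. $\mathsf{NFI}_{\mathrm{PB}_4}(\mathrm{B}_4)$ is the poset of finite index normal subgroups $\mathsf{N}\unlhd \mathrm{B}_4$ with $\mathsf{N}\le\mathrm{PB}_4$. Homomorphisms $\mathrm{PB}_3\to\mathrm{PB}_4$ (values on $x_{12},x_{23},x_{13}$): $\varphi_{123}: x_{12}, x_{23}, x_{13}$; $\varphi_{234}: x_{23}, x_{34}, x_{24}$; $\varphi_{12,3,4}: x_{13}x_{23},\ x_{34},\ x_{14}x_{24}$; $\varphi_{1,23,4}: x_{12}x_{13},\ x_{24}x_{34},\ x_{14}$; $\varphi_{1,2,34}: x_{12},\ x_{23}x_{24},\ x_{13}x_{14}$. For $\mathsf{N}\in\mathsf{NFI}_{\mathrm{PB}_4}(\mathrm{B}_4)$ let $\mathsf{N}_{\mathrm{PB}_3}$ be the intersection of the preimages of $\mathsf{N}$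 under these five homomorphisms (a finite index normal subgroup of $\mathrm{B}_3$ contained in $\mathrm{PB}_3$), let $N_{\mathrm{ord}}$ be the least common multiple of the orders of $x_{12}\mathsf{N}_{\mathrm{PB}_3}, x_{23}\mathsf{N}_{\mathrm{PB}_3}, c\,\mathsf{N}_{\mathrm{PB}_3}$ in $\mathrm{PB}_3/\mathsf{N}_{\mathrm{PB}_3}$, and $\mathsf{N}_{\mathsf{F}_2}:=\mathsf{N}_{\mathrm{PB}_3}\cap\mathsf{F}_2$. $\mathsf{GT}$-shadows. A $\mathsf{GT}$-shadow with target $\mathsf{N}$ is a pair $[m,f]:=(m+N_{\mathrm{ord}}\mathbb{Z},\ f\,\mathsf{N}_{\mathrm{PB}_3})\in \mathbb{Z}/N_{\mathrm{ord}}\mathbb{Z}\times \mathrm{PB}_3/\mathsf{N}_{\mathrm{PB}_3}$ that can be represented by $(m,f)\in\mathbb{Z}\times\mathsf{F}_2$ (all $\mathsf{GT}$-shadows are assumed "practical", and representatives are taken in $\mathbb{Z}\times\mathsf{F}_2$) such that: (i) $\sigma_1 x_{12}^m f^{-1}\sigma_2 x_{23}^m f\,\mathsf{N}_{\mathrm{PB}_3} = f^{-1}\sigma_1\sigma_2 x_{12}^{-m}c^m\,\mathsf{N}_{\mathrm{PB}_3}$ and $f^{-1}\sigma_2x_{23}^m f\sigma_1x_{12}^m\,\mathsf{N}_{\mathrm{PB}_3} = \sigma_2\sigma_1x_{23}^{-m}c^m f\,\mathsf{N}_{\mathrm{PB}_3}$ in $\mathrm{B}_3/\mathsf{N}_{\mathrm{PB}_3}$;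 (ii) $\varphi_{234}(f)\varphi_{1,23,4}(f)\varphi_{123}(f)\,\mathsf{N}=\varphi_{1,2,34}(f)\varphi_{12,3,4}(f)\,\mathsf{N}$ in $\mathrm{PB}_4/\mathsf{N}$; (iii) $2m+1$ is a unit modulo $N_{\mathrm{ord}}$; (iv) the homomorphism $T^{\mathrm{PB}_3}_{m,f}:\mathrm{PB}_3\to\mathrm{PB}_3/\mathsf{N}_{\mathrm{PB}_3}$, $x_{12}\mapsto x_{12}^{2m+1}\mathsf{N}_{\mathrm{PB}_3}$, $x_{23}\mapsto f^{-1}x_{23}^{2m+1}f\,\mathsf{N}_{\mathrm{PB}_3}$, $c\mapsto c^{2m+1}\mathsf{N}_{\mathrm{PB}_3}$, is onto. $\mathsf{GT}(\mathsf{N})$ is the set of $\mathsf{GT}$-shadows with target $\mathsf{N}$. The groupoid $\mathsf{GTSh}$. For $[m,f]\in\mathsf{GT}(\mathsf{N})$ the formulas $\sigma_1\mapsto\sigma_1^{2m+1}\mathsf{N}$, $\sigma_2\mapsto\varphi_{123}(f)^{-1}\sigma_2^{2m+1}\varphi_{123}(f)\mathsf{N}$, $\sigma_3\mapsto\varphi_{12,3,4}(f)^{-1}\sigma_3^{2m+1}\varphi_{12,3,4}(f)\mathsf{N}$ define a homomorphism $\mathrm{B}_4\to\mathrm{B}_4/\mathsf{N}$ whose restriction to $\mathrm{PB}_4$ is denoted $T^{\mathrm{PB}_4}_{m,f}:\mathrm{PB}_4\to\mathrm{PB}_4/\mathsf{N}$. The source of $[m,f]$ is $\ker(T^{\mathrm{PB}_4}_{m,f})\in\mathsf{NFI}_{\mathrm{PB}_4}(\mathrm{B}_4)$.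 It is known that $\mathsf{GT}$-shadows form a groupoid $\mathsf{GTSh}$ with object set $\mathsf{NFI}_{\mathrm{PB}_4}(\mathrm{B}_4)$, with $\mathsf{GTSh}(\mathsf{N}^{(2)},\mathsf{N}^{(1)})$ (morphisms from $\mathsf{N}^{(2)}$ to $\mathsf{N}^{(1)}$) the set of $[m,f]\in\mathsf{GT}(\mathsf{N}^{(1)})$ with source $\mathsf{N}^{(2)}$, and composition $[m_1,f_1]\circ[m_2,f_2]=[m,f]$, where $m=2m_1m_2+m_1+m_2$ and $f(x,y)=f_1(x,y)\,f_2\big(x^{2m_1+1},f_1(x,y)^{-1}y^{2m_1+1}f_1(x,y)\big)$; the identity morphisms are $[0,1]$. Child's drawings. A child's drawing of degree $d$ is an $S_d$-conjugacy class $[\psi]$ of homomorphisms $\psi:\mathsf{F}_2\to S_d$ whose image acts transitively on $\{1,\dots,d\}$. It is subordinate to $\mathsf{N}$ if $\mathsf{N}_{\mathsf{F}_2}\le\ker(\psi)$; $\mathsf{Dessin}(\mathsf{N})$ is the set of child's drawings (of all degrees) subordinate to $\mathsf{N}$. $\mathsf{Dessin}$ is the category whose objects are the elements of $\mathsf{NFI}_{\mathrm{PB}_4}(\mathrm{B}_4)$ and whose morphisms from $\mathsf{N}^{(1)}$ to $\mathsf{N}^{(2)}$ are all functions $\mathsf{Dessin}(\mathsf{N}^{(1)})\to\mathsf{Dessin}(\mathsf{N}^{(2)})$. *)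

theory Defs
  imports "HOL-Algebra.Algebra"
begin

section \<open>Groups given by generators and relations\<close>

text \<open>A letter \<open>(s, True)\<close> stands for the generator \<open>s\<close>, and \<open>(s, False)\<close> for its inverse.\<close>

type_synonym 'a word = "('a \<times> bool) list"

definition words :: "'a set \<Rightarrow> 'a word set" where
  "words S = lists (S \<times> UNIV)"

inductive pres_eq :: "'a set \<Rightarrow> ('a word \<times> 'a word) set \<Rightarrow> 'a word \<Rightarrow> 'a word \<Rightarrow> bool"
  for S R where
  refl: "w \<in> words S \<Longrightarrow> pres_eq S R w w"
| sym: "pres_eq S R u v \<Longrightarrow> pres_eq S R v u"
| trans: "pres_eq S R u v \<Longrightarrow> pres_eq S R v w \<Longrightarrow> pres_eq S R u w"
| cong: "pres_eq S R u u' \<Longrightarrow> pres_eq S R v v' \<Longrightarrow> pres_eq S R (u @ v) (u' @ v')"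
| cancel: "s \<in> S \<Longrightarrow> pres_eq S R [(s, b), (s, \<not> b)] []"
| rel: "(u, v) \<in> R \<Longrightarrow> u \<in> words S \<Longrightarrow> v \<in> words S \<Longrightarrow> pres_eq S R u v"

definition pres_class :: "'a set \<Rightarrow> ('a word \<times> 'a word) set \<Rightarrow> 'a word \<Rightarrow> 'a word set" where
  "pres_class S R w = {v. pres_eq S R w v}"

definition presented_group :: "'a set \<Rightarrow> ('a word \<times> 'a word) set \<Rightarrow> 'a word set monoid" where
  "presented_group S R =
     \<lparr> carrier = pres_class S R ` words S,
       monoid.mult = (\<lambda>A B. {w. \<exists>u\<in>A. \<exists>v\<in>B. pres_eq S R (u @ v) w}),
       one = pres_class S R [] \<rparr>"

text \<open>The homomorphism \<open>G \<rightarrow> H\<close> that sends \<open>g\<close> to \<open>a\<close> for all \<open>(g, a) \<in> P\<close>. It is only used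
  where the first components of \<open>P\<close> generate \<open>G\<close> and such a homomorphism exists; it is
  \<open>undefined\<close> outside of the carrier of \<open>G\<close>.\<close>

definition the_hom :: "('a, 'c) monoid_scheme \<Rightarrow> ('b, 'd) monoid_scheme \<Rightarrow> ('a \<times> 'b) set \<Rightarrow> 'a \<Rightarrow> 'b" where
  "the_hom G H P =
     (THE h. h \<in> hom G H \<and> h \<in> extensional (carrier G) \<and> (\<forall>(g, a)\<in>P. h g = a))"

section \<open>Braid groups\<close>

type_synonym braid = "nat word set"

definition braid_rels :: "nat \<Rightarrow> (nat word \<times> nat word) set" where
  "braid_rels n =
     {([(i, True), (i + 1, True), (i, True)], [(i + 1, True), (i, True), (i + 1, True)]) | i.
        1 \<le> i \<and> i + 1 < n} \<union>
     {([(i, True), (j, True)], [(j, True), (i, True)]) | i j. 1 \<le> i \<and> i + 2 \<le> j \<and> j < n}"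

definition BG :: "nat \<Rightarrow> braid monoid" where
  "BG n = presented_group {1..<n} (braid_rels n)"

definition bclass :: "nat \<Rightarrow> nat word \<Rightarrow> braid" where
  "bclass n = pres_class {1..<n} (braid_rels n)"

definition sig :: "nat \<Rightarrow> nat \<Rightarrow> braid" where
  "sig n i = bclass n [(i, True)]"

definition xg :: "nat \<Rightarrow> nat \<Rightarrow> nat \<Rightarrow> braid" where
  "xg n i j = bclass n
     (map (\<lambda>k. (k, True)) (rev [i + 1..<j]) @ [(i, True), (i, True)] @
      map (\<lambda>k. (k, False)) [i + 1..<j])"

text \<open>The kernel of the map to the symmetric group that records the permutation of the strands.\<close>

definition PB :: "nat \<Rightarrow> braid set" where
  "PB n = kernel (BG n) (sym_group n)
     (the_hom (BG n) (sym_group n) ((\<lambda>i. (sig n i, transpose i (i + 1))) ` {1..<n}))"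

definition PBG :: "nat \<Rightarrow> braid monoid" where
  "PBG n = (BG n)\<lparr>carrier := PB n\<rparr>"

definition cB :: braid where
  "cB = xg 3 2 3 \<otimes>\<^bsub>BG 3\<^esub> xg 3 1 2 \<otimes>\<^bsub>BG 3\<^esub> xg 3 1 3"

text \<open>The free group of rank two, as a subgroup of the pure braid group on three strands;
  \<open>xF\<close> and \<open>yF\<close> are its free generators.\<close>

abbreviation xF :: braid where "xF \<equiv> xg 3 1 2"
abbreviation yF :: braid where "yF \<equiv> xg 3 2 3"

definition F2 :: "braid set" where
  "F2 = generate (BG 3) {xF, yF}"

definition F2G :: "braid monoid" where
  "F2G = (BG 3)\<lparr>carrier := F2\<rparr>"

definition NFI :: "braid set set" where
  "NFI = {N. N \<lhd> BG 4 \<and> N \<subseteq> PB 4 \<and> finite (rcosets\<^bsub>BG 4\<^esub> N)}"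

section \<open>The five homomorphisms from \<open>PB 3\<close> to \<open>PB 4\<close>\<close>

text \<open>The arguments are the values on \<open>xg 3 1 2\<close>, \<open>xg 3 2 3\<close> and \<open>xg 3 1 3\<close>, in this order.\<close>

definition pb_hom :: "braid \<Rightarrow> braid \<Rightarrow> braid \<Rightarrow> braid \<Rightarrow> braid" where
  "pb_hom a b d = the_hom (PBG 3) (PBG 4) {(xg 3 1 2, a), (xg 3 2 3, b), (xg 3 1 3, d)}"

definition phi_123 :: "braid \<Rightarrow> braid" where
  "phi_123 = pb_hom (xg 4 1 2) (xg 4 2 3) (xg 4 1 3)"

definition phi_234 :: "braid \<Rightarrow> braid" where
  "phi_234 = pb_hom (xg 4 2 3) (xg 4 3 4) (xg 4 2 4)"

definition phi_12_3_4 :: "braid \<Rightarrow> braid" where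
  "phi_12_3_4 = pb_hom (xg 4 1 3 \<otimes>\<^bsub>BG 4\<^esub> xg 4 2 3) (xg 4 3 4) (xg 4 1 4 \<otimes>\<^bsub>BG 4\<^esub> xg 4 2 4)"

definition phi_1_23_4 :: "braid \<Rightarrow> braid" where
  "phi_1_23_4 = pb_hom (xg 4 1 2 \<otimes>\<^bsub>BG 4\<^esub> xg 4 1 3) (xg 4 2 4 \<otimes>\<^bsub>BG 4\<^esub> xg 4 3 4) (xg 4 1 4)"

definition phi_1_2_34 :: "braid \<Rightarrow> braid" where
  "phi_1_2_34 = pb_hom (xg 4 1 2) (xg 4 2 3 \<otimes>\<^bsub>BG 4\<^esub> xg 4 2 4) (xg 4 1 3 \<otimes>\<^bsub>BG 4\<^esub> xg 4 1 4)"

definition N3 :: "braid set \<Rightarrow> braid set" where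
  "N3 N = {g \<in> PB 3. phi_123 g \<in> N \<and> phi_234 g \<in> N \<and> phi_12_3_4 g \<in> N \<and>
             phi_1_23_4 g \<in> N \<and> phi_1_2_34 g \<in> N}"

definition Nord :: "braid set \<Rightarrow> nat" where
  "Nord N = Lcm ((\<lambda>g. group.ord (PBG 3 Mod N3 N) (g <#\<^bsub>PBG 3\<^esub> N3 N)) ` {xg 3 1 2, xg 3 2 3, cB})"

definition NF2 :: "braid set \<Rightarrow> braid set" where
  "NF2 N = N3 N \<inter> F2"

section \<open>GT-shadows\<close>

type_synonym shadow = "int set \<times> braid set"

definition gt_class :: "braid set \<Rightarrow> int \<Rightarrow> braid \<Rightarrow> shadow" where
  "gt_class N m f = ({m + int (Nord N) * k | k. True}, f <#\<^bsub>PBG 3\<^esub> N3 N)"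

definition hexagons :: "braid set \<Rightarrow> int \<Rightarrow> braid \<Rightarrow> bool" where
  "hexagons N m f \<longleftrightarrow>
     (sig 3 1 \<otimes>\<^bsub>BG 3\<^esub> xg 3 1 2 [^]\<^bsub>BG 3\<^esub> m \<otimes>\<^bsub>BG 3\<^esub> inv\<^bsub>BG 3\<^esub> f \<otimes>\<^bsub>BG 3\<^esub>
        sig 3 2 \<otimes>\<^bsub>BG 3\<^esub> xg 3 2 3 [^]\<^bsub>BG 3\<^esub> m \<otimes>\<^bsub>BG 3\<^esub> f) <#\<^bsub>BG 3\<^esub> N3 N
       = (inv\<^bsub>BG 3\<^esub> f \<otimes>\<^bsub>BG 3\<^esub> sig 3 1 \<otimes>\<^bsub>BG 3\<^esub> sig 3 2 \<otimes>\<^bsub>BG 3\<^esub>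
            xg 3 1 2 [^]\<^bsub>BG 3\<^esub> (- m) \<otimes>\<^bsub>BG 3\<^esub> cB [^]\<^bsub>BG 3\<^esub> m) <#\<^bsub>BG 3\<^esub> N3 N \<and>
     (inv\<^bsub>BG 3\<^esub> f \<otimes>\<^bsub>BG 3\<^esub> sig 3 2 \<otimes>\<^bsub>BG 3\<^esub> xg 3 2 3 [^]\<^bsub>BG 3\<^esub> m \<otimes>\<^bsub>BG 3\<^esub> f \<otimes>\<^bsub>BG 3\<^esub>
        sig 3 1 \<otimes>\<^bsub>BG 3\<^esub> xg 3 1 2 [^]\<^bsub>BG 3\<^esub> m) <#\<^bsub>BG 3\<^esub> N3 N
       = (sig 3 2 \<otimes>\<^bsub>BG 3\<^esub> sig 3 1 \<otimes>\<^bsub>BG 3\<^esub> xg 3 2 3 [^]\<^bsub>BG 3\<^esub> (- m) \<otimes>\<^bsub>BG 3\<^esub>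
            cB [^]\<^bsub>BG 3\<^esub> m \<otimes>\<^bsub>BG 3\<^esub> f) <#\<^bsub>BG 3\<^esub> N3 N"

definition pentagon :: "braid set \<Rightarrow> braid \<Rightarrow> bool" where
  "pentagon N f \<longleftrightarrow>
     (phi_234 f \<otimes>\<^bsub>PBG 4\<^esub> phi_1_23_4 f \<otimes>\<^bsub>PBG 4\<^esub> phi_123 f) <#\<^bsub>PBG 4\<^esub> N
       = (phi_1_2_34 f \<otimes>\<^bsub>PBG 4\<^esub> phi_12_3_4 f) <#\<^bsub>PBG 4\<^esub> N"

definition T_PB3 :: "braid set \<Rightarrow> int \<Rightarrow> braid \<Rightarrow> braid \<Rightarrow> braid set" where
  "T_PB3 N m f = the_hom (PBG 3) (PBG 3 Mod N3 N)
     {(xg 3 1 2, xg 3 1 2 [^]\<^bsub>BG 3\<^esub> (2 * m + 1) <#\<^bsub>PBG 3\<^esub> N3 N),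
      (xg 3 2 3, (inv\<^bsub>BG 3\<^esub> f \<otimes>\<^bsub>BG 3\<^esub> xg 3 2 3 [^]\<^bsub>BG 3\<^esub> (2 * m + 1) \<otimes>\<^bsub>BG 3\<^esub> f) <#\<^bsub>PBG 3\<^esub> N3 N),
      (cB, cB [^]\<^bsub>BG 3\<^esub> (2 * m + 1) <#\<^bsub>PBG 3\<^esub> N3 N)}"

definition is_gt_rep :: "braid set \<Rightarrow> int \<Rightarrow> braid \<Rightarrow> bool" where
  "is_gt_rep N m f \<longleftrightarrow>
     f \<in> F2 \<and> hexagons N m f \<and> pentagon N f \<and> coprime (2 * m + 1) (int (Nord N)) \<and>
     T_PB3 N m f ` carrier (PBG 3) = carrier (PBG 3 Mod N3 N)"

definition GT :: "braid set \<Rightarrow> shadow set" where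
  "GT N = {gt_class N m f | m f. is_gt_rep N m f}"

definition T_B4 :: "braid set \<Rightarrow> int \<Rightarrow> braid \<Rightarrow> braid \<Rightarrow> braid set" where
  "T_B4 N m f = the_hom (BG 4) (BG 4 Mod N)
     {(sig 4 1, sig 4 1 [^]\<^bsub>BG 4\<^esub> (2 * m + 1) <#\<^bsub>BG 4\<^esub> N),
      (sig 4 2, (inv\<^bsub>BG 4\<^esub> (phi_123 f) \<otimes>\<^bsub>BG 4\<^esub> sig 4 2 [^]\<^bsub>BG 4\<^esub> (2 * m + 1) \<otimes>\<^bsub>BG 4\<^esub> phi_123 f) <#\<^bsub>BG 4\<^esub> N),
      (sig 4 3, (inv\<^bsub>BG 4\<^esub> (phi_12_3_4 f) \<otimes>\<^bsub>BG 4\<^esub> sig 4 3 [^]\<^bsub>BG 4\<^esub> (2 * m + 1) \<otimes>\<^bsub>BG 4\<^esub> phi_12_3_4 f) <#\<^bsub>BG 4\<^esub> N)}"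

definition T_PB4 :: "braid set \<Rightarrow> int \<Rightarrow> braid \<Rightarrow> braid \<Rightarrow> braid set" where
  "T_PB4 N m f = restrict (T_B4 N m f) (PB 4)"

definition gt_source :: "braid set \<Rightarrow> int \<Rightarrow> braid \<Rightarrow> braid set" where
  "gt_source N m f = kernel (PBG 4) (PBG 4 Mod N) (T_PB4 N m f)"

text \<open>Morphisms from \<open>N2\<close> to \<open>N1\<close>. The source of a GT-shadow does not depend on the
  representative used to compute it.\<close>

definition GTSh_hom :: "braid set \<Rightarrow> braid set \<Rightarrow> shadow set" where
  "GTSh_hom N2 N1 = {gt_class N1 m f | m f. is_gt_rep N1 m f \<and> gt_source N1 m f = N2}"

text \<open>The endomorphism \<open>w(x, y) \<mapsto> w(x^(2m+1), f^(-1) y^(2m+1) f)\<close> of the free group.\<close>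

definition E_F2 :: "int \<Rightarrow> braid \<Rightarrow> braid \<Rightarrow> braid" where
  "E_F2 m f = the_hom F2G F2G
     {(xF, xF [^]\<^bsub>F2G\<^esub> (2 * m + 1)),
      (yF, inv\<^bsub>F2G\<^esub> f \<otimes>\<^bsub>F2G\<^esub> yF [^]\<^bsub>F2G\<^esub> (2 * m + 1) \<otimes>\<^bsub>F2G\<^esub> f)}"

text \<open>The composition of \<open>s1\<close>, a shadow with target \<open>N1\<close> and source \<open>N2\<close>, with \<open>s2\<close>, a shadow
  with target \<open>N2\<close>. The class chosen does not depend on the representatives.\<close>

definition gt_comp :: "braid set \<Rightarrow> braid set \<Rightarrow> shadow \<Rightarrow> shadow \<Rightarrow> shadow" where
  "gt_comp N1 N2 s1 s2 = (SOME s. \<exists>m1 f1 m2 f2. f1 \<in> F2 \<and> f2 \<in> F2 \<and>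
     s1 = gt_class N1 m1 f1 \<and> s2 = gt_class N2 m2 f2 \<and>
     s = gt_class N1 (2 * m1 * m2 + m1 + m2) (f1 \<otimes>\<^bsub>F2G\<^esub> E_F2 m1 f1 f2))"

section \<open>Child's drawings\<close>

definition dessin_rep :: "nat \<Rightarrow> (braid \<Rightarrow> nat \<Rightarrow> nat) \<Rightarrow> bool" where
  "dessin_rep d \<psi> \<longleftrightarrow>
     d \<ge> 1 \<and> \<psi> \<in> hom F2G (sym_group d) \<and> \<psi> \<in> extensional F2 \<and>
     (\<forall>i\<in>{1..d}. \<forall>j\<in>{1..d}. \<exists>g\<in>F2. \<psi> g i = j)"

definition subordinate :: "braid set \<Rightarrow> nat \<Rightarrow> (braid \<Rightarrow> nat \<Rightarrow> nat) \<Rightarrow> bool" where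
  "subordinate N d \<psi> \<longleftrightarrow> NF2 N \<subseteq> kernel F2G (sym_group d) \<psi>"

text \<open>A child's drawing: its degree together with a conjugacy class of homomorphisms.\<close>

type_synonym drawing = "nat \<times> (braid \<Rightarrow> nat \<Rightarrow> nat) set"

definition drawing_of :: "nat \<Rightarrow> (braid \<Rightarrow> nat \<Rightarrow> nat) \<Rightarrow> drawing" where
  "drawing_of d \<psi> =
     (d, {\<lambda>g\<in>F2. \<tau> \<otimes>\<^bsub>sym_group d\<^esub> \<psi> g \<otimes>\<^bsub>sym_group d\<^esub> inv\<^bsub>sym_group d\<^esub> \<tau> | \<tau>. \<tau> \<in> carrier (sym_group d)})"

definition Dessins :: "braid set \<Rightarrow> drawing set" where
  "Dessins N = {drawing_of d \<psi> | d \<psi>. dessin_rep d \<psi> \<and> subordinate N d \<psi>}"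

definition psi_act :: "nat \<Rightarrow> (braid \<Rightarrow> nat \<Rightarrow> nat) \<Rightarrow> int \<Rightarrow> braid \<Rightarrow> braid \<Rightarrow> nat \<Rightarrow> nat" where
  "psi_act d \<psi> m f = the_hom F2G (sym_group d)
     {(xF, \<psi> (xF [^]\<^bsub>F2G\<^esub> (2 * m + 1))),
      (yF, \<psi> (inv\<^bsub>F2G\<^esub> f \<otimes>\<^bsub>F2G\<^esub> yF [^]\<^bsub>F2G\<^esub> (2 * m + 1) \<otimes>\<^bsub>F2G\<^esub> f))}"

section \<open>Categories and contravariant functors\<close>

text \<open>\<open>Comp C a b c t s\<close> is the composite of \<open>s : a \<rightarrow> b\<close> with \<open>t : b \<rightarrow> c\<close>.\<close>

record ('o, 'm) cat =
  Obj :: "'o set"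
  Hom :: "'o \<Rightarrow> 'o \<Rightarrow> 'm set"
  Ident :: "'o \<Rightarrow> 'm"
  Comp :: "'o \<Rightarrow> 'o \<Rightarrow> 'o \<Rightarrow> 'm \<Rightarrow> 'm \<Rightarrow> 'm"

definition contravariant_functor ::
  "('o, 'm) cat \<Rightarrow> ('p, 'n) cat \<Rightarrow> ('o \<Rightarrow> 'p) \<Rightarrow> ('o \<Rightarrow> 'o \<Rightarrow> 'm \<Rightarrow> 'n) \<Rightarrow> bool" where
  "contravariant_functor C D Fo Fm \<longleftrightarrow>
     (\<forall>a\<in>Obj C. Fo a \<in> Obj D) \<and>
     (\<forall>a\<in>Obj C. \<forall>b\<in>Obj C. \<forall>s\<in>Hom C a b. Fm a b s \<in> Hom D (Fo b) (Fo a)) \<and>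
     (\<forall>a\<in>Obj C. Fm a a (Ident C a) = Ident D (Fo a)) \<and>
     (\<forall>a\<in>Obj C. \<forall>b\<in>Obj C. \<forall>c\<in>Obj C. \<forall>s\<in>Hom C a b. \<forall>t\<in>Hom C b c.
        Fm a c (Comp C a b c t s) = Comp D (Fo c) (Fo b) (Fo a) (Fm a b s) (Fm b c t))"

definition GTSh :: "(braid set, shadow) cat" where
  "GTSh = \<lparr> Obj = NFI, Hom = GTSh_hom, Ident = (\<lambda>N. gt_class N 0 \<one>\<^bsub>F2G\<^esub>),
            Comp = (\<lambda>_ N2 N1 s1 s2. gt_comp N1 N2 s1 s2) \<rparr>"

definition Dessin :: "(braid set, drawing \<Rightarrow> drawing) cat" where
  "Dessin = \<lparr> Obj = NFI, Hom = (\<lambda>N1 N2. Dessins N1 \<rightarrow>\<^sub>E Dessins N2),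
              Ident = (\<lambda>N. \<lambda>D\<in>Dessins N. D),
              Comp = (\<lambda>N1 _ _ G F. compose (Dessins N1) G F) \<rparr>"

text \<open>The action of a shadow \<open>s\<close> from \<open>N2\<close> to \<open>N1\<close>.\<close>

definition Ash_mor :: "braid set \<Rightarrow> braid set \<Rightarrow> shadow \<Rightarrow> drawing \<Rightarrow> drawing" where
  "Ash_mor N2 N1 s = (\<lambda>D\<in>Dessins N1. THE D'. \<exists>m f d \<psi>. f \<in> F2 \<and> s = gt_class N1 m f \<and>
     dessin_rep d \<psi> \<and> D = drawing_of d \<psi> \<and> D' = drawing_of d (psi_act d \<psi> m f))"

definition Ash_obj :: "braid set \<Rightarrow> braid set" where
  "Ash_obj N = N"

end

theory Submission
  imports Defs
begin

text \<open>
  The subgroup \<open>PB 3\<close> has six cosets in the braid group on three strands. Inducing along them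
  shows that any elements \<open>x\<close>, \<open>y\<close> of a group and any \<open>z\<close> commuting with both are the images of
  \<open>xF\<close>, \<open>yF\<close> and \<open>cB\<close> under a homomorphism. This yields at once the freeness of \<open>F2\<close>, the five
  homomorphisms to \<open>PB 4\<close> and the homomorphism \<open>T_PB3\<close>.

  The hexagons and the pentagon turn the images of the \<open>\<sigma>\<^sub>i\<close> under \<open>T_B4\<close> into solutions of the braid
  relations, and for each of the five homomorphisms \<open>\<phi>\<close> the elements \<open>T_B4 (\<phi> w)\<close> and \<open>\<phi> (E w)\<close>
  are conjugate modulo \<open>N\<close>, where \<open>E\<close> is the endomorphism \<open>E_F2 m f\<close>. So \<open>E\<close> maps \<open>NF2\<close> of the
  source into \<open>NF2\<close> of the target, which makes \<open>\<psi> \<circ> E\<close> subordinate to the source. It is transitive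
  since \<open>E\<close> is onto modulo \<open>NF2 N\<close>. Functoriality holds because the composition of shadows is
  the composition of these endomorphisms.
\<close>

section \<open>Presented groups\<close>

text \<open>Most maps of the statement are definite descriptions by \<open>the_hom\<close>, so each
  of them costs an existence proof and a proof that the prescribed arguments generate. For maps out
  of \<open>PB 3\<close> existence is the harder half, since that group enters as a kernel and not
  by a presentation; the induction from the cosets supplies it.

  The conjugacy of \<open>T_B4 (\<phi> w)\<close> and \<open>\<phi> (E w)\<close> rests on one
  identity: a strand encircling two neighbours, \<sigma>_2 \<sigma>_1^2 \<sigma>_2, equals
  \<sigma>_1^-2 times the full twist of the three strands. The full twist commutes with \<sigma>_1
  and \<sigma>_2, and by the hexagons it goes, up to conjugation, to its power with exponent 2m+1.
  So cabled generators go to conjugates of their powers with the same exponent. The pentagon ensures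
  that the values at both generators of \<open>F2\<close> share one conjugator.\<close>

lemma words_simps [simp]:
  "[] \<in> words S"
  "(a # w) \<in> words S \<longleftrightarrow> fst a \<in> S \<and> w \<in> words S"
  "(u @ v) \<in> words S \<longleftrightarrow> u \<in> words S \<and> v \<in> words S"
  by (auto simp: words_def mem_Times_iff)

lemma pres_eq_words: "pres_eq S R u v \<Longrightarrow> u \<in> words S \<and> v \<in> words S"
  by (induction rule: pres_eq.induct) auto

lemma pres_class_eq_iff:
  assumes "u \<in> words S"
  shows "pres_class S R u = pres_class S R v \<longleftrightarrow> pres_eq S R u v"
  using assms unfolding pres_class_def
  by (auto intro: pres_eq.refl pres_eq.sym pres_eq.trans)

lemma mult_pres_class:
  assumes "u \<in> words S" "v \<in> words S"
  shows "pres_class S R u \<otimes>\<^bsub>presented_group S R\<^esub> pres_class S R v = pres_class S R (u @ v)"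
  using assms unfolding pres_class_def presented_group_def
  by (auto intro: pres_eq.refl pres_eq.trans pres_eq.cong)

lemma one_presented_group: "\<one>\<^bsub>presented_group S R\<^esub> = pres_class S R []"
  by (simp add: presented_group_def)

lemma carrier_presented_group: "carrier (presented_group S R) = pres_class S R ` words S"
  by (simp add: presented_group_def)

lemma ex_inv_word:
  "w \<in> words S \<Longrightarrow> \<exists>v\<in>words S. pres_eq S R (v @ w) []"
proof (induction w)
  case Nil
  then show ?case using pres_eq.refl[of "[]" S R] by (intro bexI[of _ "[]"]) auto
next
  case (Cons a w)
  obtain s b where a: "a = (s, b)" by (cases a)
  from Cons obtain v where v: "v \<in> words S" "pres_eq S R (v @ w) []" by auto
  have "pres_eq S R ([(s, \<not> b)] @ [(s, b)]) []"
    using pres_eq.cancel[of s S R "\<not> b"] Cons.prems a by simp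
  from pres_eq.cong[OF this pres_eq.refl[of w]] Cons.prems
  have "pres_eq S R ((s, \<not> b) # a # w) w" by (simp add: a)
  from pres_eq.cong[OF pres_eq.refl[OF v(1)] this] v(2)
  have "pres_eq S R ((v @ [(s, \<not> b)]) @ a # w) []" by (auto intro: pres_eq.trans)
  then show ?case using v Cons.prems a by (intro bexI[of _ "v @ [(s, \<not> b)]"]) auto
qed

lemma group_presented_group [simp]: "group (presented_group S R)"
proof (rule groupI)
  fix x assume "x \<in> carrier (presented_group S R)"
  then obtain w where w: "w \<in> words S" "x = pres_class S R w"
    by (auto simp: carrier_presented_group)
  with ex_inv_word[of w S R] obtain v where "v \<in> words S" "pres_eq S R (v @ w) []" by auto
  then show "\<exists>y\<in>carrier (presented_group S R). y \<otimes>\<^bsub>presented_group S R\<^esub> x = \<one>\<^bsub>presented_group S R\<^esub>"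
    using w by (auto simp: carrier_presented_group mult_pres_class one_presented_group pres_class_eq_iff
        intro!: bexI[of _ v])
qed (auto simp: carrier_presented_group mult_pres_class one_presented_group)

primrec word_val :: "('b, 'd) monoid_scheme \<Rightarrow> ('a \<Rightarrow> 'b) \<Rightarrow> 'a word \<Rightarrow> 'b" where
  "word_val H \<phi> [] = \<one>\<^bsub>H\<^esub>"
| "word_val H \<phi> (a # w) =
     (if snd a then \<phi> (fst a) else inv\<^bsub>H\<^esub> \<phi> (fst a)) \<otimes>\<^bsub>H\<^esub> word_val H \<phi> w"

context group
begin

lemma word_val_closed:
  "\<phi> \<in> S \<rightarrow> carrier G \<Longrightarrow> w \<in> words S \<Longrightarrow> word_val G \<phi> w \<in> carrier G"
  by (induction w) auto

lemma word_val_append: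
  "\<phi> \<in> S \<rightarrow> carrier G \<Longrightarrow> u \<in> words S \<Longrightarrow> v \<in> words S \<Longrightarrow>
     word_val G \<phi> (u @ v) = word_val G \<phi> u \<otimes> word_val G \<phi> v"
  by (induction u) (auto simp: word_val_closed m_assoc Pi_def)

lemma word_val_pres_eq:
  assumes \<phi>: "\<phi> \<in> S \<rightarrow> carrier G"
    and R: "\<And>u v. (u, v) \<in> R \<Longrightarrow> word_val G \<phi> u = word_val G \<phi> v"
  shows "pres_eq S R u v \<Longrightarrow> word_val G \<phi> u = word_val G \<phi> v"
proof (induction rule: pres_eq.induct)
  case (cong u u' v v')
  then show ?case using pres_eq_words word_val_append[OF \<phi>] by metis
next
  case (cancel s b)
  then have "\<phi> s \<in> carrier G" using \<phi> by auto
  then show ?case by (cases b) auto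
qed (auto simp: R)

lemma presented_group_hom:
  assumes \<phi>: "\<phi> \<in> S \<rightarrow> carrier G"
    and R: "\<And>u v. (u, v) \<in> R \<Longrightarrow> word_val G \<phi> u = word_val G \<phi> v"
  obtains h where "h \<in> hom (presented_group S R) G"
    "\<And>w. w \<in> words S \<Longrightarrow> h (pres_class S R w) = word_val G \<phi> w"
proof
  \<comment> \<open>A class is evaluated at an arbitrary member; \<open>word_val_pres_eq\<close>
    makes the choice irrelevant.\<close>
  define h where "h = (\<lambda>A. word_val G \<phi> (SOME w. w \<in> A))"
  show *: "h (pres_class S R w) = word_val G \<phi> w" if "w \<in> words S" for w
  proof -
    have "w \<in> pres_class S R w" using that by (simp add: pres_class_def pres_eq.refl)
    then have "(SOME w'. w' \<in> pres_class S R w) \<in> pres_class S R w" by (rule someI)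
    then have "pres_eq S R w (SOME w'. w' \<in> pres_class S R w)" by (simp add: pres_class_def)
    from word_val_pres_eq[OF \<phi> R this] show ?thesis by (simp add: h_def)
  qed
  show "h \<in> hom (presented_group S R) G"
    by (rule homI) (auto simp: carrier_presented_group * word_val_closed[OF \<phi>]
        mult_pres_class word_val_append[OF \<phi>])
qed

end

lemma inv_pres_class_letter:
  assumes "s \<in> S"
  shows "inv\<^bsub>presented_group S R\<^esub> (pres_class S R [(s, True)]) = pres_class S R [(s, False)]"
proof -
  interpret group "presented_group S R" by simp
  show ?thesis
    using assms pres_eq.cancel[of s S R False]
    by (intro inv_equality) (auto simp: carrier_presented_group mult_pres_class one_presented_group pres_class_eq_iff)
qed

lemma presented_group_generate:
  "carrier (presented_group S R) =
     generate (presented_group S R) ((\<lambda>s. pres_class S R [(s, True)]) ` S)"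
proof -
  let ?P = "presented_group S R" and ?X = "(\<lambda>s. pres_class S R [(s, True)]) ` S"
  interpret group ?P by simp
  have "pres_class S R w \<in> generate ?P ?X" if "w \<in> words S" for w
    using that
  proof (induction w)
    case Nil
    then show ?case using generate.one[of ?P ?X] by (simp add: one_presented_group)
  next
    case (Cons a w)
    have "pres_class S R [a] \<in> generate ?P ?X"
    proof (cases a)
      case (Pair s b)
      then have "s \<in> S" using Cons.prems by simp
      then have s: "pres_class S R [(s, True)] \<in> ?X" by blast
      show ?thesis
      proof (cases b)
        case True
        then show ?thesis using generate.incl[OF s, of ?P] Pair by simp
      next
        case False
        then show ?thesis
          using generate.inv[OF s, of ?P] Pair inv_pres_class_letter[OF \<open>s \<in> S\<close>, of R] by simp
      qed
    qed
    moreover have "pres_class S R w \<in> generate ?P ?X" using Cons by simp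
    ultimately have "pres_class S R [a] \<otimes>\<^bsub>?P\<^esub> pres_class S R w \<in> generate ?P ?X"
      by (rule generate.eng)
    with Cons.prems show ?case by (simp add: mult_pres_class)
  qed
  then have "carrier ?P \<subseteq> generate ?P ?X" by (auto simp: carrier_presented_group)
  moreover have "generate ?P ?X \<subseteq> carrier ?P"
    by (rule generate_incl) (auto simp: carrier_presented_group)
  ultimately show ?thesis by blast
qed

lemma hom_eq_on_generate:
  assumes "group G" "group H" "h \<in> hom G H" "k \<in> hom G H" "S \<subseteq> carrier G"
    and "\<And>s. s \<in> S \<Longrightarrow> h s = k s" and "g \<in> generate G S"
  shows "h g = k g"
proof -
  interpret h: group_hom G H h using assms by (simp add: group_hom_def group_hom_axioms_def)
  interpret k: group_hom G H k using assms by (simp add: group_hom_def group_hom_axioms_def)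
  have *: "generate G S \<subseteq> carrier G" by (rule group.generate_incl[OF assms(1,5)])
  show ?thesis using assms(7)
  proof (induction rule: generate.induct)
    case (inv x)
    then show ?case using assms(5,6) by (metis h.hom_inv k.hom_inv subsetD)
  next
    case (eng x y)
    then show ?case using * by (auto simp: subset_iff)
  qed (auto simp: assms(6))
qed

text \<open>Two homomorphisms that agree on the first components of \<open>P\<close> agree on the
  subgroup these generate, which is the whole carrier; this is the uniqueness that the definite
  description asks for. The restriction is there because \<open>the_hom\<close> also demands
  extensionality, without which values outside of the carrier would be arbitrary.\<close>

lemma the_hom_eqI:
  assumes "group G" "group H" "h \<in> hom G H" "\<And>g a. (g, a) \<in> P \<Longrightarrow> h g = a"
    and "carrier G = generate G (fst ` P)"
  shows "the_hom G H P = restrict h (carrier G)"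
  unfolding the_hom_def
proof (rule the_equality)
  interpret group G by fact
  have sub: "fst ` P \<subseteq> carrier G" using generate.incl[of _ "fst ` P" G] assms(5) by auto
  have r: "restrict h (carrier G) \<in> hom G H" using assms(3) is_monoid by (auto simp: hom_def Pi_def monoid.m_closed)
  show "restrict h (carrier G) \<in> hom G H \<and> restrict h (carrier G) \<in> extensional (carrier G) \<and>
    (\<forall>(g, a)\<in>P. restrict h (carrier G) g = a)"
    using r sub assms(4) by (auto simp: image_subset_iff)
  fix k assume k: "k \<in> hom G H \<and> k \<in> extensional (carrier G) \<and> (\<forall>(g, a)\<in>P. k g = a)"
  show "k = restrict h (carrier G)"
  proof (rule extensionalityI[of _ "carrier G"])
    fix g assume g: "g \<in> carrier G"
    show "k g = restrict h (carrier G) g"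
    proof (rule hom_eq_on_generate[OF assms(1,2) _ r sub])
      show "k \<in> hom G H" using k by blast
      show "g \<in> generate G (fst ` P)" using g assms(5) by simp
      fix s assume s: "s \<in> fst ` P"
      then obtain a where "(s, a) \<in> P" by auto
      then have "k s = a" "h s = a" using k assms(4) by auto
      then show "k s = restrict h (carrier G) s" using s sub by auto
    qed
  qed (use k in auto)
qed

section \<open>Braid groups and pure braids on three strands\<close>

context group
begin

text \<open>With \<open>m_assoc\<close> all products are nested to the right, so an adjacent pair of
  inverses may sit in front of further factors. These two rules remove such pairs.\<close>

lemma inv_mult_cancel [simp]:
  "x \<in> carrier G \<Longrightarrow> y \<in> carrier G \<Longrightarrow> inv x \<otimes> (x \<otimes> y) = y"
  by (simp flip: m_assoc)

lemma mult_inv_cancel [simp]: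
  "x \<in> carrier G \<Longrightarrow> y \<in> carrier G \<Longrightarrow> x \<otimes> (inv x \<otimes> y) = y"
  by (simp flip: m_assoc)

end

lemma bclass_Nil: "bclass n [] = \<one>\<^bsub>BG n\<^esub>"
  by (simp add: bclass_def BG_def one_presented_group)

lemma group_BG [simp]: "group (BG n)"
  by (simp add: BG_def)

lemma monoid_BG [simp]: "monoid (BG n)"
  by (simp add: group.is_monoid)

lemma sig_closed: "i \<in> {1..<n} \<Longrightarrow> sig n i \<in> carrier (BG n)"
  by (auto simp: sig_def bclass_def BG_def carrier_presented_group)

lemma bclass_Cons:
  assumes "fst a \<in> {1..<n}" "w \<in> words {1..<n}"
  shows "bclass n (a # w) =
    (if snd a then sig n (fst a) else inv\<^bsub>BG n\<^esub> (sig n (fst a))) \<otimes>\<^bsub>BG n\<^esub> bclass n w"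
  using assms mult_pres_class[of "[a]" "{1..<n}" w "braid_rels n"]
    inv_pres_class_letter[of "fst a" "{1..<n}" "braid_rels n"]
  by (cases a) (auto simp: bclass_def BG_def sig_def)

lemma bclass_eqI: "(u, v) \<in> braid_rels n \<Longrightarrow> u \<in> words {1..<n} \<Longrightarrow> v \<in> words {1..<n} \<Longrightarrow>
    bclass n u = bclass n v"
  unfolding bclass_def by (subst pres_class_eq_iff) (auto intro: pres_eq.rel)

lemma sig_braid:
  assumes "1 \<le> i" "i + 1 < n"
  shows "sig n i \<otimes>\<^bsub>BG n\<^esub> (sig n (Suc i) \<otimes>\<^bsub>BG n\<^esub> sig n i) =
    sig n (Suc i) \<otimes>\<^bsub>BG n\<^esub> (sig n i \<otimes>\<^bsub>BG n\<^esub> sig n (Suc i))"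
  using bclass_eqI[of "[(i, True), (i + 1, True), (i, True)]" "[(i + 1, True), (i, True), (i + 1, True)]" n]
    assms sig_closed[of i n] sig_closed[of "Suc i" n]
  by (auto simp: braid_rels_def bclass_Cons bclass_Nil monoid.r_one)

lemma sig_commute:
  assumes "1 \<le> i" "i + 2 \<le> j" "j < n"
  shows "sig n i \<otimes>\<^bsub>BG n\<^esub> sig n j = sig n j \<otimes>\<^bsub>BG n\<^esub> sig n i"
proof -
  have "bclass n [(i, True), (j, True)] = bclass n [(j, True), (i, True)]"
    using assms by (intro bclass_eqI) (auto simp: braid_rels_def)
  then show ?thesis
    using assms sig_closed[of i n] sig_closed[of j n]
    by (auto simp: bclass_Cons bclass_Nil monoid.r_one)
qed

lemma BG_generate: "carrier (BG n) = generate (BG n) (sig n ` {1..<n})"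
  unfolding BG_def sig_def bclass_def by (rule presented_group_generate)

lemma (in group) BG_hom:
  assumes "\<And>i. i \<in> {1..<n} \<Longrightarrow> \<phi> i \<in> carrier G"
    and "\<And>i. 1 \<le> i \<Longrightarrow> i + 1 < n \<Longrightarrow> \<phi> i \<otimes> (\<phi> (i + 1) \<otimes> \<phi> i) = \<phi> (i + 1) \<otimes> (\<phi> i \<otimes> \<phi> (i + 1))"
    and "\<And>i j. 1 \<le> i \<Longrightarrow> i + 2 \<le> j \<Longrightarrow> j < n \<Longrightarrow> \<phi> i \<otimes> \<phi> j = \<phi> j \<otimes> \<phi> i"
  obtains h where "h \<in> hom (BG n) G" "\<And>i. i \<in> {1..<n} \<Longrightarrow> h (sig n i) = \<phi> i"
proof -
  have \<phi>: "\<phi> \<in> {1..<n} \<rightarrow> carrier G" using assms(1) by auto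
  have "word_val G \<phi> u = word_val G \<phi> v" if "(u, v) \<in> braid_rels n" for u v
    using that assms by (auto simp: braid_rels_def)
  from presented_group_hom[OF \<phi> this] obtain h where
    h: "h \<in> hom (BG n) G" "\<And>w. w \<in> words {1..<n} \<Longrightarrow> h (bclass n w) = word_val G \<phi> w"
    unfolding BG_def bclass_def by metis
  moreover have "h (sig n i) = \<phi> i" if "i \<in> {1..<n}" for i
    using h(2)[of "[(i, True)]"] that assms(1)[OF that] by (auto simp: sig_def)
  ultimately show thesis using that by blast
qed

lemma group_sym_group [simp]: "group (sym_group n)"
  by (rule sym_group_is_group)

declare One_nat_def [simp del]

text \<open>The permutation map inside the definition of \<open>PB n\<close> is a definite
  description. It exists because neighbouring transpositions satisfy the braid relations, and
  \<open>PB n\<close> becomes the kernel of a homomorphism with known values.\<close>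

lemma perm_hom:
  obtains p where "p \<in> hom (BG n) (sym_group n)"
    "\<And>i. i \<in> {1..<n} \<Longrightarrow> p (sig n i) = transpose i (Suc i)"
    "PB n = kernel (BG n) (sym_group n) p"
proof -
  interpret group "sym_group n" by simp
  obtain p where p: "p \<in> hom (BG n) (sym_group n)" "\<And>i. i \<in> {1..<n} \<Longrightarrow> p (sig n i) = transpose i (Suc i)"
    by (rule BG_hom[of n "\<lambda>i. transpose i (Suc i)"])
      (auto simp: sym_group_carrier sym_group_mult permutes_swap_id fun_eq_iff transpose_def)
  have "the_hom (BG n) (sym_group n) ((\<lambda>i. (sig n i, transpose i (i + 1))) ` {1..<n}) = restrict p (carrier (BG n))"
    by (rule the_hom_eqI) (auto simp: p image_image BG_generate simp flip: Suc_eq_plus1)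
  then have "PB n = kernel (BG n) (sym_group n) p"
    unfolding PB_def kernel_def by auto
  with p that show thesis by blast
qed

lemma normal_PB: "PB n \<lhd> BG n"
proof -
  obtain p where "p \<in> hom (BG n) (sym_group n)" "PB n = kernel (BG n) (sym_group n) p"
    by (rule perm_hom[of n])
  then show ?thesis
    using group_hom.normal_kernel[of "BG n" "sym_group n" p]
    by (simp add: group_hom_def group_hom_axioms_def)
qed

lemma subgroup_PB: "subgroup (PB n) (BG n)"
  by (rule normal_imp_subgroup[OF normal_PB])

lemma sig_sq_PB: "i \<in> {1..<n} \<Longrightarrow> sig n i \<otimes>\<^bsub>BG n\<^esub> sig n i \<in> PB n"
proof -
  assume i: "i \<in> {1..<n}"
  obtain p where p: "p \<in> hom (BG n) (sym_group n)" "p (sig n i) = transpose i (Suc i)"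
    "PB n = kernel (BG n) (sym_group n) p"
    using i by (metis perm_hom)
  then show ?thesis
    using hom_mult[OF p(1) sig_closed[OF i] sig_closed[OF i]] sig_closed[OF i]
    by (simp add: kernel_def sym_group_mult sym_group_one monoid.m_closed)
qed

lemma conj_PB: "g \<in> PB n \<Longrightarrow> h \<in> carrier (BG n) \<Longrightarrow> h \<otimes>\<^bsub>BG n\<^esub> g \<otimes>\<^bsub>BG n\<^esub> inv\<^bsub>BG n\<^esub> h \<in> PB n"
  using normal_PB[of n] by (rule normal.inv_op_closed2)

lemma carrier_PBG [simp]: "carrier (PBG n) = PB n"
  by (simp add: PBG_def)

lemma mult_PBG [simp]: "x \<otimes>\<^bsub>PBG n\<^esub> y = x \<otimes>\<^bsub>BG n\<^esub> y"
  by (simp add: PBG_def)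

lemma group_PBG [simp]: "group (PBG n)"
  unfolding PBG_def by (rule subgroup.subgroup_is_group[OF subgroup_PB group_BG])

lemma PB_closed: "g \<in> PB n \<Longrightarrow> g \<in> carrier (BG n)"
  using subgroup.subset[OF subgroup_PB] by auto

section \<open>Consequences of the braid relation for two elements\<close>

locale braid3 = group +
  fixes a b
  assumes a [simp]: "a \<in> carrier G" and b [simp]: "b \<in> carrier G"
    and braid: "a \<otimes> (b \<otimes> a) = b \<otimes> (a \<otimes> b)"
begin

lemma braid': "x \<in> carrier G \<Longrightarrow> a \<otimes> (b \<otimes> (a \<otimes> x)) = b \<otimes> (a \<otimes> (b \<otimes> x))"
  using braid by (simp flip: m_assoc)

text \<open>The half twist on three strands, conjugation by which exchanges \<open>a\<close> and
  \<open>b\<close>; its square \<zeta>, the full twist, therefore commutes with both. The locale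
  serves the braids themselves, their images in quotients and the values of a shadow on the
  generators.\<close>

definition "\<Delta> = a \<otimes> (b \<otimes> a)"
definition "\<zeta> = \<Delta> \<otimes> \<Delta>"

lemma \<Delta>_closed [simp]: "\<Delta> \<in> carrier G" and \<zeta>_closed [simp]: "\<zeta> \<in> carrier G"
  by (simp_all add: \<Delta>_def \<zeta>_def)

lemma a_\<Delta>: "a \<otimes> \<Delta> = \<Delta> \<otimes> b"
  by (simp add: \<Delta>_def m_assoc braid braid')

lemma b_\<Delta>: "b \<otimes> \<Delta> = \<Delta> \<otimes> a"
  by (simp add: \<Delta>_def m_assoc flip: braid')

lemma a_\<zeta>: "a \<otimes> \<zeta> = \<zeta> \<otimes> a"
  unfolding \<zeta>_def by (metis a_\<Delta> b_\<Delta> \<Delta>_closed a b m_assoc)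

lemma b_\<zeta>: "b \<otimes> \<zeta> = \<zeta> \<otimes> b"
  unfolding \<zeta>_def by (metis a_\<Delta> b_\<Delta> \<Delta>_closed a b m_assoc)

lemma \<zeta>_bab: "b \<otimes> (a \<otimes> (b \<otimes> (b \<otimes> (a \<otimes> b)))) = \<zeta>"
  unfolding \<zeta>_def \<Delta>_def by (simp add: m_assoc braid braid')

text \<open>\<zeta> is \<open>a\<close> times the left side times \<open>a\<close>, and it commutes
  with \<open>a\<close>. So one strand encircling two neighbours is an inverse square times an
  element that commutes with \<open>a\<close>, which makes its powers computable (see
  \<open>pow_inv_inv\<close>).\<close>

lemma baab: "b \<otimes> (a \<otimes> (a \<otimes> b)) = inv a \<otimes> (inv a \<otimes> \<zeta>)"
proof -
  have "a \<otimes> (b \<otimes> (a \<otimes> (a \<otimes> b))) \<otimes> a = \<zeta>" by (simp add: \<zeta>_def \<Delta>_def m_assoc)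
  then have "a \<otimes> (b \<otimes> (a \<otimes> (a \<otimes> b))) = \<zeta> \<otimes> inv a" by (metis inv_solve_right a b m_closed \<zeta>_closed)
  also have "\<dots> = inv a \<otimes> \<zeta>" by (metis a_\<zeta> inv_solve_left inv_solve_right a \<zeta>_closed m_closed m_assoc inv_closed)
  finally show ?thesis by (metis inv_mult_cancel a b m_closed)
qed

lemma abba: "a \<otimes> (b \<otimes> (b \<otimes> a)) = inv b \<otimes> (inv b \<otimes> \<zeta>)"
proof -
  have "b \<otimes> (a \<otimes> (b \<otimes> (b \<otimes> a))) \<otimes> b = \<zeta>" by (simp add: \<zeta>_bab m_assoc)
  then have "b \<otimes> (a \<otimes> (b \<otimes> (b \<otimes> a))) = \<zeta> \<otimes> inv b" by (metis inv_solve_right a b m_closed \<zeta>_closed)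
  also have "\<dots> = inv b \<otimes> \<zeta>" by (metis b_\<zeta> inv_solve_left inv_solve_right b \<zeta>_closed m_closed m_assoc inv_closed)
  finally show ?thesis by (metis inv_mult_cancel a b m_closed)
qed

end

text \<open>The coset of \<open>PB 3\<close> in the braid group with index \<open>k\<close> is represented by the \<open>k\<close>-th entry
  of \<open>1, \<sigma>\<^sub>1, \<sigma>\<^sub>2, \<sigma>\<^sub>1\<sigma>\<^sub>2, \<sigma>\<^sub>2\<sigma>\<^sub>1, \<sigma>\<^sub>1\<sigma>\<^sub>2\<sigma>\<^sub>1\<close>. Multiplication of a representative by \<open>\<sigma>\<^sub>i\<close> from the left
  gives another one (\<open>dest\<close>), times a pure braid, which is expressed by \<open>x\<close>, \<open>y\<close>, \<open>z\<close>
  (\<open>cocyc\<close>).\<close>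

definition dest :: "bool \<Rightarrow> nat \<Rightarrow> nat" where
  "dest i k = (if i then [1, 0, 3, 2, 5, 4] else [2, 4, 0, 5, 1, 3]) ! k"

lemma less_6: "k < 6 \<longleftrightarrow> k \<in> {0, 1, 2, 3, 4, 5}" for k :: nat by auto

lemma dest_simps [simp]: "k < 6 \<Longrightarrow> dest i k < 6" "k < 6 \<Longrightarrow> dest i (dest i k) = k"
  by (auto simp: dest_def less_6)

section \<open>Homomorphisms out of \<open>PB 3\<close> by induction from its six cosets\<close>

locale pure3 = group +
  fixes x y z
  assumes x [simp]: "x \<in> carrier G" and y [simp]: "y \<in> carrier G" and z [simp]: "z \<in> carrier G"
    and xz: "x \<otimes> z = z \<otimes> x" and yz: "y \<otimes> z = z \<otimes> y"
begin

lemma comm_z: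
  "z \<otimes> x = x \<otimes> z" "z \<otimes> y = y \<otimes> z"
  "z \<otimes> inv x = inv x \<otimes> z" "z \<otimes> inv y = inv y \<otimes> z"
  "w \<in> carrier G \<Longrightarrow> z \<otimes> (x \<otimes> w) = x \<otimes> (z \<otimes> w)"
  "w \<in> carrier G \<Longrightarrow> z \<otimes> (y \<otimes> w) = y \<otimes> (z \<otimes> w)"
  "w \<in> carrier G \<Longrightarrow> z \<otimes> (inv x \<otimes> w) = inv x \<otimes> (z \<otimes> w)"
  "w \<in> carrier G \<Longrightarrow> z \<otimes> (inv y \<otimes> w) = inv y \<otimes> (z \<otimes> w)"
proof -
  show *: "z \<otimes> x = x \<otimes> z" "z \<otimes> y = y \<otimes> z" using xz yz by simp_all
  show **: "z \<otimes> inv x = inv x \<otimes> z" "z \<otimes> inv y = inv y \<otimes> z"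
    using * by (metis inv_closed inv_solve_left inv_solve_right m_assoc m_closed x y z)+
  show "z \<otimes> (x \<otimes> w) = x \<otimes> (z \<otimes> w)" if "w \<in> carrier G" using that * by (simp flip: m_assoc)
  show "z \<otimes> (y \<otimes> w) = y \<otimes> (z \<otimes> w)" if "w \<in> carrier G" using that * by (simp flip: m_assoc)
  show "z \<otimes> (inv x \<otimes> w) = inv x \<otimes> (z \<otimes> w)" if "w \<in> carrier G" using that ** by (simp flip: m_assoc)
  show "z \<otimes> (inv y \<otimes> w) = inv y \<otimes> (z \<otimes> w)" if "w \<in> carrier G" using that ** by (simp flip: m_assoc)
qed

definition cocyc :: "bool \<Rightarrow> nat \<Rightarrow> 'a" where
  "cocyc i k = (if i then [\<one>, x, \<one>, inv y \<otimes> (inv x \<otimes> z), \<one>, y]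
     else [\<one>, \<one>, y, \<one>, inv x \<otimes> (inv y \<otimes> z), x]) ! k"

lemma cocyc_closed [simp]: "k < 6 \<Longrightarrow> cocyc i k \<in> carrier G"
  by (auto simp: cocyc_def less_6)

text \<open>The induced action: a generator permutes the cosets and multiplies the component in
  \<open>G\<close> by the cocycle. It is restricted to the six cosets times the carrier, since
  elements of \<open>BijGroup\<close> are extensional bijections.\<close>

definition act :: "bool \<Rightarrow> nat \<times> 'a \<Rightarrow> nat \<times> 'a" where
  "act i = (\<lambda>(k, g)\<in>{..<6} \<times> carrier G. (dest i k, cocyc i k \<otimes> g))"

lemma act_Bij: "act i \<in> Bij ({..<6} \<times> carrier G)"
proof -
  \<comment> \<open>The inverse has to remove the cocycle met on the way to \<open>k\<close>. That
    way starts at \<open>dest i k\<close>, because \<open>dest i\<close> is an involution.\<close>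
  have "bij_betw (act i) ({..<6} \<times> carrier G) ({..<6} \<times> carrier G)"
    by (rule bij_betw_byWitness[where f' = "\<lambda>(k, g). (dest i k, inv (cocyc i (dest i k)) \<otimes> g)"])
      (auto simp: act_def)
  then show ?thesis by (auto simp: Bij_def act_def)
qed

abbreviation "act_group \<equiv> BijGroup ({..<6::nat} \<times> carrier G)"

lemma act_simp: "k < 6 \<Longrightarrow> g \<in> carrier G \<Longrightarrow> act i (k, g) = (dest i k, cocyc i k \<otimes> g)"
  by (simp add: act_def)

text \<open>For three strands the single relation \<sigma>_1 \<sigma>_2 \<sigma>_1 = \<sigma>_2
  \<sigma>_1 \<sigma>_2 has to be checked. On each of the six cosets the cocycles of both sides
  multiply to the same element once \<open>z\<close> is moved past \<open>x\<close> and
  \<open>y\<close>.\<close>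

lemma act_hom:
  obtains L where "L \<in> hom (BG 3) act_group" "L (sig 3 1) = act True" "L (sig 3 2) = act False"
proof -
  interpret B: group act_group by (rule group_BijGroup)
  have act: "act i \<in> carrier act_group" for i by (simp add: act_Bij BijGroup_def)
  have "act True \<otimes>\<^bsub>act_group\<^esub> (act False \<otimes>\<^bsub>act_group\<^esub> act True) =
      act False \<otimes>\<^bsub>act_group\<^esub> (act True \<otimes>\<^bsub>act_group\<^esub> act False)"
  proof -
    have "compose ({..<6} \<times> carrier G) (act True) (compose ({..<6} \<times> carrier G) (act False) (act True)) v =
        compose ({..<6} \<times> carrier G) (act False) (compose ({..<6} \<times> carrier G) (act True) (act False)) v"
      for v
    proof (cases "v \<in> {..<6} \<times> carrier G")
      case True
      then obtain k g where v: "v = (k, g)" "k < 6" "g \<in> carrier G" by auto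
      show ?thesis using v
        by (simp add: compose_def act_simp)
          (auto simp: less_6 dest_def cocyc_def m_assoc comm_z)
    qed (simp add: compose_def)
    then have "compose ({..<6} \<times> carrier G) (act True) (compose ({..<6} \<times> carrier G) (act False) (act True)) =
        compose ({..<6} \<times> carrier G) (act False) (compose ({..<6} \<times> carrier G) (act True) (act False))"
      by (rule ext)
    then show ?thesis by (simp add: BijGroup_def act_Bij compose_Bij)
  qed
  then obtain L where L: "L \<in> hom (BG 3) act_group" "\<And>i. i \<in> {1..<3} \<Longrightarrow> L (sig 3 i) = act (i = 1)"
    using B.BG_hom[of 3 "\<lambda>i. act (i = 1)"] act
    by (auto simp: atLeastLessThan_iff less_Suc_eq numeral_eq_Suc)
  show thesis by (rule that[OF L(1)]) (simp_all add: L(2))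
qed

lemma act_group_apply:
  "f \<in> carrier act_group \<Longrightarrow> h \<in> carrier act_group \<Longrightarrow> k < 6 \<Longrightarrow> g \<in> carrier G \<Longrightarrow>
    (f \<otimes>\<^bsub>act_group\<^esub> h) (k, g) = f (h (k, g))"
  by (simp add: BijGroup_def compose_def)

end

lemma xg_3:
  "xg 3 1 2 = sig 3 1 \<otimes>\<^bsub>BG 3\<^esub> sig 3 1"
  "xg 3 2 3 = sig 3 2 \<otimes>\<^bsub>BG 3\<^esub> sig 3 2"
  "xg 3 1 3 = sig 3 2 \<otimes>\<^bsub>BG 3\<^esub> (sig 3 1 \<otimes>\<^bsub>BG 3\<^esub> (sig 3 1 \<otimes>\<^bsub>BG 3\<^esub> inv\<^bsub>BG 3\<^esub> sig 3 2))"
proof -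
  interpret group "BG 3" by simp
  have [simp]: "[1 + 1..<3] = [2]" by (simp_all add: upt_rec)
  show
    "xg 3 1 2 = sig 3 1 \<otimes>\<^bsub>BG 3\<^esub> sig 3 1"
    "xg 3 2 3 = sig 3 2 \<otimes>\<^bsub>BG 3\<^esub> sig 3 2"
    "xg 3 1 3 = sig 3 2 \<otimes>\<^bsub>BG 3\<^esub> (sig 3 1 \<otimes>\<^bsub>BG 3\<^esub> (sig 3 1 \<otimes>\<^bsub>BG 3\<^esub> inv\<^bsub>BG 3\<^esub> sig 3 2))"
    by (simp_all add: xg_def bclass_Cons bclass_Nil sig_closed)
qed

context braid3
begin

interpretation z: pure3 G a b \<zeta>
  by unfold_locales (simp_all add: a_\<zeta> b_\<zeta>)

lemma baaB: "b \<otimes> (a \<otimes> (a \<otimes> inv b)) = inv a \<otimes> (inv a \<otimes> (inv b \<otimes> (inv b \<otimes> \<zeta>)))"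
proof -
  have "b \<otimes> (a \<otimes> (a \<otimes> inv b)) = b \<otimes> (a \<otimes> (a \<otimes> b)) \<otimes> inv b \<otimes> inv b"
    by (simp add: m_assoc)
  then show ?thesis by (simp add: baab m_assoc z.comm_z)
qed

lemma Baab: "inv b \<otimes> (a \<otimes> (a \<otimes> b)) = inv b \<otimes> (inv b \<otimes> (inv a \<otimes> (inv a \<otimes> \<zeta>)))"
proof -
  have "inv b \<otimes> (a \<otimes> (a \<otimes> b)) = inv b \<otimes> (inv b \<otimes> (b \<otimes> (a \<otimes> (a \<otimes> b))))" by simp
  then show ?thesis by (simp add: baab)
qed

lemma aab: "a \<otimes> (a \<otimes> b) = inv b \<otimes> (inv a \<otimes> (inv a \<otimes> \<zeta>))"
proof -
  have "a \<otimes> (a \<otimes> b) = b \<otimes> (inv b \<otimes> (a \<otimes> (a \<otimes> b)))" by simp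
  also have "\<dots> = b \<otimes> (inv b \<otimes> (inv b \<otimes> (inv a \<otimes> (inv a \<otimes> \<zeta>))))" by (simp only: Baab)
  finally show ?thesis by simp
qed

lemma bba: "b \<otimes> (b \<otimes> a) = inv a \<otimes> (inv b \<otimes> (inv b \<otimes> \<zeta>))"
proof -
  have "b \<otimes> (b \<otimes> a) = inv a \<otimes> (a \<otimes> (b \<otimes> (b \<otimes> a)))" by simp
  then show ?thesis by (simp add: abba del: inv_mult_cancel)
qed

text \<open>The left side is x_23 x_12 x_13 written in the generators. So \<open>cB\<close> is the
  full twist; the same identity gives the central values of \<open>phi_123\<close> and
  \<open>phi_234\<close>.\<close>

lemma center_eq: "b \<otimes> b \<otimes> (a \<otimes> a) \<otimes> (b \<otimes> (a \<otimes> (a \<otimes> inv b))) = \<zeta>"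
  by (simp add: baaB m_assoc)

sublocale p: pure3 G "a \<otimes> a" "b \<otimes> b" \<zeta>
  by unfold_locales (simp_all add: m_assoc z.comm_z)

definition coset_rep :: "nat \<Rightarrow> 'a" where
  "coset_rep k = [\<one>, a, b, a \<otimes> b, b \<otimes> a, \<Delta>] ! k"

lemma coset_rep_closed [simp]: "k < 6 \<Longrightarrow> coset_rep k \<in> carrier G"
  by (auto simp: coset_rep_def less_6)

text \<open>The origin of the tables \<open>dest\<close> and \<open>cocyc\<close>: they record this
  computation, in which \<open>x\<close> and \<open>y\<close> are the squares of \<open>a\<close>
  and \<open>b\<close>, and \<open>z\<close> is the full twist.\<close>

lemma coset_rep_dest:
  "k < 6 \<Longrightarrow> (if i then a else b) \<otimes> coset_rep k = coset_rep (dest i k) \<otimes> p.cocyc i k"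
  by (auto simp: coset_rep_def dest_def p.cocyc_def less_6 m_assoc inv_mult_group aab bba \<Delta>_def braid braid')

end

interpretation B3: braid3 "BG 3" "sig 3 1" "sig 3 2"
  using sig_braid[of 1 3] by (intro braid3.intro braid3_axioms.intro) (auto intro: sig_closed simp: numeral_2_eq_2)

lemma cB_eq: "cB = B3.\<zeta>"
  using B3.center_eq by (simp add: cB_def xg_3)

lemma strands: "{1..<3} = {1, 2 :: nat}" "{1..<4} = {1, 2, 3 :: nat}"
  by auto

lemma xg_3_PB: "xF \<in> PB 3" "yF \<in> PB 3" "cB \<in> PB 3" "xg 3 1 3 \<in> PB 3"
proof -
  interpret PB: subgroup "PB 3" "BG 3" by (rule subgroup_PB)
  show x: "xF \<in> PB 3" and y: "yF \<in> PB 3" by (simp_all add: xg_3 sig_sq_PB)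
  show "xg 3 1 3 \<in> PB 3"
    using conj_PB[of "sig 3 1 \<otimes>\<^bsub>BG 3\<^esub> sig 3 1" 3 "sig 3 2"] sig_sq_PB[of 1 3]
    by (simp add: xg_3 B3.m_assoc)
  then show "cB \<in> PB 3" using x y by (simp add: cB_def PB.m_closed)
qed

lemmas xg_3_closed [simp] = xg_3_PB [THEN PB_closed]

text \<open>Schreier's argument. Left multiplication by a generator or its inverse preserves the
  union of the six cosets of \<open>?P\<close>, so they cover the braid group. A pure braid then
  lies in the coset with index 0, the only one whose representative has trivial permutation.\<close>

lemma PB3_generate: "PB 3 = generate (BG 3) {xF, yF, cB}"
proof
  let ?P = "generate (BG 3) {xF, yF, cB}"
  have P: "subgroup ?P (BG 3)" by (rule B3.generate_is_subgroup) (simp)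
  interpret P: subgroup ?P "BG 3" by fact
  show "?P \<subseteq> PB 3"
    by (rule B3.generate_subgroup_incl[OF _ subgroup_PB]) (simp add: xg_3_PB)
  have gen: "xF \<in> ?P" "yF \<in> ?P" "cB \<in> ?P" by (auto intro: generate.incl)
  have "pure3 (BG 3) xF yF cB"
    using B3.p.pure3_axioms by (simp add: cB_eq xg_3)
  from pure3.cocyc_def[OF this] have cocyc: "B3.p.cocyc i k \<in> ?P" if "k < 6" for i k
    using that gen by (auto simp: less_6 cB_eq[symmetric] xg_3[symmetric])
  have step: "\<exists>k'<6. \<exists>h'\<in>?P. s \<otimes>\<^bsub>BG 3\<^esub> (B3.coset_rep k \<otimes>\<^bsub>BG 3\<^esub> h) = B3.coset_rep k' \<otimes>\<^bsub>BG 3\<^esub> h'"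
    if "k < 6" "h \<in> ?P" "s = (if i then sig 3 1 else sig 3 2)" for k h s i
  proof (intro exI conjI bexI)
    show "s \<otimes>\<^bsub>BG 3\<^esub> (B3.coset_rep k \<otimes>\<^bsub>BG 3\<^esub> h) = B3.coset_rep (dest i k) \<otimes>\<^bsub>BG 3\<^esub> (B3.p.cocyc i k \<otimes>\<^bsub>BG 3\<^esub> h)"
      using that B3.coset_rep_dest[of k i] by (simp flip: B3.m_assoc)
    show "B3.p.cocyc i k \<otimes>\<^bsub>BG 3\<^esub> h \<in> ?P" using that cocyc by blast
  qed (use that in simp)
  \<comment> \<open>The inverse generator leads from \<open>k\<close> to \<open>dest i k\<close> as
    well, because \<open>dest i\<close> is an involution, and it contributes the inverse of the
    cocycle at \<open>dest i k\<close>.\<close>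
  have step': "\<exists>k'<6. \<exists>h'\<in>?P. inv\<^bsub>BG 3\<^esub> s \<otimes>\<^bsub>BG 3\<^esub> (B3.coset_rep k \<otimes>\<^bsub>BG 3\<^esub> h) = B3.coset_rep k' \<otimes>\<^bsub>BG 3\<^esub> h'"
    if "k < 6" "h \<in> ?P" "s = (if i then sig 3 1 else sig 3 2)" for k h s i
  proof (intro exI conjI bexI)
    have s: "s \<in> carrier (BG 3)" using that by simp
    let ?h = "inv\<^bsub>BG 3\<^esub> (B3.p.cocyc i (dest i k)) \<otimes>\<^bsub>BG 3\<^esub> h"
    have e: "s \<otimes>\<^bsub>BG 3\<^esub> B3.coset_rep (dest i k) = B3.coset_rep k \<otimes>\<^bsub>BG 3\<^esub> B3.p.cocyc i (dest i k)"
      using that B3.coset_rep_dest[of "dest i k" i] by simp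
    have "s \<otimes>\<^bsub>BG 3\<^esub> (B3.coset_rep (dest i k) \<otimes>\<^bsub>BG 3\<^esub> ?h) = s \<otimes>\<^bsub>BG 3\<^esub> B3.coset_rep (dest i k) \<otimes>\<^bsub>BG 3\<^esub> ?h"
      using that(1,2) s by (simp add: B3.m_assoc)
    also have "\<dots> = B3.coset_rep k \<otimes>\<^bsub>BG 3\<^esub> h"
      unfolding e using that(1,2) by (simp add: B3.m_assoc)
    finally have "inv\<^bsub>BG 3\<^esub> s \<otimes>\<^bsub>BG 3\<^esub> (B3.coset_rep k \<otimes>\<^bsub>BG 3\<^esub> h) =
        inv\<^bsub>BG 3\<^esub> s \<otimes>\<^bsub>BG 3\<^esub> (s \<otimes>\<^bsub>BG 3\<^esub> (B3.coset_rep (dest i k) \<otimes>\<^bsub>BG 3\<^esub> ?h))" by simp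
    then show "inv\<^bsub>BG 3\<^esub> s \<otimes>\<^bsub>BG 3\<^esub> (B3.coset_rep k \<otimes>\<^bsub>BG 3\<^esub> h) = B3.coset_rep (dest i k) \<otimes>\<^bsub>BG 3\<^esub> ?h"
      using that s by simp
    show "?h \<in> ?P" using that cocyc by simp
  qed (use that in simp)
  have ind: "g \<in> carrier (BG 3) \<and> (\<forall>k<6. \<forall>h\<in>?P. \<exists>k'<6. \<exists>h'\<in>?P.
      g \<otimes>\<^bsub>BG 3\<^esub> (B3.coset_rep k \<otimes>\<^bsub>BG 3\<^esub> h) = B3.coset_rep k' \<otimes>\<^bsub>BG 3\<^esub> h')"
    if "g \<in> generate (BG 3) (sig 3 ` {1..<3})" for g
    using that
  proof induction
    case one
    then show ?case by (auto simp: B3.l_one)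
  next
    case (incl s)
    then have "s = sig 3 1 \<or> s = sig 3 2" by (auto simp: strands)
    then show ?case using step[of _ _ s True] step[of _ _ s False] by auto
  next
    case (inv s)
    then have "s = sig 3 1 \<or> s = sig 3 2" by (auto simp: strands)
    then show ?case using step'[of _ _ s True] step'[of _ _ s False] by auto
  next
    case (eng g h)
    show ?case
    proof (intro conjI allI impI ballI)
      show "g \<otimes>\<^bsub>BG 3\<^esub> h \<in> carrier (BG 3)" using eng.IH by simp
      fix k :: nat and u assume ku: "k < 6" "u \<in> ?P"
      then obtain k' u' where 1: "k' < 6" "u' \<in> ?P" "h \<otimes>\<^bsub>BG 3\<^esub> (B3.coset_rep k \<otimes>\<^bsub>BG 3\<^esub> u) = B3.coset_rep k' \<otimes>\<^bsub>BG 3\<^esub> u'"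
        using eng.IH(2) by blast
      then obtain k'' u'' where 2: "k'' < 6" "u'' \<in> ?P" "g \<otimes>\<^bsub>BG 3\<^esub> (B3.coset_rep k' \<otimes>\<^bsub>BG 3\<^esub> u') = B3.coset_rep k'' \<otimes>\<^bsub>BG 3\<^esub> u''"
        using eng.IH(1) by blast
      have "g \<otimes>\<^bsub>BG 3\<^esub> h \<otimes>\<^bsub>BG 3\<^esub> (B3.coset_rep k \<otimes>\<^bsub>BG 3\<^esub> u) = B3.coset_rep k'' \<otimes>\<^bsub>BG 3\<^esub> u''"
        using eng.IH ku 1 2 by (simp add: B3.m_assoc)
      then show "\<exists>k'<6. \<exists>h'\<in>?P. g \<otimes>\<^bsub>BG 3\<^esub> h \<otimes>\<^bsub>BG 3\<^esub> (B3.coset_rep k \<otimes>\<^bsub>BG 3\<^esub> u) = B3.coset_rep k' \<otimes>\<^bsub>BG 3\<^esub> h'"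
        using 2 by blast
    qed
  qed
  show "PB 3 \<subseteq> ?P"
  proof
    fix g assume g: "g \<in> PB 3"
    obtain p where p: "p \<in> hom (BG 3) (sym_group 3)"
      "\<And>i. i \<in> {1..<3} \<Longrightarrow> p (sig 3 i) = transpose i (Suc i)" "PB 3 = kernel (BG 3) (sym_group 3) p"
      by (rule perm_hom[of 3]) blast
    interpret p: group_hom "BG 3" "sym_group 3" p
      using p(1) by (simp add: group_hom_def group_hom_axioms_def)
    have "\<exists>k<6. \<exists>h\<in>?P. g \<otimes>\<^bsub>BG 3\<^esub> (B3.coset_rep 0 \<otimes>\<^bsub>BG 3\<^esub> \<one>\<^bsub>BG 3\<^esub>) = B3.coset_rep k \<otimes>\<^bsub>BG 3\<^esub> h"
      using ind[of g] PB_closed[OF g] P.one_closed zero_less_numeral unfolding BG_generate by blast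
    then obtain k h where kh: "k < 6" "h \<in> ?P" "g = B3.coset_rep k \<otimes>\<^bsub>BG 3\<^esub> h"
      using PB_closed[OF g] by (auto simp: B3.coset_rep_def)
    have "h \<in> PB 3" using kh \<open>?P \<subseteq> PB 3\<close> by blast
    then have "p h = id" "p g = id" using g p(3) by (auto simp: kernel_def sym_group_one)
    then have "p (B3.coset_rep k) = id" using kh by (simp add: sym_group_mult)
    moreover have "p (sig 3 1) = transpose 1 2" "p (sig 3 2) = transpose 2 3"
      using p(2)[of 1] p(2)[of 2] by (simp_all add: numeral_eq_Suc)
    ultimately have "k = 0" using kh(1)
      by (auto simp: less_6 B3.coset_rep_def B3.\<Delta>_def sym_group_mult fun_eq_iff transpose_def dest: spec[of _ 1] spec[of _ 2])
    then show "g \<in> ?P" using kh by (simp add: B3.coset_rep_def)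
  qed
qed

text \<open>A pure braid fixes the coset with index 0 and acts there as left multiplication by one
  element of \<open>G\<close>; the homomorphism sends the braid to that element. The action is
  computed for the three generators and carried to all of \<open>PB 3\<close> by generation.\<close>

lemma (in pure3) PB3_hom:
  obtains h where "h \<in> hom (PBG 3) G" "h xF = x" "h yF = y" "h cB = z"
proof -
  obtain L where L: "L \<in> hom (BG 3) act_group" "L (sig 3 1) = act True" "L (sig 3 2) = act False"
    by (rule act_hom)
  interpret L: group_hom "BG 3" act_group L
    using L(1) group_BijGroup by (simp add: group_hom_def group_hom_axioms_def)
  have step: "L (g \<otimes>\<^bsub>BG 3\<^esub> h) (k, u) = L g (L h (k, u))"
    if "g \<in> carrier (BG 3)" "h \<in> carrier (BG 3)" "k < 6" "u \<in> carrier G" for g h k u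
    using that by (simp add: act_group_apply)
  let ?Q = "\<lambda>g c. c \<in> carrier G \<and> (\<forall>u\<in>carrier G. L g (0, u) = (0, c \<otimes> u))"
  have gens: "?Q xF x" "?Q yF y" "?Q cB z"
    by (auto simp: xg_3 cB_eq B3.\<zeta>_def B3.\<Delta>_def step act_simp L dest_def cocyc_def m_assoc comm_z
        simp del: L.hom_mult)
  have Q_one: "?Q \<one>\<^bsub>BG 3\<^esub> \<one>"
    by (simp add: BijGroup_def)
  have Q_inv: "?Q (inv\<^bsub>BG 3\<^esub> g) (inv c)" if "?Q g c" "g \<in> carrier (BG 3)" for g c
  proof (intro conjI ballI)
    fix u assume u: "u \<in> carrier G"
    have "L (inv\<^bsub>BG 3\<^esub> g) (0, u) = L (inv\<^bsub>BG 3\<^esub> g) (L g (0, inv c \<otimes> u))"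
      using that u by simp
    also have "\<dots> = L (inv\<^bsub>BG 3\<^esub> g \<otimes>\<^bsub>BG 3\<^esub> g) (0, inv c \<otimes> u)"
      using that u by (subst step) auto
    also have "\<dots> = (0, inv c \<otimes> u)" using that u Q_one by (simp add: B3.l_inv)
    finally show "L (inv\<^bsub>BG 3\<^esub> g) (0, u) = (0, inv c \<otimes> u)" .
  qed (use that in simp)
  have Q_mult: "?Q (g \<otimes>\<^bsub>BG 3\<^esub> h) (c \<otimes> d)" if "?Q g c" "?Q h d" "g \<in> carrier (BG 3)" "h \<in> carrier (BG 3)" for g h c d
    using that by (simp add: step m_assoc del: L.hom_mult)
  have "\<exists>c. ?Q g c" if "g \<in> generate (BG 3) {xF, yF, cB}" for g
    using that
  proof induction
    case one
    then show ?case using Q_one by blast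
  next
    case (incl h)
    then show ?case using gens by blast
  next
    case (inv h)
    then have "h \<in> carrier (BG 3)" by auto
    with inv show ?case using gens Q_inv by (metis (no_types, lifting) insertE singletonD)
  next
    case (eng g h)
    then have "g \<in> carrier (BG 3)" "h \<in> carrier (BG 3)"
      using PB_closed by (auto simp: PB3_generate[symmetric])
    with eng.IH Q_mult show ?case by blast
  qed
  then obtain \<phi> where \<phi>: "\<And>g. g \<in> PB 3 \<Longrightarrow> ?Q g (\<phi> g)"
    unfolding PB3_generate by metis
  have uniq: "c = d" if "?Q g c" "?Q g d" for g c d
    using that by (metis one_closed prod.inject r_one)
  have eq: "\<phi> g = c" if "?Q g c" "g \<in> PB 3" for g c
    using that \<phi>[of g] by (intro uniq[where g = g]) auto
  show thesis
  proof (rule that)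
    show "\<phi> \<in> hom (PBG 3) G"
    proof (rule homI)
      fix g h assume "g \<in> carrier (PBG 3)" "h \<in> carrier (PBG 3)"
      then have "g \<in> PB 3" "h \<in> PB 3" by simp_all
      then show "\<phi> (g \<otimes>\<^bsub>PBG 3\<^esub> h) = \<phi> g \<otimes> \<phi> h"
        using eq[OF Q_mult[OF \<phi> \<phi>], of g h] PB_closed subgroup.m_closed[OF subgroup_PB] by simp
    qed (use \<phi> in simp)
  qed (use eq gens xg_3_PB in blast)+
qed

lemma xg_3_commute_cB: "xF \<otimes>\<^bsub>BG 3\<^esub> cB = cB \<otimes>\<^bsub>BG 3\<^esub> xF" "yF \<otimes>\<^bsub>BG 3\<^esub> cB = cB \<otimes>\<^bsub>BG 3\<^esub> yF"
  using B3.p.xz B3.p.yz by (simp_all add: xg_3 cB_eq)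

section \<open>Relations between pure braids on four strands\<close>

context group
begin

definition centr :: "'a \<Rightarrow> 'a set" where
  "centr u = {g \<in> carrier G. g \<otimes> u = u \<otimes> g}"

lemma subgroup_centr: "u \<in> carrier G \<Longrightarrow> subgroup (centr u) G"
proof (rule subgroupI)
  assume u: "u \<in> carrier G"
  show "inv g \<in> centr u" if "g \<in> centr u" for g
    using that u unfolding centr_def
    by (auto simp: inv_solve_left inv_solve_right m_assoc)
  show "g \<otimes> h \<in> centr u" if "g \<in> centr u" "h \<in> centr u" for g h
    using that u unfolding centr_def by (auto simp: m_assoc) (metis m_assoc)
  show "centr u \<noteq> {}" using u unfolding centr_def by (auto intro: exI[of _ \<one>])
qed (auto simp: centr_def)

lemma centr_closed: "g \<in> centr u \<Longrightarrow> g \<in> carrier G"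
  by (simp add: centr_def)

lemma centr_sym: "g \<in> centr u \<Longrightarrow> u \<in> carrier G \<Longrightarrow> u \<in> centr g"
  by (simp add: centr_def)

lemma centr_refl: "u \<in> carrier G \<Longrightarrow> u \<in> centr u"
  by (simp add: centr_def)

lemma centr_intros:
  assumes "u \<in> carrier G"
  shows "g \<in> centr u \<Longrightarrow> h \<in> centr u \<Longrightarrow> g \<otimes> h \<in> centr u"
    and "g \<in> centr u \<Longrightarrow> inv g \<in> centr u"
    and "g \<in> centr u \<Longrightarrow> g [^] (k :: int) \<in> centr u"
    and "u \<in> centr u"
  using subgroup_centr[OF assms] centr_refl[OF assms] subgroup_int_pow_closed[of "centr u" g k]
  by (auto simp: subgroup.m_closed subgroup.m_inv_closed)

lemma hom_generate_centr:
  assumes "group H" "h \<in> hom H G" "S \<subseteq> carrier H" "u \<in> carrier G"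
    and "\<And>s. s \<in> S \<Longrightarrow> h s \<in> centr u" and "g \<in> generate H S"
  shows "h g \<in> centr u"
proof -
  interpret h: group_hom H G h using assms by (simp add: group_hom_def group_hom_axioms_def)
  show ?thesis
    using assms(6)
  proof induction
    case (inv x)
    then show ?case using assms(3) by (auto simp: assms(4,5) centr_intros subset_iff)
  next
    case (eng x y)
    moreover have "x \<in> carrier H" "y \<in> carrier H"
      using eng.hyps h.G.generate_in_carrier[OF assms(3)] by auto
    ultimately show ?case by (simp add: assms(4) centr_intros)
  qed (use assms(4,5) in \<open>auto simp: centr_def\<close>)
qed

text \<open>The hypothesis is the Artin relation of type B_2, and \<open>yxyx\<close> is central in
  the group it defines: in \<open>xyxyx\<close> the relation turns the first four letters into
  \<open>yxyx\<close>, and similarly for \<open>y\<close>.\<close>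

lemma typeB_centr:
  assumes "x \<in> carrier G" "y \<in> carrier G" "x \<otimes> (y \<otimes> (x \<otimes> y)) = y \<otimes> (x \<otimes> (y \<otimes> x))"
  shows "y \<otimes> (x \<otimes> (y \<otimes> x)) \<in> centr x" "y \<otimes> (x \<otimes> (y \<otimes> x)) \<in> centr y"
  using assms unfolding centr_def by (auto simp: m_assoc) (metis m_assoc m_closed)+

end

section \<open>Identities between positive braids on four strands\<close>

fun braid_move :: "nat \<Rightarrow> nat list \<Rightarrow> nat list" where
  "braid_move 0 (i # j # w) =
     (if (i, j) \<in> {(1, 3), (3, 1)} then j # i # w
      else if (i, j) \<in> {(1, 2), (2, 1), (2, 3), (3, 2)} \<and> w \<noteq> [] \<and> hd w = i then j # i # j # tl w
      else i # j # w)"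
| "braid_move (Suc n) (i # w) = i # braid_move n w"
| "braid_move n w = w"

locale braid4 = group +
  fixes a b c
  assumes a [simp]: "a \<in> carrier G" and b [simp]: "b \<in> carrier G" and c [simp]: "c \<in> carrier G"
    and ab: "a \<otimes> (b \<otimes> a) = b \<otimes> (a \<otimes> b)" and bc: "b \<otimes> (c \<otimes> b) = c \<otimes> (b \<otimes> c)"
    and ac: "a \<otimes> c = c \<otimes> a"
begin

sublocale ab: braid3 G a b by unfold_locales (simp_all add: ab)
sublocale bc: braid3 G b c by unfold_locales (simp_all add: bc)

lemma ac': "x \<in> carrier G \<Longrightarrow> a \<otimes> (c \<otimes> x) = c \<otimes> (a \<otimes> x)"
  using ac by (simp flip: m_assoc)

definition gen :: "nat \<Rightarrow> 'a" where
  "gen i = (if i = 1 then a else if i = 2 then b else c)"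

lemma gen_closed [simp]: "gen i \<in> carrier G"
  by (simp add: gen_def)

primrec pos_val :: "nat list \<Rightarrow> 'a" where
  "pos_val [] = \<one>"
| "pos_val (i # w) = gen i \<otimes> pos_val w"

lemma pos_val_closed [simp]: "pos_val w \<in> carrier G"
  by (induction w) auto

lemma pos_val_braid_move: "pos_val (braid_move n w) = pos_val w"
proof (induction n w rule: braid_move.induct)
  case (1 i j w)
  then show ?case
    by (cases w) (auto simp: gen_def ac ac' ab.braid' bc.braid')
qed auto

lemma pos_val_braid_moves: "pos_val (fold braid_move ns w) = pos_val w"
  by (induction ns arbitrary: w) (simp_all add: pos_val_braid_move)

text \<open>The list of positions is a certificate that is checked by evaluation. A position at
  which no relation applies leaves the word alone, so every list of positions preserves the
  value.\<close>

lemma pos_val_eqI: "fold braid_move ns u = v \<Longrightarrow> pos_val u = pos_val v"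
  using pos_val_braid_moves by metis

text \<open>\<open>W\<close> and \<open>W'\<close> stand for \<open>abccba\<close> and \<open>cbaabc\<close>. The positions at which relations are
  applied were found by a breadth-first search in the set of positive words.\<close>

lemma cW: "c \<otimes> (a \<otimes> (b \<otimes> (c \<otimes> (c \<otimes> (b \<otimes> a))))) = a \<otimes> (b \<otimes> (c \<otimes> (c \<otimes> (b \<otimes> (a \<otimes> c)))))"
  using pos_val_eqI[of "[0, 1, 3, 5]" "[3, 1, 2, 3, 3, 2, 1]" "[1, 2, 3, 3, 2, 1, 3]"]
  by (simp add: gen_def numeral_eq_Suc One_nat_def)

lemma bW: "b \<otimes> (a \<otimes> (b \<otimes> (c \<otimes> (c \<otimes> (b \<otimes> a))))) = a \<otimes> (b \<otimes> (c \<otimes> (c \<otimes> (b \<otimes> (a \<otimes> b)))))"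
  using pos_val_eqI[of "[0, 2, 3, 4]" "[2, 1, 2, 3, 3, 2, 1]" "[1, 2, 3, 3, 2, 1, 2]"]
  by (simp add: gen_def numeral_eq_Suc One_nat_def)

lemma aW': "a \<otimes> (c \<otimes> (b \<otimes> (a \<otimes> (a \<otimes> (b \<otimes> c))))) = c \<otimes> (b \<otimes> (a \<otimes> (a \<otimes> (b \<otimes> (c \<otimes> a)))))"
  using pos_val_eqI[of "[0, 1, 3, 5]" "[1, 3, 2, 1, 1, 2, 3]" "[3, 2, 1, 1, 2, 3, 1]"]
  by (simp add: gen_def numeral_eq_Suc One_nat_def)

lemma bW': "b \<otimes> (c \<otimes> (b \<otimes> (a \<otimes> (a \<otimes> (b \<otimes> c))))) = c \<otimes> (b \<otimes> (a \<otimes> (a \<otimes> (b \<otimes> (c \<otimes> b)))))"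
  using pos_val_eqI[of "[0, 2, 3, 4]" "[2, 3, 2, 1, 1, 2, 3]" "[3, 2, 1, 1, 2, 3, 2]"]
  by (simp add: gen_def numeral_eq_Suc One_nat_def)

lemma W_W':
  "c \<otimes> (b \<otimes> (b \<otimes> (c \<otimes> (a \<otimes> (b \<otimes> (c \<otimes> (c \<otimes> (b \<otimes> a)))))))) =
   a \<otimes> (b \<otimes> (b \<otimes> (a \<otimes> (c \<otimes> (b \<otimes> (a \<otimes> (a \<otimes> (b \<otimes> c))))))))"
  using pos_val_eqI[of "[3, 4, 2, 1, 6, 4, 3, 5, 4, 0, 1, 2, 8, 6, 4, 3]"
      "[3, 2, 2, 3, 1, 2, 3, 3, 2, 1]" "[1, 2, 2, 1, 3, 2, 1, 1, 2, 3]"]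
  by (simp add: gen_def numeral_eq_Suc One_nat_def)

text \<open>The type B_2 relation between the cabled word \<open>baab\<close> and \<open>c\<close>,
  and in the next lemma between \<open>bccb\<close> and \<open>a\<close>, in the form that
  \<open>typeB_centr\<close> asks for.\<close>

lemma typeB_12_3:
  "b \<otimes> (a \<otimes> (a \<otimes> (b \<otimes> (c \<otimes> (b \<otimes> (a \<otimes> (a \<otimes> (b \<otimes> c)))))))) =
   c \<otimes> (b \<otimes> (a \<otimes> (a \<otimes> (b \<otimes> (c \<otimes> (b \<otimes> (a \<otimes> (a \<otimes> b))))))))"
  using pos_val_eqI[of "[3, 2, 1, 5, 3, 2, 0, 2, 6, 7, 5, 4, 7, 6, 3, 4]"
      "[2, 1, 1, 2, 3, 2, 1, 1, 2, 3]" "[3, 2, 1, 1, 2, 3, 2, 1, 1, 2]"]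
  by (simp add: gen_def numeral_eq_Suc One_nat_def)

lemma typeB_2_34:
  "b \<otimes> (c \<otimes> (c \<otimes> (b \<otimes> (a \<otimes> (b \<otimes> (c \<otimes> (c \<otimes> (b \<otimes> a)))))))) =
   a \<otimes> (b \<otimes> (c \<otimes> (c \<otimes> (b \<otimes> (a \<otimes> (b \<otimes> (c \<otimes> (c \<otimes> b))))))))"
  using pos_val_eqI[of "[3, 5, 6, 7, 2, 3, 5, 1, 2, 0, 4, 2, 3, 7, 6, 4]"
      "[2, 3, 3, 2, 1, 2, 3, 3, 2, 1]" "[1, 2, 3, 3, 2, 1, 2, 3, 3, 2]"]
  by (simp add: gen_def numeral_eq_Suc One_nat_def)

end

section \<open>Cabled generators and the five homomorphisms\<close>

lemma xg_4:
  "xg 4 1 2 = sig 4 1 \<otimes>\<^bsub>BG 4\<^esub> sig 4 1"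
  "xg 4 2 3 = sig 4 2 \<otimes>\<^bsub>BG 4\<^esub> sig 4 2"
  "xg 4 3 4 = sig 4 3 \<otimes>\<^bsub>BG 4\<^esub> sig 4 3"
  "xg 4 1 3 = sig 4 2 \<otimes>\<^bsub>BG 4\<^esub> (sig 4 1 \<otimes>\<^bsub>BG 4\<^esub> (sig 4 1 \<otimes>\<^bsub>BG 4\<^esub> inv\<^bsub>BG 4\<^esub> sig 4 2))"
  "xg 4 2 4 = sig 4 3 \<otimes>\<^bsub>BG 4\<^esub> (sig 4 2 \<otimes>\<^bsub>BG 4\<^esub> (sig 4 2 \<otimes>\<^bsub>BG 4\<^esub> inv\<^bsub>BG 4\<^esub> sig 4 3))"
  "xg 4 1 4 = sig 4 3 \<otimes>\<^bsub>BG 4\<^esub> (xg 4 1 3 \<otimes>\<^bsub>BG 4\<^esub> inv\<^bsub>BG 4\<^esub> sig 4 3)"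
proof -
  interpret group "BG 4" by simp
  have [simp]: "[1 + 1..<4] = [2, 3]" "[1 + 1..<3] = [2]" "[2 + 1..<4] = [3]" by (simp_all add: upt_rec)
  show
    "xg 4 1 2 = sig 4 1 \<otimes>\<^bsub>BG 4\<^esub> sig 4 1"
    "xg 4 2 3 = sig 4 2 \<otimes>\<^bsub>BG 4\<^esub> sig 4 2"
    "xg 4 3 4 = sig 4 3 \<otimes>\<^bsub>BG 4\<^esub> sig 4 3"
    "xg 4 1 3 = sig 4 2 \<otimes>\<^bsub>BG 4\<^esub> (sig 4 1 \<otimes>\<^bsub>BG 4\<^esub> (sig 4 1 \<otimes>\<^bsub>BG 4\<^esub> inv\<^bsub>BG 4\<^esub> sig 4 2))"
    "xg 4 2 4 = sig 4 3 \<otimes>\<^bsub>BG 4\<^esub> (sig 4 2 \<otimes>\<^bsub>BG 4\<^esub> (sig 4 2 \<otimes>\<^bsub>BG 4\<^esub> inv\<^bsub>BG 4\<^esub> sig 4 3))"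
    "xg 4 1 4 = sig 4 3 \<otimes>\<^bsub>BG 4\<^esub> (xg 4 1 3 \<otimes>\<^bsub>BG 4\<^esub> inv\<^bsub>BG 4\<^esub> sig 4 3)"
    by (simp_all add: xg_def bclass_Cons bclass_Nil sig_closed m_assoc)
qed

interpretation B4: braid4 "BG 4" "sig 4 1" "sig 4 2" "sig 4 3"
  using sig_braid[of 1 4] sig_braid[of 2 4] sig_commute[of 1 3 4]
  by (intro braid4.intro braid4_axioms.intro) (auto intro: sig_closed simp: numeral_2_eq_2 numeral_3_eq_3 One_nat_def)

lemma xg_4_closed [simp]: "xg 4 1 2 \<in> PB 4" "xg 4 2 3 \<in> PB 4" "xg 4 3 4 \<in> PB 4"
  "xg 4 1 3 \<in> PB 4" "xg 4 2 4 \<in> PB 4" "xg 4 1 4 \<in> PB 4"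
proof -
  show 1: "xg 4 1 2 \<in> PB 4" "xg 4 2 3 \<in> PB 4" "xg 4 3 4 \<in> PB 4"
    by (simp_all add: xg_4 sig_sq_PB)
  show 2: "xg 4 1 3 \<in> PB 4" "xg 4 2 4 \<in> PB 4"
    using conj_PB[OF 1(1), of "sig 4 2"] conj_PB[OF 1(2), of "sig 4 3"] by (simp_all add: xg_4 B4.m_assoc)
  show "xg 4 1 4 \<in> PB 4"
    using conj_PB[OF 2(1), of "sig 4 3"] PB_closed[OF 2(1)] by (simp add: xg_4(6) B4.m_assoc)
qed

context braid3
begin

lemma conj_sq: "b \<otimes> (a \<otimes> (a \<otimes> inv b)) = inv a \<otimes> (b \<otimes> (b \<otimes> a))"
proof -
  have "a \<otimes> (b \<otimes> (a \<otimes> (a \<otimes> inv b))) = b \<otimes> (b \<otimes> a)" by (simp add: braid')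
  then show ?thesis by (metis a b inv_mult_cancel m_closed inv_closed)
qed

lemma conj_sq': "x \<in> carrier G \<Longrightarrow> b \<otimes> (a \<otimes> (a \<otimes> (inv b \<otimes> x))) = inv a \<otimes> (b \<otimes> (b \<otimes> (a \<otimes> x)))"
  using conj_sq by (simp flip: m_assoc)

end

text \<open>Each product is one strand encircling two neighbours: 3 around 1 and 2, 2 around 3 and
  4, 1 around 2 and 3, 4 around 2 and 3. Written without inverses, these braids are open to the
  identities between positive words.\<close>

lemma xg_4_cable:
  "xg 4 1 3 \<otimes>\<^bsub>BG 4\<^esub> xg 4 2 3 = sig 4 2 \<otimes>\<^bsub>BG 4\<^esub> (sig 4 1 \<otimes>\<^bsub>BG 4\<^esub> (sig 4 1 \<otimes>\<^bsub>BG 4\<^esub> sig 4 2))"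
  "xg 4 2 3 \<otimes>\<^bsub>BG 4\<^esub> xg 4 2 4 = sig 4 2 \<otimes>\<^bsub>BG 4\<^esub> (sig 4 3 \<otimes>\<^bsub>BG 4\<^esub> (sig 4 3 \<otimes>\<^bsub>BG 4\<^esub> sig 4 2))"
  "xg 4 1 2 \<otimes>\<^bsub>BG 4\<^esub> xg 4 1 3 = sig 4 1 \<otimes>\<^bsub>BG 4\<^esub> (sig 4 2 \<otimes>\<^bsub>BG 4\<^esub> (sig 4 2 \<otimes>\<^bsub>BG 4\<^esub> sig 4 1))"
  "xg 4 2 4 \<otimes>\<^bsub>BG 4\<^esub> xg 4 3 4 = sig 4 3 \<otimes>\<^bsub>BG 4\<^esub> (sig 4 2 \<otimes>\<^bsub>BG 4\<^esub> (sig 4 2 \<otimes>\<^bsub>BG 4\<^esub> sig 4 3))"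
  by (simp add: xg_4 B4.m_assoc, simp add: xg_4 B4.m_assoc B4.bc.conj_sq, simp add: xg_4 B4.m_assoc B4.ab.conj_sq,
      simp add: xg_4 B4.m_assoc)

text \<open>The five homomorphisms are prescribed on x_13, the map \<open>T_PB3\<close> on
  \<open>cB\<close>; for \<open>the_hom_eqI\<close> each needs generation by its own third
  element.\<close>

lemma PB3_generate': "PB 3 = generate (PBG 3) {xF, yF, xg 3 1 3}" "PB 3 = generate (PBG 3) {xF, yF, cB}"
proof -
  have "cB \<in> generate (BG 3) {xF, yF, xg 3 1 3}"
    unfolding cB_def by (intro generate.eng generate.incl) auto
  then have "{xF, yF, cB} \<subseteq> generate (BG 3) {xF, yF, xg 3 1 3}"
    by (auto intro: generate.incl)
  then have "PB 3 \<subseteq> generate (BG 3) {xF, yF, xg 3 1 3}"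
    unfolding PB3_generate by (rule B3.generate_subgroup_incl) (rule B3.generate_is_subgroup, simp)
  moreover have "generate (BG 3) {xF, yF, xg 3 1 3} \<subseteq> PB 3"
    by (rule B3.generate_subgroup_incl[OF _ subgroup_PB]) (simp add: xg_3_PB)
  ultimately show "PB 3 = generate (PBG 3) {xF, yF, xg 3 1 3}"
    using B3.generate_consistent[OF _ subgroup_PB, of "{xF, yF, xg 3 1 3}"] xg_3_PB
    by (simp add: PBG_def)
  show "PB 3 = generate (PBG 3) {xF, yF, cB}"
    using B3.generate_consistent[OF _ subgroup_PB, of "{xF, yF, cB}"] PB3_generate xg_3_PB
    by (simp add: PBG_def)
qed

lemma (in pure3) PB3_the_hom:
  defines "h \<equiv> the_hom (PBG 3) G {(xF, x), (yF, y), (cB, z)}"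
  shows "h \<in> hom (PBG 3) G" "h xF = x" "h yF = y" "h cB = z"
proof -
  obtain k where k: "k \<in> hom (PBG 3) G" "k xF = x" "k yF = y" "k cB = z" by (rule PB3_hom)
  have "h = restrict k (carrier (PBG 3))"
    unfolding h_def by (rule the_hom_eqI) (use k PB3_generate'(2) in auto)
  then show "h \<in> hom (PBG 3) G" "h xF = x" "h yF = y" "h cB = z"
    using k by (auto simp: xg_3_PB hom_def subgroup.m_closed[OF subgroup_PB])
qed

text \<open>\<open>PB3_hom\<close> takes a value at \<open>cB\<close>, not at x_13. Since
  \<open>cB\<close> is x_23 x_12 x_13, choosing \<open>yxd\<close> as its image forces
  \<open>d\<close> at x_13 by cancellation. What remains to be assumed is that \<open>yxd\<close>
  commutes with \<open>x\<close> and \<open>y\<close>.\<close>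

lemma pb_hom:
  assumes "x \<in> PB 4" "y \<in> PB 4" "d \<in> PB 4"
    and "y \<otimes>\<^bsub>BG 4\<^esub> x \<otimes>\<^bsub>BG 4\<^esub> d \<in> B4.centr x" "y \<otimes>\<^bsub>BG 4\<^esub> x \<otimes>\<^bsub>BG 4\<^esub> d \<in> B4.centr y"
  shows "pb_hom x y d \<in> hom (PBG 3) (PBG 4)" "pb_hom x y d xF = x" "pb_hom x y d yF = y"
    "pb_hom x y d (xg 3 1 3) = d"
proof -
  let ?z = "y \<otimes>\<^bsub>BG 4\<^esub> x \<otimes>\<^bsub>BG 4\<^esub> d"
  have m: "g \<otimes>\<^bsub>BG n\<^esub> h \<in> PB n" if "g \<in> PB n" "h \<in> PB n" for g h n
    using that by (rule subgroup.m_closed[OF subgroup_PB])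
  interpret P: pure3 "PBG 4" x y ?z
    using assms m by (intro pure3.intro pure3_axioms.intro) (auto simp: B4.centr_def)
  obtain k where k: "k \<in> hom (PBG 3) (PBG 4)" "k xF = x" "k yF = y" "k cB = ?z" by (rule P.PB3_hom)
  have kc: "k (xg 3 1 3) \<in> PB 4" using hom_in_carrier[OF k(1), of "xg 3 1 3"] xg_3_PB by simp
  have "k cB = k yF \<otimes>\<^bsub>PBG 4\<^esub> k xF \<otimes>\<^bsub>PBG 4\<^esub> k (xg 3 1 3)"
    using hom_mult[OF k(1), of "yF \<otimes>\<^bsub>BG 3\<^esub> xF" "xg 3 1 3"] hom_mult[OF k(1), of yF xF]
    by (simp add: cB_def xg_3_PB m)
  then have kd: "k (xg 3 1 3) = d"
    using k P.l_cancel[of "y \<otimes>\<^bsub>BG 4\<^esub> x" "k (xg 3 1 3)" d] assms(1-3) m kc by simp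
  then have "pb_hom x y d = restrict k (carrier (PBG 3))"
    unfolding pb_hom_def by (intro the_hom_eqI) (use k kd PB3_generate'(1) in auto)
  then show "pb_hom x y d \<in> hom (PBG 3) (PBG 4)" "pb_hom x y d xF = x" "pb_hom x y d yF = y"
    "pb_hom x y d (xg 3 1 3) = d"
    using k kd by (auto simp: xg_3_PB hom_def m)
qed

lemma PB_mult_closed: "g \<in> PB n \<Longrightarrow> h \<in> PB n \<Longrightarrow> g \<otimes>\<^bsub>BG n\<^esub> h \<in> PB n"
  by (rule subgroup.m_closed[OF subgroup_PB])

lemma phi_123: "phi_123 \<in> hom (PBG 3) (PBG 4)" "phi_123 xF = sig 4 1 \<otimes>\<^bsub>BG 4\<^esub> sig 4 1"
    "phi_123 yF = sig 4 2 \<otimes>\<^bsub>BG 4\<^esub> sig 4 2"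
    "phi_123 (xg 3 1 3) = xg 4 1 3"
proof -
  have z: "xg 4 2 3 \<otimes>\<^bsub>BG 4\<^esub> xg 4 1 2 \<otimes>\<^bsub>BG 4\<^esub> xg 4 1 3 = B4.ab.\<zeta>"
    using B4.ab.center_eq by (simp add: xg_4)
  have "B4.ab.\<zeta> \<in> B4.centr (xg 4 1 2)" "B4.ab.\<zeta> \<in> B4.centr (xg 4 2 3)"
    using B4.ab.p.xz B4.ab.p.yz by (simp_all add: B4.centr_def xg_4)
  note phi = pb_hom[of "xg 4 1 2" "xg 4 2 3" "xg 4 1 3", folded phi_123_def, unfolded z, OF _ _ _ this, simplified]
  show "phi_123 \<in> hom (PBG 3) (PBG 4)" "phi_123 xF = sig 4 1 \<otimes>\<^bsub>BG 4\<^esub> sig 4 1"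
    "phi_123 yF = sig 4 2 \<otimes>\<^bsub>BG 4\<^esub> sig 4 2"
    "phi_123 (xg 3 1 3) = xg 4 1 3"
    using phi by (simp_all add: xg_4)
qed

lemma phi_234: "phi_234 \<in> hom (PBG 3) (PBG 4)" "phi_234 xF = sig 4 2 \<otimes>\<^bsub>BG 4\<^esub> sig 4 2"
    "phi_234 yF = sig 4 3 \<otimes>\<^bsub>BG 4\<^esub> sig 4 3"
    "phi_234 (xg 3 1 3) = xg 4 2 4"
proof -
  have z: "xg 4 3 4 \<otimes>\<^bsub>BG 4\<^esub> xg 4 2 3 \<otimes>\<^bsub>BG 4\<^esub> xg 4 2 4 = B4.bc.\<zeta>"
    using B4.bc.center_eq by (simp add: xg_4)
  have "B4.bc.\<zeta> \<in> B4.centr (xg 4 2 3)" "B4.bc.\<zeta> \<in> B4.centr (xg 4 3 4)"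
    using B4.bc.p.xz B4.bc.p.yz by (simp_all add: B4.centr_def xg_4)
  note phi = pb_hom[of "xg 4 2 3" "xg 4 3 4" "xg 4 2 4", folded phi_234_def, unfolded z, OF _ _ _ this, simplified]
  show "phi_234 \<in> hom (PBG 3) (PBG 4)" "phi_234 xF = sig 4 2 \<otimes>\<^bsub>BG 4\<^esub> sig 4 2"
    "phi_234 yF = sig 4 3 \<otimes>\<^bsub>BG 4\<^esub> sig 4 3"
    "phi_234 (xg 3 1 3) = xg 4 2 4"
    using phi by (simp_all add: xg_4)
qed

lemma (in group) centr_conj: "g \<in> centr u \<Longrightarrow> u \<in> carrier G \<Longrightarrow> u \<otimes> g \<otimes> inv u = g"
  unfolding centr_def by (auto simp: inv_solve_right')

context braid4
begin

lemma cA: "c \<otimes> inv a = inv a \<otimes> c" and aC: "a \<otimes> inv c = inv c \<otimes> a"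
proof -
  have "inv a \<in> centr c" "inv c \<in> centr a" by (intro centr_intros, simp, simp add: centr_def ac)+
  then show "c \<otimes> inv a = inv a \<otimes> c" "a \<otimes> inv c = inv c \<otimes> a" by (simp_all add: centr_def)
qed

lemma cA': "x \<in> carrier G \<Longrightarrow> c \<otimes> (inv a \<otimes> x) = inv a \<otimes> (c \<otimes> x)"
  using cA by (simp flip: m_assoc)

lemma centr_12_3:
  defines "z \<equiv> c \<otimes> (b \<otimes> (a \<otimes> (a \<otimes> (b \<otimes> (c \<otimes> (b \<otimes> (a \<otimes> (a \<otimes> b))))))))"
  shows "z \<in> centr (b \<otimes> (a \<otimes> (a \<otimes> b)))" "z \<in> centr c"
  using typeB_centr[of "b \<otimes> (a \<otimes> (a \<otimes> b))" c] typeB_12_3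
  by (simp_all add: m_assoc z_def)

lemma centr_2_34:
  defines "z \<equiv> b \<otimes> (c \<otimes> (c \<otimes> (b \<otimes> (a \<otimes> (b \<otimes> (c \<otimes> (c \<otimes> (b \<otimes> a))))))))"
  shows "z \<in> centr a" "z \<in> centr (b \<otimes> (c \<otimes> (c \<otimes> b)))"
  using typeB_centr[of "b \<otimes> (c \<otimes> (c \<otimes> b))" a] typeB_2_34
  by (simp_all add: m_assoc z_def)

text \<open>\<open>z\<close> has two factorizations, equal by \<open>W_W'\<close>:
  \<open>cbbc\<close> times \<open>abccba\<close>, in which strand 1 encircles all others, and
  \<open>abba\<close> times \<open>cbaabc\<close>, in which strand 4 does. The first encircling
  commutes with \<open>b\<close> and \<open>c\<close>, the second with \<open>a\<close> and
  \<open>b\<close>, and each yields one of the two claims.\<close>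

lemma centr_1_23_4:
  defines "z \<equiv> c \<otimes> (b \<otimes> (b \<otimes> (c \<otimes> (a \<otimes> (b \<otimes> (c \<otimes> (c \<otimes> (b \<otimes> a))))))))"
  shows "z \<in> centr (c \<otimes> (b \<otimes> (b \<otimes> c)))" "z \<in> centr (a \<otimes> (b \<otimes> (b \<otimes> a)))"
proof -
  let ?W = "a \<otimes> (b \<otimes> (c \<otimes> (c \<otimes> (b \<otimes> a))))" and ?W' = "c \<otimes> (b \<otimes> (a \<otimes> (a \<otimes> (b \<otimes> c))))"
  let ?x = "a \<otimes> (b \<otimes> (b \<otimes> a))" and ?y = "c \<otimes> (b \<otimes> (b \<otimes> c))"
  have "b \<in> centr ?W" "c \<in> centr ?W" using bW cW by (simp_all add: centr_def m_assoc)
  then have "?y \<in> centr ?W" by (simp add: centr_intros)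
  then have "?W \<in> centr ?y" by (rule centr_sym) simp
  then have "?y \<otimes> ?W \<in> centr ?y" by (simp add: centr_intros)
  then show "z \<in> centr ?y" by (simp add: z_def m_assoc)
  have "a \<in> centr ?W'" "b \<in> centr ?W'" using aW' bW' by (simp_all add: centr_def m_assoc)
  then have "?x \<in> centr ?W'" by (simp add: centr_intros)
  then have "?W' \<in> centr ?x" by (rule centr_sym) simp
  then have "?x \<otimes> ?W' \<in> centr ?x" by (simp add: centr_intros)
  then show "z \<in> centr ?x" by (simp add: z_def m_assoc W_W')
qed

end

lemma xg_4_cable_PB [simp]:
  "sig 4 2 \<otimes>\<^bsub>BG 4\<^esub> (sig 4 1 \<otimes>\<^bsub>BG 4\<^esub> (sig 4 1 \<otimes>\<^bsub>BG 4\<^esub> sig 4 2)) \<in> PB 4"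
  "sig 4 2 \<otimes>\<^bsub>BG 4\<^esub> (sig 4 3 \<otimes>\<^bsub>BG 4\<^esub> (sig 4 3 \<otimes>\<^bsub>BG 4\<^esub> sig 4 2)) \<in> PB 4"
  "sig 4 1 \<otimes>\<^bsub>BG 4\<^esub> (sig 4 2 \<otimes>\<^bsub>BG 4\<^esub> (sig 4 2 \<otimes>\<^bsub>BG 4\<^esub> sig 4 1)) \<in> PB 4"
  "sig 4 3 \<otimes>\<^bsub>BG 4\<^esub> (sig 4 2 \<otimes>\<^bsub>BG 4\<^esub> (sig 4 2 \<otimes>\<^bsub>BG 4\<^esub> sig 4 3)) \<in> PB 4"
  by (simp_all flip: xg_4_cable add: PB_mult_closed)

lemma phi_12_3_4: "phi_12_3_4 \<in> hom (PBG 3) (PBG 4)"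
    "phi_12_3_4 xF = sig 4 2 \<otimes>\<^bsub>BG 4\<^esub> (sig 4 1 \<otimes>\<^bsub>BG 4\<^esub> (sig 4 1 \<otimes>\<^bsub>BG 4\<^esub> sig 4 2))"
    "phi_12_3_4 yF = sig 4 3 \<otimes>\<^bsub>BG 4\<^esub> sig 4 3"
proof -
  let ?x = "xg 4 1 3 \<otimes>\<^bsub>BG 4\<^esub> xg 4 2 3" and ?d = "xg 4 1 4 \<otimes>\<^bsub>BG 4\<^esub> xg 4 2 4"
  let ?z = "sig 4 3 \<otimes>\<^bsub>BG 4\<^esub> (sig 4 2 \<otimes>\<^bsub>BG 4\<^esub> (sig 4 1 \<otimes>\<^bsub>BG 4\<^esub> (sig 4 1 \<otimes>\<^bsub>BG 4\<^esub> (sig 4 2 \<otimes>\<^bsub>BG 4\<^esub>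
     (sig 4 3 \<otimes>\<^bsub>BG 4\<^esub> (sig 4 2 \<otimes>\<^bsub>BG 4\<^esub> (sig 4 1 \<otimes>\<^bsub>BG 4\<^esub> (sig 4 1 \<otimes>\<^bsub>BG 4\<^esub> sig 4 2))))))))"
  \<comment> \<open>The product comes out as the conjugate of \<open>?z\<close> by \<sigma>_3, which
    is \<open>?z\<close> itself because the two commute.\<close>
  have "xg 4 3 4 \<otimes>\<^bsub>BG 4\<^esub> ?x \<otimes>\<^bsub>BG 4\<^esub> ?d = sig 4 3 \<otimes>\<^bsub>BG 4\<^esub> ?z \<otimes>\<^bsub>BG 4\<^esub> inv\<^bsub>BG 4\<^esub> sig 4 3"
    unfolding xg_4_cable(1) by (simp add: xg_4 B4.m_assoc)
  also have "\<dots> = ?z"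
    using B4.centr_12_3(2) by (rule B4.centr_conj) simp
  finally have z: "xg 4 3 4 \<otimes>\<^bsub>BG 4\<^esub> ?x \<otimes>\<^bsub>BG 4\<^esub> ?d = ?z" .
  have "?z \<in> B4.centr (xg 4 3 4)"
    unfolding xg_4(3) by (rule B4.centr_sym, intro B4.centr_intros B4.centr_sym[OF B4.centr_12_3(2)]) simp_all
  then show "phi_12_3_4 \<in> hom (PBG 3) (PBG 4)"
    "phi_12_3_4 xF = sig 4 2 \<otimes>\<^bsub>BG 4\<^esub> (sig 4 1 \<otimes>\<^bsub>BG 4\<^esub> (sig 4 1 \<otimes>\<^bsub>BG 4\<^esub> sig 4 2))"
    "phi_12_3_4 yF = sig 4 3 \<otimes>\<^bsub>BG 4\<^esub> sig 4 3"
    using pb_hom[of ?x "xg 4 3 4" ?d, folded phi_12_3_4_def, unfolded z] B4.centr_12_3(1)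
    by (simp_all add: PB_mult_closed sig_sq_PB xg_4_cable xg_4(3))
qed

lemma phi_1_2_34: "phi_1_2_34 \<in> hom (PBG 3) (PBG 4)"
    "phi_1_2_34 xF = sig 4 1 \<otimes>\<^bsub>BG 4\<^esub> sig 4 1"
    "phi_1_2_34 yF = sig 4 2 \<otimes>\<^bsub>BG 4\<^esub> (sig 4 3 \<otimes>\<^bsub>BG 4\<^esub> (sig 4 3 \<otimes>\<^bsub>BG 4\<^esub> sig 4 2))"
proof -
  let ?y = "xg 4 2 3 \<otimes>\<^bsub>BG 4\<^esub> xg 4 2 4" and ?d = "xg 4 1 3 \<otimes>\<^bsub>BG 4\<^esub> xg 4 1 4"
  let ?z = "sig 4 2 \<otimes>\<^bsub>BG 4\<^esub> (sig 4 3 \<otimes>\<^bsub>BG 4\<^esub> (sig 4 3 \<otimes>\<^bsub>BG 4\<^esub> (sig 4 2 \<otimes>\<^bsub>BG 4\<^esub> (sig 4 1 \<otimes>\<^bsub>BG 4\<^esub>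
     (sig 4 2 \<otimes>\<^bsub>BG 4\<^esub> (sig 4 3 \<otimes>\<^bsub>BG 4\<^esub> (sig 4 3 \<otimes>\<^bsub>BG 4\<^esub> (sig 4 2 \<otimes>\<^bsub>BG 4\<^esub> sig 4 1))))))))"
  have z: "?y \<otimes>\<^bsub>BG 4\<^esub> xg 4 1 2 \<otimes>\<^bsub>BG 4\<^esub> ?d = ?z"
    unfolding xg_4_cable(2)
    by (simp add: xg_4 B4.m_assoc B4.ab.conj_sq B4.ab.conj_sq' B4.bc.conj_sq B4.bc.conj_sq' B4.cA B4.cA' B4.aC)
  have "?z \<in> B4.centr (xg 4 1 2)"
    unfolding xg_4(1) by (rule B4.centr_sym, intro B4.centr_intros B4.centr_sym[OF B4.centr_2_34(1)]) simp_all
  then show "phi_1_2_34 \<in> hom (PBG 3) (PBG 4)"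
    "phi_1_2_34 xF = sig 4 1 \<otimes>\<^bsub>BG 4\<^esub> sig 4 1"
    "phi_1_2_34 yF = sig 4 2 \<otimes>\<^bsub>BG 4\<^esub> (sig 4 3 \<otimes>\<^bsub>BG 4\<^esub> (sig 4 3 \<otimes>\<^bsub>BG 4\<^esub> sig 4 2))"
    using pb_hom[of "xg 4 1 2" ?y ?d, folded phi_1_2_34_def, unfolded z] B4.centr_2_34(2)
    by (simp_all add: PB_mult_closed sig_sq_PB xg_4_cable xg_4(1))
qed

lemma phi_1_23_4: "phi_1_23_4 \<in> hom (PBG 3) (PBG 4)"
    "phi_1_23_4 xF = sig 4 1 \<otimes>\<^bsub>BG 4\<^esub> (sig 4 2 \<otimes>\<^bsub>BG 4\<^esub> (sig 4 2 \<otimes>\<^bsub>BG 4\<^esub> sig 4 1))"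
    "phi_1_23_4 yF = sig 4 3 \<otimes>\<^bsub>BG 4\<^esub> (sig 4 2 \<otimes>\<^bsub>BG 4\<^esub> (sig 4 2 \<otimes>\<^bsub>BG 4\<^esub> sig 4 3))"
proof -
  let ?x = "xg 4 1 2 \<otimes>\<^bsub>BG 4\<^esub> xg 4 1 3" and ?y = "xg 4 2 4 \<otimes>\<^bsub>BG 4\<^esub> xg 4 3 4"
  let ?z = "sig 4 3 \<otimes>\<^bsub>BG 4\<^esub> (sig 4 2 \<otimes>\<^bsub>BG 4\<^esub> (sig 4 2 \<otimes>\<^bsub>BG 4\<^esub> (sig 4 3 \<otimes>\<^bsub>BG 4\<^esub> (sig 4 1 \<otimes>\<^bsub>BG 4\<^esub>
     (sig 4 2 \<otimes>\<^bsub>BG 4\<^esub> (sig 4 3 \<otimes>\<^bsub>BG 4\<^esub> (sig 4 3 \<otimes>\<^bsub>BG 4\<^esub> (sig 4 2 \<otimes>\<^bsub>BG 4\<^esub> sig 4 1))))))))"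
  have z: "?y \<otimes>\<^bsub>BG 4\<^esub> ?x \<otimes>\<^bsub>BG 4\<^esub> xg 4 1 4 = ?z"
    unfolding xg_4_cable
    by (simp add: xg_4 B4.m_assoc B4.ab.conj_sq B4.ab.conj_sq' B4.bc.conj_sq B4.bc.conj_sq' B4.cA B4.cA' B4.aC)
  show "phi_1_23_4 \<in> hom (PBG 3) (PBG 4)"
    "phi_1_23_4 xF = sig 4 1 \<otimes>\<^bsub>BG 4\<^esub> (sig 4 2 \<otimes>\<^bsub>BG 4\<^esub> (sig 4 2 \<otimes>\<^bsub>BG 4\<^esub> sig 4 1))"
    "phi_1_23_4 yF = sig 4 3 \<otimes>\<^bsub>BG 4\<^esub> (sig 4 2 \<otimes>\<^bsub>BG 4\<^esub> (sig 4 2 \<otimes>\<^bsub>BG 4\<^esub> sig 4 3))"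
    using pb_hom[of ?x ?y "xg 4 1 4", folded phi_1_23_4_def, unfolded z] B4.centr_1_23_4
    by (simp_all add: PB_mult_closed xg_4_cable)
qed

section \<open>The free group of rank two\<close>

lemma subgroup_F2: "subgroup F2 (BG 3)"
  unfolding F2_def by (rule B3.generate_is_subgroup) simp

lemma group_F2G [simp]: "group F2G"
  unfolding F2G_def by (rule subgroup.subgroup_is_group[OF subgroup_F2 group_BG])

lemma carrier_F2G [simp]: "carrier F2G = F2"
  by (simp add: F2G_def)

lemma mult_F2G: "x \<otimes>\<^bsub>F2G\<^esub> y = x \<otimes>\<^bsub>BG 3\<^esub> y"
  by (simp add: F2G_def)

lemma inv_F2G: "x \<in> F2 \<Longrightarrow> inv\<^bsub>F2G\<^esub> x = inv\<^bsub>BG 3\<^esub> x"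
  unfolding F2G_def by (rule B3.m_inv_consistent[OF subgroup_F2])

lemma pow_F2G: "x \<in> F2 \<Longrightarrow> x [^]\<^bsub>F2G\<^esub> (k :: int) = x [^]\<^bsub>BG 3\<^esub> k"
  unfolding F2G_def by (rule B3.int_pow_consistent[OF subgroup_F2, symmetric])

lemma F2_gens [simp]: "xF \<in> F2" "yF \<in> F2"
  unfolding F2_def by (auto intro: generate.incl)

lemma F2_generate: "F2 = generate F2G {xF, yF}"
  using B3.generate_consistent[OF _ subgroup_F2, of "{xF, yF}"] by (simp add: F2G_def F2_def[symmetric])

lemma F2_PB: "g \<in> F2 \<Longrightarrow> g \<in> PB 3"
  unfolding F2_def PB3_generate using B3.mono_generate[of "{xF, yF}" "{xF, yF, cB}"] by auto

lemma hom_PBG_F2G: "h \<in> hom (PBG 3) G \<Longrightarrow> h \<in> hom F2G G"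
  by (auto simp: hom_def F2_PB mult_F2G)

lemma F2_commute_cB:
  assumes "w \<in> F2"
  shows "w \<otimes>\<^bsub>BG 3\<^esub> cB [^]\<^bsub>BG 3\<^esub> (k :: int) = cB [^]\<^bsub>BG 3\<^esub> k \<otimes>\<^bsub>BG 3\<^esub> w"
proof -
  have "F2 \<subseteq> B3.centr cB"
    unfolding F2_def by (rule B3.generate_subgroup_incl[OF _ B3.subgroup_centr])
      (simp_all add: B3.centr_def xg_3_commute_cB)
  then have w: "w \<in> B3.centr cB" using assms by blast
  have "cB [^]\<^bsub>BG 3\<^esub> k \<in> B3.centr w"
    by (rule B3.centr_intros(3)[OF _ B3.centr_sym[OF w]]) (simp_all add: B3.centr_closed[OF w])
  then show ?thesis by (simp add: B3.centr_def)
qed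

lemma PB3_decompose:
  assumes "g \<in> PB 3"
  obtains w and k :: int where "w \<in> F2" "g = w \<otimes>\<^bsub>BG 3\<^esub> cB [^]\<^bsub>BG 3\<^esub> k"
proof -
  interpret F2: subgroup F2 "BG 3" by (rule subgroup_F2)
  have "\<exists>w\<in>F2. \<exists>k :: int. g = w \<otimes>\<^bsub>BG 3\<^esub> cB [^]\<^bsub>BG 3\<^esub> k" if "g \<in> generate (BG 3) {xF, yF, cB}" for g
    using that
  proof induction
    case one
    show ?case by (intro bexI[of _ "\<one>\<^bsub>BG 3\<^esub>"] exI[of _ 0]) auto
  next
    case (incl h)
    then consider "h \<in> F2" | "h = cB" by auto
    then show ?case
    proof cases
      case 1 then show ?thesis by (intro bexI[of _ h] exI[of _ 0]) auto
    next
      case 2 then show ?thesis by (intro bexI[of _ "\<one>\<^bsub>BG 3\<^esub>"] exI[of _ 1]) auto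
    qed
  next
    case (inv h)
    then consider "h \<in> F2" | "h = cB" by auto
    then show ?case
    proof cases
      case 1 then show ?thesis by (intro bexI[of _ "inv\<^bsub>BG 3\<^esub> h"] exI[of _ 0]) auto
    next
      case 2 then show ?thesis
        by (intro bexI[of _ "\<one>\<^bsub>BG 3\<^esub>"] exI[of _ "- 1"]) (auto simp: B3.int_pow_neg)
    qed
  next
    case (eng g h)
    then obtain w v k l where w: "w \<in> F2" "g = w \<otimes>\<^bsub>BG 3\<^esub> cB [^]\<^bsub>BG 3\<^esub> (k :: int)"
      and v: "v \<in> F2" "h = v \<otimes>\<^bsub>BG 3\<^esub> cB [^]\<^bsub>BG 3\<^esub> (l :: int)" by blast
    have "g \<otimes>\<^bsub>BG 3\<^esub> h = w \<otimes>\<^bsub>BG 3\<^esub> (cB [^]\<^bsub>BG 3\<^esub> k \<otimes>\<^bsub>BG 3\<^esub> v) \<otimes>\<^bsub>BG 3\<^esub> cB [^]\<^bsub>BG 3\<^esub> l"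
      using w v by (simp add: B3.m_assoc F2.mem_carrier)
    also have "cB [^]\<^bsub>BG 3\<^esub> k \<otimes>\<^bsub>BG 3\<^esub> v = v \<otimes>\<^bsub>BG 3\<^esub> cB [^]\<^bsub>BG 3\<^esub> k"
      by (rule F2_commute_cB[OF v(1), symmetric])
    also have "w \<otimes>\<^bsub>BG 3\<^esub> \<dots> \<otimes>\<^bsub>BG 3\<^esub> cB [^]\<^bsub>BG 3\<^esub> l = w \<otimes>\<^bsub>BG 3\<^esub> v \<otimes>\<^bsub>BG 3\<^esub> cB [^]\<^bsub>BG 3\<^esub> (k + l)"
      using w v by (simp add: B3.m_assoc F2.mem_carrier B3.int_pow_mult)
    finally show ?case using w(1) v(1) by blast
  qed
  with assms that show thesis unfolding PB3_generate by blast
qed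

text \<open>Freeness of \<open>F2\<close>: the unit commutes with everything, so it can be the value
  at \<open>cB\<close>, and the values at \<open>xF\<close> and \<open>yF\<close> are
  arbitrary.\<close>

lemma (in group) F2_the_hom:
  assumes "u \<in> carrier G" "v \<in> carrier G"
  defines "h \<equiv> the_hom F2G G {(xF, u), (yF, v)}"
  shows "h \<in> hom F2G G" "h xF = u" "h yF = v" "h \<in> extensional F2"
proof -
  interpret pure3 G u v \<one> using assms by unfold_locales auto
  obtain k where k: "k \<in> hom (PBG 3) G" "k xF = u" "k yF = v" by (rule PB3_hom)
  have h: "h = restrict k (carrier F2G)"
    unfolding h_def by (rule the_hom_eqI) (use k hom_PBG_F2G F2_generate in auto)
  then show "h xF = u" "h yF = v" "h \<in> extensional F2" using k by auto
  show "h \<in> hom F2G G"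
    using hom_PBG_F2G[OF k(1)] subgroup.m_closed[OF subgroup_F2] unfolding h
    by (auto simp: hom_def mult_F2G)
qed

lemma F2_hom_eqI:
  assumes "group G" "h \<in> hom F2G G" "k \<in> hom F2G G" "h xF = k xF" "h yF = k yF" "w \<in> F2"
  shows "h w = k w"
  by (rule hom_eq_on_generate[of F2G G h k "{xF, yF}"]) (use assms F2_generate in auto)

lemma E_F2:
  assumes "f \<in> F2"
  shows "E_F2 m f \<in> hom F2G F2G" "E_F2 m f xF = xF [^]\<^bsub>F2G\<^esub> (2 * m + 1)"
    "E_F2 m f yF = inv\<^bsub>F2G\<^esub> f \<otimes>\<^bsub>F2G\<^esub> yF [^]\<^bsub>F2G\<^esub> (2 * m + 1) \<otimes>\<^bsub>F2G\<^esub> f"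
proof -
  interpret F: group F2G by simp
  have "xF [^]\<^bsub>F2G\<^esub> (2 * m + 1) \<in> carrier F2G"
    "inv\<^bsub>F2G\<^esub> f \<otimes>\<^bsub>F2G\<^esub> yF [^]\<^bsub>F2G\<^esub> (2 * m + 1) \<otimes>\<^bsub>F2G\<^esub> f \<in> carrier F2G"
    using assms by (auto intro!: F.m_closed F.int_pow_closed F.inv_closed simp del: carrier_F2G) auto
  from F.F2_the_hom[OF this] show "E_F2 m f \<in> hom F2G F2G" "E_F2 m f xF = xF [^]\<^bsub>F2G\<^esub> (2 * m + 1)"
    "E_F2 m f yF = inv\<^bsub>F2G\<^esub> f \<otimes>\<^bsub>F2G\<^esub> yF [^]\<^bsub>F2G\<^esub> (2 * m + 1) \<otimes>\<^bsub>F2G\<^esub> f"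
    by (simp_all add: E_F2_def)
qed

context group
begin

text \<open>The conjugator stands on the right, as in the formulas for \<sigma>_2 and \<sigma>_3 in
  \<open>T_B4\<close>; a product therefore conjugates by its left factor first.\<close>

definition conj_by :: "'a \<Rightarrow> 'a \<Rightarrow> 'a" where
  "conj_by g x = inv g \<otimes> (x \<otimes> g)"

lemma conj_by_closed [simp]: "g \<in> carrier G \<Longrightarrow> x \<in> carrier G \<Longrightarrow> conj_by g x \<in> carrier G"
  by (simp add: conj_by_def)

lemma conj_by_hom: "g \<in> carrier G \<Longrightarrow> conj_by g \<in> hom G G"
  by (rule homI) (auto simp: conj_by_def m_assoc)

lemma conj_by_group_hom: "g \<in> carrier G \<Longrightarrow> group_hom G G (conj_by g)"
  by (simp add: group_hom_def group_hom_axioms_def conj_by_hom)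

lemma conj_by_mult:
  "g \<in> carrier G \<Longrightarrow> x \<in> carrier G \<Longrightarrow> y \<in> carrier G \<Longrightarrow> conj_by g (x \<otimes> y) = conj_by g x \<otimes> conj_by g y"
  by (simp add: conj_by_def m_assoc)

lemma conj_by_inv:
  "g \<in> carrier G \<Longrightarrow> x \<in> carrier G \<Longrightarrow> conj_by g (inv x) = inv (conj_by g x)"
  by (rule group_hom.hom_inv[OF conj_by_group_hom])

lemma conj_by_pow:
  "g \<in> carrier G \<Longrightarrow> x \<in> carrier G \<Longrightarrow> conj_by g (x [^] (k :: int)) = conj_by g x [^] k"
  by (rule group_hom.hom_int_pow[OF conj_by_group_hom])

lemma conj_by_conj_by:
  "g \<in> carrier G \<Longrightarrow> h \<in> carrier G \<Longrightarrow> x \<in> carrier G \<Longrightarrow> conj_by (g \<otimes> h) x = conj_by h (conj_by g x)"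
  by (simp add: conj_by_def m_assoc inv_mult_group)

lemma conj_by_centr: "g \<in> centr x \<Longrightarrow> x \<in> carrier G \<Longrightarrow> conj_by g x = x"
  by (auto simp: conj_by_def centr_def) (metis inv_mult_cancel)

lemma conj_by_eqI: "g \<in> carrier G \<Longrightarrow> x \<in> carrier G \<Longrightarrow> y \<in> carrier G \<Longrightarrow> x \<otimes> g = g \<otimes> y \<Longrightarrow> conj_by g x = y"
  by (simp add: conj_by_def)

lemma conj_byD: "g \<in> carrier G \<Longrightarrow> x \<in> carrier G \<Longrightarrow> conj_by g x = y \<Longrightarrow> x \<otimes> g = g \<otimes> y"
  by (auto simp: conj_by_def)

lemma pow_shift:
  assumes "x \<in> carrier G" "y \<in> carrier G" "u \<in> carrier G" "x \<otimes> u = u \<otimes> y"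
  shows "x [^] (k :: int) \<otimes> u = u \<otimes> y [^] k"
  using conj_by_eqI[of u x y] conj_by_pow[of u x k] conj_byD[of u "x [^] k"] assms by simp

lemma sq_pow: "x \<in> carrier G \<Longrightarrow> (x \<otimes> x) [^] (k :: int) = x [^] (2 * k)"
  by (simp only: mult_2 int_pow_mult int_pow_mult_distrib)

lemma pow_odd: "x \<in> carrier G \<Longrightarrow> x \<otimes> (x \<otimes> x) [^] (m :: int) = x [^] (2 * m + 1)"
  using int_pow_mult[of x 1 "2 * m"] by (simp add: sq_pow add.commute)

end

section \<open>The hexagons and the pentagon as equations in a group\<close>

context braid3
begin

text \<open>The hexagons give \<open>AB\<close> and \<open>BA\<close>. Multiplying \<open>BA\<close>
  by \<open>A\<close> on the left or by \<open>B\<close> on the right leads to \<Delta> \<zeta>^m f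
  in both cases, which is the braid relation. Multiplying \<open>AB\<close> by \<open>A\<close> on
  the right gives a second form f^-1 \<Delta> \<zeta>^m of \<open>ABA\<close>, and \<open>f\<close>
  cancels in the product of the two forms.\<close>

lemma hexagon:
  fixes m :: int and f
  defines "A \<equiv> a [^] (2 * m + 1)" and "B \<equiv> inv f \<otimes> (b [^] (2 * m + 1) \<otimes> f)"
  assumes f [simp]: "f \<in> carrier G"
    and hex1: "a \<otimes> (a \<otimes> a) [^] m \<otimes> inv f \<otimes> b \<otimes> (b \<otimes> b) [^] m \<otimes> f =
        inv f \<otimes> a \<otimes> b \<otimes> (a \<otimes> a) [^] (- m) \<otimes> \<zeta> [^] m"
    and hex2: "inv f \<otimes> b \<otimes> (b \<otimes> b) [^] m \<otimes> f \<otimes> a \<otimes> (a \<otimes> a) [^] m =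
        b \<otimes> a \<otimes> (b \<otimes> b) [^] (- m) \<otimes> \<zeta> [^] m \<otimes> f"
  shows "A \<otimes> (B \<otimes> A) = B \<otimes> (A \<otimes> B)"
    and "A \<otimes> (B \<otimes> A) \<otimes> (A \<otimes> (B \<otimes> A)) = \<zeta> [^] (2 * m + 1)"
proof -
  have [simp]: "A \<in> carrier G" "B \<in> carrier G" by (simp_all add: A_def B_def)
  have za: "\<zeta> [^] m \<otimes> a [^] k = a [^] k \<otimes> \<zeta> [^] m" "\<zeta> [^] m \<otimes> b [^] k = b [^] k \<otimes> \<zeta> [^] m" for k :: int
    using pow_shift[OF _ _ _ pow_shift[OF _ _ _ a_\<zeta>, symmetric], of k m]
      pow_shift[OF _ _ _ pow_shift[OF _ _ _ b_\<zeta>, symmetric], of k m] by simp_all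
  have AB: "A \<otimes> B = inv f \<otimes> (a \<otimes> (b \<otimes> ((a \<otimes> a) [^] (- m) \<otimes> \<zeta> [^] m)))"
    using hex1 by (simp add: A_def B_def m_assoc flip: pow_odd)
  have BA: "B \<otimes> A = b \<otimes> (a \<otimes> ((b \<otimes> b) [^] (- m) \<otimes> (\<zeta> [^] m \<otimes> f)))"
    using hex2 by (simp add: A_def B_def m_assoc flip: pow_odd)
  have cancel: "(x \<otimes> x) [^] (- m) \<otimes> x [^] (2 * m + 1) = x"
    "x [^] (2 * m + 1) \<otimes> (x \<otimes> x) [^] (- m) = x" if "x \<in> carrier G" for x
    using that int_pow_mult[OF that, of "2 * - m" "2 * m + 1"] int_pow_mult[OF that, of "2 * m + 1" "2 * - m"]
    by (simp_all add: sq_pow)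
  \<comment> \<open>Conjugation by \<open>b \<otimes> a\<close> carries \<open>a\<close> to
    \<open>b\<close>, hence powers to powers.\<close>
  have "a \<otimes> (b \<otimes> a) = b \<otimes> a \<otimes> b" by (simp add: braid m_assoc)
  then have shift: "A \<otimes> (b \<otimes> a) = b \<otimes> a \<otimes> b [^] (2 * m + 1)"
    unfolding A_def by (intro pow_shift) simp_all
  have "A \<otimes> (B \<otimes> A) = A \<otimes> (b \<otimes> a) \<otimes> (b \<otimes> b) [^] (- m) \<otimes> (\<zeta> [^] m \<otimes> f)"
    unfolding BA by (simp add: m_assoc)
  also have "\<dots> = b \<otimes> a \<otimes> (b [^] (2 * m + 1) \<otimes> (b \<otimes> b) [^] (- m)) \<otimes> (\<zeta> [^] m \<otimes> f)"
    unfolding shift by (simp add: m_assoc)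
  also have "\<dots> = \<Delta> \<otimes> (\<zeta> [^] m \<otimes> f)"
    by (simp add: cancel m_assoc \<Delta>_def braid braid')
  finally have ABA: "A \<otimes> (B \<otimes> A) = \<Delta> \<otimes> (\<zeta> [^] m \<otimes> f)" .
  have "B \<otimes> (A \<otimes> B) = (B \<otimes> A) \<otimes> B" by (simp add: m_assoc)
  also have "\<dots> = b \<otimes> a \<otimes> (b \<otimes> b) [^] (- m) \<otimes> (\<zeta> [^] m \<otimes> b [^] (2 * m + 1)) \<otimes> f"
    unfolding BA by (simp add: B_def m_assoc)
  also have "\<dots> = b \<otimes> a \<otimes> ((b \<otimes> b) [^] (- m) \<otimes> b [^] (2 * m + 1)) \<otimes> \<zeta> [^] m \<otimes> f"
    by (simp add: za m_assoc)
  also have "\<dots> = \<Delta> \<otimes> (\<zeta> [^] m \<otimes> f)"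
    by (simp add: cancel m_assoc \<Delta>_def braid braid')
  finally show "A \<otimes> (B \<otimes> A) = B \<otimes> (A \<otimes> B)" using ABA by simp
  have "A \<otimes> (B \<otimes> A) = (A \<otimes> B) \<otimes> A" by (simp add: m_assoc)
  also have "\<dots> = inv f \<otimes> (a \<otimes> b \<otimes> (a \<otimes> a) [^] (- m) \<otimes> (\<zeta> [^] m \<otimes> a [^] (2 * m + 1)))"
    unfolding AB by (simp add: A_def m_assoc)
  also have "\<dots> = inv f \<otimes> (a \<otimes> b \<otimes> ((a \<otimes> a) [^] (- m) \<otimes> a [^] (2 * m + 1)) \<otimes> \<zeta> [^] m)"
    by (simp add: za m_assoc)
  also have "\<dots> = inv f \<otimes> (\<Delta> \<otimes> \<zeta> [^] m)"
    by (simp add: cancel m_assoc \<Delta>_def)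
  finally have ABA': "A \<otimes> (B \<otimes> A) = inv f \<otimes> (\<Delta> \<otimes> \<zeta> [^] m)" .
  have "\<zeta> [^] m \<otimes> \<Delta> = \<Delta> \<otimes> \<zeta> [^] m"
    by (rule pow_shift) (simp_all add: \<zeta>_def m_assoc)
  then have "\<zeta> [^] m \<otimes> (\<Delta> \<otimes> \<zeta> [^] m) = \<Delta> \<otimes> (\<zeta> [^] m \<otimes> \<zeta> [^] m)"
    by (simp flip: m_assoc)
  \<comment> \<open>The two factors take different forms of \<open>ABA\<close>, so that
    \<open>f\<close> meets its inverse.\<close>
  moreover have "A \<otimes> (B \<otimes> A) \<otimes> (A \<otimes> (B \<otimes> A)) = \<Delta> \<otimes> (\<zeta> [^] m \<otimes> f) \<otimes> (inv f \<otimes> (\<Delta> \<otimes> \<zeta> [^] m))"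
    by (subst ABA', subst ABA) rule
  ultimately have "A \<otimes> (B \<otimes> A) \<otimes> (A \<otimes> (B \<otimes> A)) = \<zeta> \<otimes> (\<zeta> [^] m \<otimes> \<zeta> [^] m)"
    by (simp add: m_assoc) (simp add: \<zeta>_def m_assoc)
  also have "\<dots> = \<zeta> [^] (2 * m + 1)"
    using int_pow_mult_distrib[of \<zeta> \<zeta> m] pow_odd[of \<zeta> m] by simp
  finally show "A \<otimes> (B \<otimes> A) \<otimes> (A \<otimes> (B \<otimes> A)) = \<zeta> [^] (2 * m + 1)" .
qed

end

text \<open>The conditions of a shadow, moved from cosets to equations in a group \<open>G\<close>,
  which will be the quotient by \<open>N\<close>. The five maps stand for the homomorphisms from
  \<open>PB 3\<close> followed by the projection; they are taken on \<open>F2\<close>, where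
  \<open>f\<close> and the endomorphism live.\<close>

locale shadow4 = braid4 +
  fixes P_123 P_234 P_12_3_4 P_1_23_4 P_1_2_34 :: "braid \<Rightarrow> 'a" and m :: int and f :: braid
  assumes P_hom: "P_123 \<in> hom F2G G" "P_234 \<in> hom F2G G" "P_12_3_4 \<in> hom F2G G"
      "P_1_23_4 \<in> hom F2G G" "P_1_2_34 \<in> hom F2G G"
    and P_xF: "P_123 xF = a \<otimes> a" "P_234 xF = b \<otimes> b" "P_12_3_4 xF = b \<otimes> (a \<otimes> (a \<otimes> b))"
      "P_1_23_4 xF = a \<otimes> (b \<otimes> (b \<otimes> a))" "P_1_2_34 xF = a \<otimes> a"
    and P_yF: "P_123 yF = b \<otimes> b" "P_234 yF = c \<otimes> c" "P_12_3_4 yF = c \<otimes> c"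
      "P_1_23_4 yF = c \<otimes> (b \<otimes> (b \<otimes> c))" "P_1_2_34 yF = b \<otimes> (c \<otimes> (c \<otimes> b))"
    and f: "f \<in> F2"
    and hex_123:
      "a \<otimes> (a \<otimes> a) [^] m \<otimes> inv P_123 f \<otimes> b \<otimes> (b \<otimes> b) [^] m \<otimes> P_123 f =
        inv P_123 f \<otimes> a \<otimes> b \<otimes> (a \<otimes> a) [^] (- m) \<otimes> ab.\<zeta> [^] m"
      "inv P_123 f \<otimes> b \<otimes> (b \<otimes> b) [^] m \<otimes> P_123 f \<otimes> a \<otimes> (a \<otimes> a) [^] m =
        b \<otimes> a \<otimes> (b \<otimes> b) [^] (- m) \<otimes> ab.\<zeta> [^] m \<otimes> P_123 f"
    and hex_234:
      "b \<otimes> (b \<otimes> b) [^] m \<otimes> inv P_234 f \<otimes> c \<otimes> (c \<otimes> c) [^] m \<otimes> P_234 f =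
        inv P_234 f \<otimes> b \<otimes> c \<otimes> (b \<otimes> b) [^] (- m) \<otimes> bc.\<zeta> [^] m"
      "inv P_234 f \<otimes> c \<otimes> (c \<otimes> c) [^] m \<otimes> P_234 f \<otimes> b \<otimes> (b \<otimes> b) [^] m =
        c \<otimes> b \<otimes> (c \<otimes> c) [^] (- m) \<otimes> bc.\<zeta> [^] m \<otimes> P_234 f"
    and pent: "P_234 f \<otimes> (P_1_23_4 f \<otimes> P_123 f) = P_1_2_34 f \<otimes> P_12_3_4 f"
begin

abbreviation "n \<equiv> 2 * m + 1"

lemma P_closed [simp]:
  "w \<in> F2 \<Longrightarrow> P_123 w \<in> carrier G" "w \<in> F2 \<Longrightarrow> P_234 w \<in> carrier G" "w \<in> F2 \<Longrightarrow> P_12_3_4 w \<in> carrier G"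
  "w \<in> F2 \<Longrightarrow> P_1_23_4 w \<in> carrier G" "w \<in> F2 \<Longrightarrow> P_1_2_34 w \<in> carrier G"
  using P_hom[THEN hom_in_carrier] by simp_all

lemmas Pf_closed [simp] = P_closed[OF f]

lemma P_centr:
  assumes "h \<in> hom F2G G" "u \<in> carrier G" "h xF \<in> centr u" "h yF \<in> centr u"
  shows "h f \<in> centr u"
  by (rule hom_generate_centr[of F2G h "{xF, yF}"]) (use assms f F2_generate in auto)

lemma P_123_centr: "P_123 f \<in> centr ab.\<zeta>"
proof (rule P_centr)
  have "a \<in> centr ab.\<zeta>" "b \<in> centr ab.\<zeta>" using ab.a_\<zeta> ab.b_\<zeta> by (simp_all add: centr_def)
  then show "P_123 xF \<in> centr ab.\<zeta>" "P_123 yF \<in> centr ab.\<zeta>" by (simp_all add: P_xF P_yF centr_intros)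
qed (simp_all add: P_hom)

lemma P_234_centr: "P_234 f \<in> centr bc.\<zeta>"
proof (rule P_centr)
  have "b \<in> centr bc.\<zeta>" "c \<in> centr bc.\<zeta>" using bc.a_\<zeta> bc.b_\<zeta> by (simp_all add: centr_def)
  then show "P_234 xF \<in> centr bc.\<zeta>" "P_234 yF \<in> centr bc.\<zeta>" by (simp_all add: P_xF P_yF centr_intros)
qed (simp_all add: P_hom)

text \<open>Strands 1 and 2 form a cable, and the crossing \<open>a\<close> inside it commutes with
  whatever the cable does. The next two lemmas are the same for the cables 2, 3 and 3, 4.\<close>

lemma P_12_3_4_centr: "P_12_3_4 f \<in> centr a"
proof (rule P_centr)
  have "a \<in> centr a" "c \<in> centr a" "ab.\<zeta> \<in> centr a"
    using ab.a_\<zeta> ac by (simp_all add: centr_def)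
  then show "P_12_3_4 xF \<in> centr a" "P_12_3_4 yF \<in> centr a"
    by (simp_all add: P_xF P_yF centr_intros ab.baab)
qed (simp_all add: P_hom)

lemma P_1_23_4_centr: "P_1_23_4 f \<in> centr b"
proof (rule P_centr)
  have "b \<in> centr b" "ab.\<zeta> \<in> centr b" "bc.\<zeta> \<in> centr b"
    using ab.b_\<zeta> bc.a_\<zeta> by (simp_all add: centr_def)
  then show "P_1_23_4 xF \<in> centr b" "P_1_23_4 yF \<in> centr b"
    by (simp_all add: P_xF P_yF centr_intros ab.abba bc.baab)
qed (simp_all add: P_hom)

lemma P_1_2_34_centr: "P_1_2_34 f \<in> centr c"
proof (rule P_centr)
  have "a \<in> centr c" "c \<in> centr c" "bc.\<zeta> \<in> centr c"
    using bc.b_\<zeta> ac by (simp_all add: centr_def)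
  then show "P_1_2_34 xF \<in> centr c" "P_1_2_34 yF \<in> centr c"
    by (simp_all add: P_xF P_yF centr_intros bc.abba)
qed (simp_all add: P_hom)

lemma conj_pow_centr:
  assumes "g \<in> centr u" "u \<in> carrier G"
  shows "conj_by g (u [^] (k :: int)) = u [^] k"
  using assms by (simp add: conj_by_pow conj_by_centr centr_closed)

text \<open>The conjugator that carries the hexagon solution on strands 2, 3, 4, namely
  \<open>b [^] n\<close> and the conjugate of \<open>c [^] n\<close> by \<open>P_234 f\<close>, to
  the pair \<open>T2\<close>, \<open>T3\<close>. It is the left side of the pentagon without its
  first factor.\<close>

definition "g = P_1_23_4 f \<otimes> P_123 f"

lemma g_closed [simp]: "g \<in> carrier G" by (simp add: g_def)

definition "T1 = a [^] n"
definition "T2 = conj_by (P_123 f) (b [^] n)"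
definition "T3 = conj_by (P_12_3_4 f) (c [^] n)"

lemma T_closed [simp]: "T1 \<in> carrier G" "T2 \<in> carrier G" "T3 \<in> carrier G"
  by (simp_all add: T1_def T2_def T3_def)

lemma T2_eq: "T2 = conj_by g (b [^] n)"
  by (simp add: g_def conj_by_conj_by conj_pow_centr[OF P_1_23_4_centr] T2_def)

lemma pent_conj:
  "x \<in> carrier G \<Longrightarrow> conj_by g (conj_by (P_234 f) x) = conj_by (P_12_3_4 f) (conj_by (P_1_2_34 f) x)"
  using pent by (simp add: g_def flip: conj_by_conj_by)

text \<open>Conjugation by \<open>P_1_2_34 f\<close> fixes powers of \<open>c\<close>, so it may be
  inserted first; then the pentagon exchanges the conjugator
  \<open>P_1_2_34 f \<otimes> P_12_3_4 f\<close> for \<open>P_234 f \<otimes> g\<close>.\<close>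

lemma T3_eq: "T3 = conj_by g (conj_by (P_234 f) (c [^] n))"
  by (simp add: pent_conj conj_pow_centr[OF P_1_2_34_centr] T3_def)

lemma T12: "T1 \<otimes> (T2 \<otimes> T1) = T2 \<otimes> (T1 \<otimes> T2)" "T1 \<otimes> (T2 \<otimes> T1) \<otimes> (T1 \<otimes> (T2 \<otimes> T1)) = ab.\<zeta> [^] n"
  using ab.hexagon[OF _ hex_123] by (simp_all add: T1_def T2_def conj_by_def)

lemma T23: "T2 \<otimes> (T3 \<otimes> T2) = T3 \<otimes> (T2 \<otimes> T3)"
    "T2 \<otimes> (T3 \<otimes> T2) \<otimes> (T2 \<otimes> (T3 \<otimes> T2)) = conj_by g (bc.\<zeta> [^] n)"
proof -
  let ?B = "b [^] n" and ?C = "conj_by (P_234 f) (c [^] n)"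
  have "?B \<otimes> (?C \<otimes> ?B) = ?C \<otimes> (?B \<otimes> ?C)" "?B \<otimes> (?C \<otimes> ?B) \<otimes> (?B \<otimes> (?C \<otimes> ?B)) = bc.\<zeta> [^] n"
    using bc.hexagon[OF _ hex_234] by (simp_all add: conj_by_def)
  then have "conj_by g (?B \<otimes> (?C \<otimes> ?B)) = conj_by g (?C \<otimes> (?B \<otimes> ?C))"
    "conj_by g (?B \<otimes> (?C \<otimes> ?B) \<otimes> (?B \<otimes> (?C \<otimes> ?B))) = conj_by g (bc.\<zeta> [^] n)"
    by simp_all
  then show "T2 \<otimes> (T3 \<otimes> T2) = T3 \<otimes> (T2 \<otimes> T3)"
    "T2 \<otimes> (T3 \<otimes> T2) \<otimes> (T2 \<otimes> (T3 \<otimes> T2)) = conj_by g (bc.\<zeta> [^] n)"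
    by (simp_all add: conj_by_mult T2_eq T3_eq)
qed

lemma T13: "T1 \<otimes> T3 = T3 \<otimes> T1"
proof -
  have a: "P_12_3_4 f \<in> centr a" "c \<in> centr a" using P_12_3_4_centr ac by (simp_all add: centr_def)
  then have "T3 \<in> centr a" by (simp add: T3_def conj_by_def centr_intros)
  then have "a \<in> centr T3" by (rule centr_sym) simp
  then have "T1 \<in> centr T3" by (simp add: T1_def centr_intros)
  then show ?thesis by (simp add: centr_def)
qed

sublocale T: braid4 G T1 T2 T3
  by unfold_locales (simp_all add: T12 T23 T13)

text \<open>With the full twists of the new solution known, \<open>T.ab.baab\<close> and its
  companions evaluate the cabled words in \<open>T1\<close>, \<open>T2\<close>,
  \<open>T3\<close>.\<close>

lemma T_\<zeta>: "T.ab.\<zeta> = ab.\<zeta> [^] n" "T.bc.\<zeta> = conj_by g (bc.\<zeta> [^] n)"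
  by (simp_all only: T.ab.\<zeta>_def T.ab.\<Delta>_def T.bc.\<zeta>_def T.bc.\<Delta>_def T12(2) T23(2))

text \<open>On a free group it is enough to compare at \<open>xF\<close> and \<open>yF\<close>. The
  element \<open>u\<close> is the conjugator by which \<open>h\<close>, later \<open>T_B4\<close>
  after one of the five homomorphisms, differs from that homomorphism after \<open>E_F2 m f\<close>;
  the same \<open>u\<close> has to serve both generators.\<close>

lemma hom_E_F2_eqI:
  assumes "h \<in> hom F2G G" "P \<in> hom F2G G" "u \<in> carrier G" "w \<in> F2"
    and "h xF = conj_by u (P xF [^] n)" "h yF = conj_by u (conj_by (P f) (P yF [^] n))"
  shows "h w = conj_by u (P (E_F2 m f w))"
proof -
  interpret P: group_hom F2G G P using assms by (simp add: group_hom_def group_hom_axioms_def)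
  note E = E_F2[OF f, of m]
  have "h w = (conj_by u \<circ> (P \<circ> E_F2 m f)) w"
  proof (rule F2_hom_eqI)
    show "conj_by u \<circ> (P \<circ> E_F2 m f) \<in> hom F2G G"
      by (rule Group.hom_compose[OF Group.hom_compose[OF E(1) assms(2)] conj_by_hom[OF assms(3)]])
    show "h xF = (conj_by u \<circ> (P \<circ> E_F2 m f)) xF"
      using assms P.hom_int_pow[of xF n] by (simp add: E)
    show "h yF = (conj_by u \<circ> (P \<circ> E_F2 m f)) yF"
      using assms f P.hom_int_pow[of yF n] P.G.int_pow_closed[of yF n] P.G.inv_closed[of f]
        P.G.m_closed[of "inv\<^bsub>F2G\<^esub> f" "yF [^]\<^bsub>F2G\<^esub> n"]
      by (simp add: E conj_by_def[of "P f"] m_assoc)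
  qed (use assms in auto)
  then show ?thesis by simp
qed

text \<open>All factors commute, so the power is taken factor by factor. The result has the shape of
  \<open>baab\<close> again, with powers in place of \<open>x\<close> and \<open>z\<close>, and so
  matches the cabled words in \<open>T1\<close>, \<open>T2\<close>, \<open>T3\<close>.\<close>

lemma pow_inv_inv:
  assumes "x \<otimes> z = z \<otimes> x" "x \<in> carrier G" "z \<in> carrier G"
  shows "(inv x \<otimes> (inv x \<otimes> z)) [^] (k :: int) = inv (x [^] k) \<otimes> (inv (x [^] k) \<otimes> z [^] k)"
proof -
  have "x \<in> centr z" using assms by (simp add: centr_def)
  then have "inv x \<in> centr z" "inv x \<otimes> z \<in> centr (inv x)"
    using assms centr_intros(2)[of z x] centr_sym[of "inv x" z] by (simp_all add: centr_intros)
  then have "inv x \<otimes> z = z \<otimes> inv x" "inv x \<otimes> (inv x \<otimes> z) = (inv x \<otimes> z) \<otimes> inv x"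
    by (simp_all add: centr_def)
  from this[THEN int_pow_mult_distrib, of k] show ?thesis using assms(2,3) by (simp add: int_pow_inv)
qed

lemmas sq_pow' = int_pow_mult_distrib[OF HOL.refl]

lemma T_phi_123:
  assumes "h \<in> hom F2G G" "h xF = T1 \<otimes> T1" "h yF = T2 \<otimes> T2" "w \<in> F2"
  shows "h w = conj_by \<one> (P_123 (E_F2 m f w))"
  by (rule hom_E_F2_eqI[OF assms(1) P_hom(1) _ assms(4)])
    (simp_all add: assms P_xF P_yF sq_pow' conj_by_mult, simp_all add: T1_def T2_def conj_by_def)

lemma T_phi_234:
  assumes "h \<in> hom F2G G" "h xF = T2 \<otimes> T2" "h yF = T3 \<otimes> T3" "w \<in> F2"
  shows "h w = conj_by g (P_234 (E_F2 m f w))"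
  by (rule hom_E_F2_eqI[OF assms(1) P_hom(2) _ assms(4)])
    (simp_all add: assms P_xF P_yF sq_pow' conj_by_mult T2_eq T3_eq)

lemma T_phi_12_3_4:
  assumes "h \<in> hom F2G G" "h xF = T2 \<otimes> (T1 \<otimes> (T1 \<otimes> T2))" "h yF = T3 \<otimes> T3" "w \<in> F2"
  shows "h w = conj_by \<one> (P_12_3_4 (E_F2 m f w))"
  by (rule hom_E_F2_eqI[OF assms(1) P_hom(3) _ assms(4)])
    (simp_all add: assms P_xF P_yF sq_pow' conj_by_mult T.ab.baab T_\<zeta> ab.baab pow_inv_inv ab.a_\<zeta>,
     simp_all add: T1_def T3_def conj_by_def)

text \<open>At \<open>xF\<close> the conjugator is \<open>P_123 f\<close>, because \<open>T2\<close>
  is a conjugate by it and it commutes with \<open>ab.\<zeta>\<close>. At \<open>yF\<close> the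
  conjugator is \<open>g\<close>, that is \<open>P_1_23_4 f\<close> followed by the same
  \<open>P_123 f\<close>; the first factor is the one that comes from the conjugation by
  \<open>f\<close> in the value of the endomorphism.\<close>

lemma T_phi_1_23_4:
  assumes "h \<in> hom F2G G" "h xF = T1 \<otimes> (T2 \<otimes> (T2 \<otimes> T1))" "h yF = T3 \<otimes> (T2 \<otimes> (T2 \<otimes> T3))" "w \<in> F2"
  shows "h w = conj_by (P_123 f) (P_1_23_4 (E_F2 m f w))"
proof (rule hom_E_F2_eqI[OF assms(1) P_hom(4) _ assms(4)])
  show "h xF = conj_by (P_123 f) (P_1_23_4 xF [^] n)"
    by (simp add: assms T.ab.abba T_\<zeta>)
      (simp add: P_xF ab.abba pow_inv_inv ab.b_\<zeta> conj_by_mult conj_by_inv T2_def conj_pow_centr[OF P_123_centr])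
  show "h yF = conj_by (P_123 f) (conj_by (P_1_23_4 f) (P_1_23_4 yF [^] n))"
    by (simp add: assms T.bc.baab T_\<zeta>)
      (simp add: P_yF bc.baab pow_inv_inv bc.a_\<zeta> conj_by_mult conj_by_inv T2_eq flip: g_def conj_by_conj_by)
qed simp

text \<open>\<open>P_12_3_4 f\<close> commutes with \<open>a\<close>, so conjugating by it is
  harmless at \<open>xF\<close>. At \<open>yF\<close> the computation gives the conjugator
  \<open>P_234 f \<otimes> g\<close>, and the pentagon rewrites it with \<open>P_12_3_4 f\<close> as
  its last factor.\<close>

lemma T_phi_1_2_34:
  assumes "h \<in> hom F2G G" "h xF = T1 \<otimes> T1" "h yF = T2 \<otimes> (T3 \<otimes> (T3 \<otimes> T2))" "w \<in> F2"
  shows "h w = conj_by (P_12_3_4 f) (P_1_2_34 (E_F2 m f w))"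
proof (rule hom_E_F2_eqI[OF assms(1) P_hom(5) _ assms(4)])
  show "h xF = conj_by (P_12_3_4 f) (P_1_2_34 xF [^] n)"
    by (simp add: assms P_xF sq_pow' conj_by_mult T1_def conj_pow_centr[OF P_12_3_4_centr])
  have "h yF = conj_by g (conj_by (P_234 f) (P_1_2_34 yF [^] n))"
    by (simp add: assms T.bc.abba T_\<zeta>)
      (simp add: P_yF bc.abba pow_inv_inv bc.b_\<zeta> conj_by_mult conj_by_inv T3_eq conj_pow_centr[OF P_234_centr])
  then show "h yF = conj_by (P_12_3_4 f) (conj_by (P_1_2_34 f) (P_1_2_34 yF [^] n))"
    by (simp add: pent_conj P_yF)
qed simp

lemma T_hom:
  obtains T where "T \<in> hom (BG 4) G" "T (sig 4 1) = T1" "T (sig 4 2) = T2" "T (sig 4 3) = T3"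
proof -
  define t where "t i = (if i = (1 :: nat) then T1 else if i = 2 then T2 else T3)" for i
  obtain T where T: "T \<in> hom (BG 4) G" "\<And>i. i \<in> {1..<4} \<Longrightarrow> T (sig 4 i) = t i"
  proof (rule BG_hom[of 4 t])
    fix i :: nat assume "1 \<le> i" "i + 1 < 4"
    then have "i = 1 \<or> i = 2" by auto
    then show "t i \<otimes> (t (i + 1) \<otimes> t i) = t (i + 1) \<otimes> (t i \<otimes> t (i + 1))"
      using T12 T23 by (auto simp: t_def)
  next
    fix i j :: nat assume "1 \<le> i" "i + 2 \<le> j" "j < 4"
    then have "i = 1 \<and> j = 3" by auto
    then show "t i \<otimes> t j = t j \<otimes> t i" using T13 by (simp add: t_def)
  qed (auto simp: t_def)
  then show thesis using that by (simp add: t_def)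
qed

end

section \<open>GT-shadows in the quotient groups\<close>

text \<open>Units and products of the quotient groups stay symbolic from here on, so that the
  simplifier applies group laws and does not unfold cosets into sets.\<close>

declare one_FactGroup [simp del] mult_FactGroup [simp del]

lemma inv_PBG: "x \<in> PB n \<Longrightarrow> inv\<^bsub>PBG n\<^esub> x = inv\<^bsub>BG n\<^esub> x"
  unfolding PBG_def by (rule group.m_inv_consistent[OF group_BG subgroup_PB])

lemma pow_PBG: "x \<in> PB n \<Longrightarrow> x [^]\<^bsub>PBG n\<^esub> (k :: int) = x [^]\<^bsub>BG n\<^esub> k"
  unfolding PBG_def by (rule group.int_pow_consistent[OF group_BG subgroup_PB, symmetric])

lemma F2_ops [simp]:
  "x \<in> F2 \<Longrightarrow> y \<in> F2 \<Longrightarrow> x \<otimes>\<^bsub>BG 3\<^esub> y \<in> F2"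
  "x \<in> F2 \<Longrightarrow> inv\<^bsub>BG 3\<^esub> x \<in> F2"
  "x \<in> F2 \<Longrightarrow> x [^]\<^bsub>BG 3\<^esub> (k :: int) \<in> F2"
  "\<one>\<^bsub>BG 3\<^esub> \<in> F2"
  using subgroup_F2 B3.subgroup_int_pow_closed[OF subgroup_F2]
  by (auto simp: subgroup.m_closed subgroup.m_inv_closed subgroup.one_closed)

lemma one_F2G: "\<one>\<^bsub>F2G\<^esub> = \<one>\<^bsub>BG 3\<^esub>"
  by (simp add: F2G_def)

lemma hom_PBG_BG: "h \<in> hom G (PBG n) \<Longrightarrow> h \<in> hom G (BG n)"
  by (auto simp: hom_def PB_closed Pi_iff)

lemma (in group) inv_mult_eq_one_iff:
  assumes "x \<in> carrier G" "y \<in> carrier G"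
  shows "inv x \<otimes> y = \<one> \<longleftrightarrow> x = y"
  by (metis assms l_inv mult_inv_cancel r_one)

lemma (in normal) lcoset_hom: "(\<lambda>g. g <# H) \<in> hom G (G Mod H)"
  using r_coset_hom_Mod coset_eq by (auto simp: hom_def Pi_iff)

lemma (in normal) lcoset_eq_iff:
  assumes "g \<in> carrier G"
  shows "g <# H = H \<longleftrightarrow> g \<in> H"
  using coset_join3[OF assms subgroup_axioms] lcos_self[OF assms subgroup_axioms] by auto

locale quotient4 =
  fixes N
  assumes N: "N \<lhd> BG 4" "N \<subseteq> PB 4"
begin

sublocale N: normal N "BG 4" by (rule N)

abbreviation "Q \<equiv> BG 4 Mod N"

definition qt :: "braid \<Rightarrow> braid set" where "qt g = g <#\<^bsub>BG 4\<^esub> N"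

sublocale Q: group Q by (rule N.factorgroup_is_group)

lemma qt_hom: "qt \<in> hom (BG 4) Q"
  using N.lcoset_hom by (simp add: qt_def[abs_def])

sublocale qt: group_hom "BG 4" Q qt
  by (simp add: group_hom_def group_hom_axioms_def qt_hom Q.group_axioms)

lemma qt_one_iff: "g \<in> carrier (BG 4) \<Longrightarrow> qt g = \<one>\<^bsub>Q\<^esub> \<longleftrightarrow> g \<in> N"
  using N.lcoset_eq_iff by (simp add: qt_def one_FactGroup)

lemma qt_phi_hom:
  "h \<in> hom (PBG 3) (PBG 4) \<Longrightarrow> qt \<circ> h \<in> hom (PBG 3) Q"
  using Group.hom_compose[OF hom_PBG_BG qt_hom] .

lemma N3_normal: "N3 N \<lhd> PBG 3"
proof -
  have n: "{g \<in> PB 3. h g \<in> N} \<lhd> PBG 3" if "h \<in> hom (PBG 3) (PBG 4)" for h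
  proof -
    interpret h: group_hom "PBG 3" Q "qt \<circ> h"
      using qt_phi_hom[OF that] by (simp add: group_hom_def group_hom_axioms_def Q.group_axioms)
    have "qt (h g) = \<one>\<^bsub>Q\<^esub> \<longleftrightarrow> h g \<in> N" if "g \<in> PB 3" for g
      using that hom_in_carrier[OF \<open>h \<in> hom (PBG 3) (PBG 4)\<close>, of g] PB_closed qt_one_iff by simp
    then have "kernel (PBG 3) Q (qt \<circ> h) = {g \<in> PB 3. h g \<in> N}"
      unfolding kernel_def by auto
    then show ?thesis using h.normal_kernel by simp
  qed
  interpret PB3: group "PBG 3" by simp
  have "N3 N = {g \<in> PB 3. phi_123 g \<in> N} \<inter> {g \<in> PB 3. phi_234 g \<in> N} \<inter> {g \<in> PB 3. phi_12_3_4 g \<in> N}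
      \<inter> {g \<in> PB 3. phi_1_23_4 g \<in> N} \<inter> {g \<in> PB 3. phi_1_2_34 g \<in> N}"
    by (auto simp: N3_def)
  then show ?thesis
    by (simp only:) (intro PB3.normal_subgroup_intersect n phi_123 phi_234 phi_12_3_4 phi_1_23_4 phi_1_2_34)
qed

sublocale N3: normal "N3 N" "PBG 3" by (rule N3_normal)

abbreviation "R \<equiv> PBG 3 Mod N3 N"

definition rt :: "braid \<Rightarrow> braid set" where "rt g = g <#\<^bsub>PBG 3\<^esub> N3 N"

sublocale R: group R by (rule N3.factorgroup_is_group)

lemma rt_hom: "rt \<in> hom (PBG 3) R"
  using N3.lcoset_hom by (simp add: rt_def[abs_def])

sublocale rt: group_hom "PBG 3" R rt
  by (simp add: group_hom_def group_hom_axioms_def rt_hom R.group_axioms)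

lemma rt_one_iff: "g \<in> PB 3 \<Longrightarrow> rt g = \<one>\<^bsub>R\<^esub> \<longleftrightarrow> g \<in> N3 N"
  using N3.lcoset_eq_iff by (simp add: rt_def one_FactGroup)

lemma rt_eq_iff:
  assumes "g \<in> PB 3" "h \<in> PB 3"
  shows "rt g = rt h \<longleftrightarrow> inv\<^bsub>BG 3\<^esub> g \<otimes>\<^bsub>BG 3\<^esub> h \<in> N3 N"
proof -
  have "inv\<^bsub>PBG 3\<^esub> g \<in> PB 3" using assms N3.inv_closed[of g] by simp
  then have "inv\<^bsub>PBG 3\<^esub> g \<otimes>\<^bsub>PBG 3\<^esub> h \<in> N3 N \<longleftrightarrow> rt (inv\<^bsub>PBG 3\<^esub> g \<otimes>\<^bsub>PBG 3\<^esub> h) = \<one>\<^bsub>R\<^esub>"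
    using assms by (subst rt_one_iff) (simp_all add: PB_mult_closed)
  also have "\<dots> \<longleftrightarrow> inv\<^bsub>R\<^esub> (rt g) \<otimes>\<^bsub>R\<^esub> rt h = \<one>\<^bsub>R\<^esub>"
    using assms rt.hom_mult[of "inv\<^bsub>PBG 3\<^esub> g" h] rt.hom_inv[of g] \<open>inv\<^bsub>PBG 3\<^esub> g \<in> PB 3\<close>
    by simp
  also have "\<dots> \<longleftrightarrow> rt g = rt h"
    using assms by (intro R.inv_mult_eq_one_iff rt.hom_closed) simp_all
  finally show ?thesis using assms by (simp add: inv_PBG)
qed

text \<open>\<open>hexagons\<close> compares cosets in the full braid group, whereas normality of
  \<open>N3 N\<close> was shown inside \<open>PB 3\<close>.\<close>

lemma subgroup_N3: "subgroup (N3 N) (BG 3)"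
proof -
  have "subgroup (N3 N) (PBG 3)" by (rule N3.subgroup_axioms)
  then show ?thesis
    unfolding PBG_def by (rule B3.incl_subgroup[OF subgroup_PB])
qed

sublocale q4: braid4 Q "qt (sig 4 1)" "qt (sig 4 2)" "qt (sig 4 3)"
  using B4.ab B4.bc B4.ac by unfold_locales (simp_all flip: qt.hom_mult)

text \<open>The hexagons involve \<sigma>_1 and \<sigma>_2, which are not pure; so \<phi> is
  replaced by \<iota>, which agrees with it on \<open>PB 3\<close> and is defined on all braids.
  Equal left cosets differ by an element of \<open>N3 N\<close>, whose image lies in
  \<open>N\<close>, so each hexagon becomes an equation in \<open>Q\<close>.\<close>

lemma hexagon_image:
  assumes \<iota>: "\<iota> \<in> hom (BG 3) (BG 4)" and \<phi>: "\<And>g. g \<in> N3 N \<Longrightarrow> \<phi> g \<in> N" "\<And>g. g \<in> PB 3 \<Longrightarrow> \<phi> g = \<iota> g"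
    and f: "f \<in> F2" and hex: "hexagons N m f"
  defines "a \<equiv> qt (\<iota> (sig 3 1))" and "b \<equiv> qt (\<iota> (sig 3 2))" and "F \<equiv> qt (\<phi> f)"
  defines "z \<equiv> a \<otimes>\<^bsub>Q\<^esub> (b \<otimes>\<^bsub>Q\<^esub> a) \<otimes>\<^bsub>Q\<^esub> (a \<otimes>\<^bsub>Q\<^esub> (b \<otimes>\<^bsub>Q\<^esub> a))"
  shows "a \<otimes>\<^bsub>Q\<^esub> (a \<otimes>\<^bsub>Q\<^esub> a) [^]\<^bsub>Q\<^esub> m \<otimes>\<^bsub>Q\<^esub> inv\<^bsub>Q\<^esub> F \<otimes>\<^bsub>Q\<^esub> b \<otimes>\<^bsub>Q\<^esub> (b \<otimes>\<^bsub>Q\<^esub> b) [^]\<^bsub>Q\<^esub> m \<otimes>\<^bsub>Q\<^esub> F =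
        inv\<^bsub>Q\<^esub> F \<otimes>\<^bsub>Q\<^esub> a \<otimes>\<^bsub>Q\<^esub> b \<otimes>\<^bsub>Q\<^esub> (a \<otimes>\<^bsub>Q\<^esub> a) [^]\<^bsub>Q\<^esub> (- m) \<otimes>\<^bsub>Q\<^esub> z [^]\<^bsub>Q\<^esub> m"
    and "inv\<^bsub>Q\<^esub> F \<otimes>\<^bsub>Q\<^esub> b \<otimes>\<^bsub>Q\<^esub> (b \<otimes>\<^bsub>Q\<^esub> b) [^]\<^bsub>Q\<^esub> m \<otimes>\<^bsub>Q\<^esub> F \<otimes>\<^bsub>Q\<^esub> a \<otimes>\<^bsub>Q\<^esub> (a \<otimes>\<^bsub>Q\<^esub> a) [^]\<^bsub>Q\<^esub> m =
        b \<otimes>\<^bsub>Q\<^esub> a \<otimes>\<^bsub>Q\<^esub> (b \<otimes>\<^bsub>Q\<^esub> b) [^]\<^bsub>Q\<^esub> (- m) \<otimes>\<^bsub>Q\<^esub> z [^]\<^bsub>Q\<^esub> m \<otimes>\<^bsub>Q\<^esub> F"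
proof -
  interpret \<iota>: group_hom "BG 3" "BG 4" \<iota>
    using \<iota> by (simp add: group_hom_def group_hom_axioms_def)
  have eq: "qt (\<iota> g) = qt (\<iota> h)"
    if "g <#\<^bsub>BG 3\<^esub> N3 N = h <#\<^bsub>BG 3\<^esub> N3 N" "g \<in> carrier (BG 3)" "h \<in> carrier (BG 3)" for g h
  proof -
    have "inv\<^bsub>BG 3\<^esub> g \<otimes>\<^bsub>BG 3\<^esub> h \<in> N3 N"
      using subgroup.lcos_module_imp[OF subgroup_N3 group_BG that(2)]
        B3.lcos_self[OF that(3) subgroup_N3] that(1) by simp
    then have "\<iota> (inv\<^bsub>BG 3\<^esub> g \<otimes>\<^bsub>BG 3\<^esub> h) \<in> N" using \<phi> by (simp add: N3_def)
    then have "qt (\<iota> (inv\<^bsub>BG 3\<^esub> g \<otimes>\<^bsub>BG 3\<^esub> h)) = \<one>\<^bsub>Q\<^esub>"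
      using that by (subst qt_one_iff) auto
    then show ?thesis using that by (simp add: Q.inv_mult_eq_one_iff)
  qed
  have fc: "f \<in> carrier (BG 3)" and F: "F = qt (\<iota> f)" using f \<phi>(2)[of f] by (simp_all add: F2_PB PB_closed F_def)
  have z: "z = qt (\<iota> cB)" by (simp add: cB_eq B3.\<zeta>_def B3.\<Delta>_def z_def a_def b_def)
  have ab: "a \<otimes>\<^bsub>Q\<^esub> a = qt (\<iota> xF)" "b \<otimes>\<^bsub>Q\<^esub> b = qt (\<iota> yF)" by (simp_all add: xg_3 a_def b_def)
  show "a \<otimes>\<^bsub>Q\<^esub> (a \<otimes>\<^bsub>Q\<^esub> a) [^]\<^bsub>Q\<^esub> m \<otimes>\<^bsub>Q\<^esub> inv\<^bsub>Q\<^esub> F \<otimes>\<^bsub>Q\<^esub> b \<otimes>\<^bsub>Q\<^esub> (b \<otimes>\<^bsub>Q\<^esub> b) [^]\<^bsub>Q\<^esub> m \<otimes>\<^bsub>Q\<^esub> F =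
        inv\<^bsub>Q\<^esub> F \<otimes>\<^bsub>Q\<^esub> a \<otimes>\<^bsub>Q\<^esub> b \<otimes>\<^bsub>Q\<^esub> (a \<otimes>\<^bsub>Q\<^esub> a) [^]\<^bsub>Q\<^esub> (- m) \<otimes>\<^bsub>Q\<^esub> z [^]\<^bsub>Q\<^esub> m"
    using eq[OF conjunct1[OF hex[unfolded hexagons_def]]] fc
    by (simp add: ab z F) (simp add: a_def b_def \<iota>.hom_int_pow qt.hom_int_pow)
  show "inv\<^bsub>Q\<^esub> F \<otimes>\<^bsub>Q\<^esub> b \<otimes>\<^bsub>Q\<^esub> (b \<otimes>\<^bsub>Q\<^esub> b) [^]\<^bsub>Q\<^esub> m \<otimes>\<^bsub>Q\<^esub> F \<otimes>\<^bsub>Q\<^esub> a \<otimes>\<^bsub>Q\<^esub> (a \<otimes>\<^bsub>Q\<^esub> a) [^]\<^bsub>Q\<^esub> m =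
        b \<otimes>\<^bsub>Q\<^esub> a \<otimes>\<^bsub>Q\<^esub> (b \<otimes>\<^bsub>Q\<^esub> b) [^]\<^bsub>Q\<^esub> (- m) \<otimes>\<^bsub>Q\<^esub> z [^]\<^bsub>Q\<^esub> m \<otimes>\<^bsub>Q\<^esub> F"
    using eq[OF conjunct2[OF hex[unfolded hexagons_def]]] fc
    by (simp add: ab z F) (simp add: a_def b_def \<iota>.hom_int_pow qt.hom_int_pow)
qed

end

lemma strand_inclusion:
  assumes "k \<le> 1"
  obtains \<iota> where "\<iota> \<in> hom (BG 3) (BG 4)" "\<iota> (sig 3 1) = sig 4 (k + 1)" "\<iota> (sig 3 2) = sig 4 (k + 2)"
proof -
  obtain \<iota> where "\<iota> \<in> hom (BG 3) (BG 4)" "\<And>i. i \<in> {1..<3} \<Longrightarrow> \<iota> (sig 3 i) = sig 4 (k + i)"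
  proof (rule B4.BG_hom[of 3 "\<lambda>i. sig 4 (k + i)"])
    show "sig 4 (k + i) \<otimes>\<^bsub>BG 4\<^esub> (sig 4 (k + (i + 1)) \<otimes>\<^bsub>BG 4\<^esub> sig 4 (k + i)) =
        sig 4 (k + (i + 1)) \<otimes>\<^bsub>BG 4\<^esub> (sig 4 (k + i) \<otimes>\<^bsub>BG 4\<^esub> sig 4 (k + (i + 1)))"
      if "1 \<le> i" "i + 1 < 3" for i
      using sig_braid[of "k + i" 4] that assms by (simp add: One_nat_def)
  qed (use assms in \<open>auto intro!: sig_closed\<close>)
  then show thesis using that by simp
qed

lemma PB3_hom_eqI:
  assumes "group G" "h \<in> hom (PBG 3) G" "k \<in> hom (PBG 3) G" "h xF = k xF" "h yF = k yF"
    "h (xg 3 1 3) = k (xg 3 1 3)" "w \<in> PB 3"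
  shows "h w = k w"
  by (rule hom_eq_on_generate[of "PBG 3" G h k "{xF, yF, xg 3 1 3}"])
    (use assms PB3_generate'(1) xg_3_PB in auto)

lemma phi_123_strand_inclusion:
  obtains \<iota> where "\<iota> \<in> hom (BG 3) (BG 4)" "\<iota> (sig 3 1) = sig 4 1" "\<iota> (sig 3 2) = sig 4 2"
    "\<And>g. g \<in> PB 3 \<Longrightarrow> phi_123 g = \<iota> g"
proof -
  obtain \<iota> where \<iota>: "\<iota> \<in> hom (BG 3) (BG 4)" "\<iota> (sig 3 1) = sig 4 1" "\<iota> (sig 3 2) = sig 4 2"
    using strand_inclusion[of 0] unfolding add_0 by auto
  interpret \<iota>: group_hom "BG 3" "BG 4" \<iota> using \<iota> by (simp add: group_hom_def group_hom_axioms_def)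
  have h: "\<iota> \<in> hom (PBG 3) (BG 4)" using \<iota>(1) by (auto simp: hom_def PB_closed)
  have "phi_123 g = \<iota> g" if "g \<in> PB 3" for g
    by (rule PB3_hom_eqI[OF group_BG hom_PBG_BG[OF phi_123(1)] h _ _ _ that])
      (simp_all add: phi_123, simp_all add: xg_3 \<iota> xg_4 B4.m_assoc)
  with \<iota> that show thesis by blast
qed

lemma phi_234_strand_inclusion:
  obtains \<iota> where "\<iota> \<in> hom (BG 3) (BG 4)" "\<iota> (sig 3 1) = sig 4 2" "\<iota> (sig 3 2) = sig 4 3"
    "\<And>g. g \<in> PB 3 \<Longrightarrow> phi_234 g = \<iota> g"
proof -
  obtain \<iota> where \<iota>: "\<iota> \<in> hom (BG 3) (BG 4)" "\<iota> (sig 3 1) = sig 4 2" "\<iota> (sig 3 2) = sig 4 3"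
    using strand_inclusion[of 1] by auto
  interpret \<iota>: group_hom "BG 3" "BG 4" \<iota> using \<iota> by (simp add: group_hom_def group_hom_axioms_def)
  have h: "\<iota> \<in> hom (PBG 3) (BG 4)" using \<iota>(1) by (auto simp: hom_def PB_closed)
  have "phi_234 g = \<iota> g" if "g \<in> PB 3" for g
    by (rule PB3_hom_eqI[OF group_BG hom_PBG_BG[OF phi_234(1)] h _ _ _ that])
      (simp_all add: phi_234, simp_all add: xg_3 \<iota> xg_4 B4.m_assoc)
  with \<iota> that show thesis by blast
qed

section \<open>A representative of a shadow and its source\<close>

locale gt_rep = quotient4 +
  fixes m f
  assumes rep: "is_gt_rep N m f"
begin

lemma f: "f \<in> F2" using rep by (simp add: is_gt_rep_def)

lemma qt_phi_F2_hom: "h \<in> hom (PBG 3) (PBG 4) \<Longrightarrow> qt \<circ> h \<in> hom F2G Q"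
  by (rule hom_PBG_F2G[OF qt_phi_hom])

lemma phi_PB:
  assumes "g \<in> PB 3"
  shows "phi_123 g \<in> PB 4" "phi_234 g \<in> PB 4" "phi_12_3_4 g \<in> PB 4" "phi_1_23_4 g \<in> PB 4" "phi_1_2_34 g \<in> PB 4"
  using assms hom_in_carrier[OF phi_123(1)] hom_in_carrier[OF phi_234(1)] hom_in_carrier[OF phi_12_3_4(1)]
    hom_in_carrier[OF phi_1_23_4(1)] hom_in_carrier[OF phi_1_2_34(1)] by simp_all

lemmas phi_closed [simp] = phi_PB[THEN PB_closed]

text \<open>\<open>phi_123\<close> and \<open>phi_234\<close> extend to inclusions of braid groups,
  and through these the hexagons reach \<sigma>_1, \<sigma>_2 and \<sigma>_2, \<sigma>_3 in the
  quotient.\<close>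

sublocale S: shadow4 Q "qt (sig 4 1)" "qt (sig 4 2)" "qt (sig 4 3)" "qt \<circ> phi_123" "qt \<circ> phi_234"
  "qt \<circ> phi_12_3_4" "qt \<circ> phi_1_23_4" "qt \<circ> phi_1_2_34" m f
proof (intro shadow4.intro shadow4_axioms.intro)
  show "braid4 Q (qt (sig 4 1)) (qt (sig 4 2)) (qt (sig 4 3))" by (rule q4.braid4_axioms)
  have hex: "hexagons N m f" and pent: "pentagon N f" using rep by (simp_all add: is_gt_rep_def)
  obtain \<iota> where \<iota>: "\<iota> \<in> hom (BG 3) (BG 4)" "\<iota> (sig 3 1) = sig 4 1" "\<iota> (sig 3 2) = sig 4 2"
    "\<And>g. g \<in> PB 3 \<Longrightarrow> phi_123 g = \<iota> g" by (rule phi_123_strand_inclusion) blast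
  have \<phi>: "phi_123 g \<in> N" "phi_234 g \<in> N" if "g \<in> N3 N" for g using that by (simp_all add: N3_def)
  note h = hexagon_image[OF \<iota>(1) \<phi>(1) \<iota>(4) f hex, simplified \<iota>]
  show "qt (sig 4 1) \<otimes>\<^bsub>Q\<^esub> (qt (sig 4 1) \<otimes>\<^bsub>Q\<^esub> qt (sig 4 1)) [^]\<^bsub>Q\<^esub> m \<otimes>\<^bsub>Q\<^esub> inv\<^bsub>Q\<^esub> (qt \<circ> phi_123) f \<otimes>\<^bsub>Q\<^esub>
      qt (sig 4 2) \<otimes>\<^bsub>Q\<^esub> (qt (sig 4 2) \<otimes>\<^bsub>Q\<^esub> qt (sig 4 2)) [^]\<^bsub>Q\<^esub> m \<otimes>\<^bsub>Q\<^esub> (qt \<circ> phi_123) f =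
      inv\<^bsub>Q\<^esub> (qt \<circ> phi_123) f \<otimes>\<^bsub>Q\<^esub> qt (sig 4 1) \<otimes>\<^bsub>Q\<^esub> qt (sig 4 2) \<otimes>\<^bsub>Q\<^esub>
      (qt (sig 4 1) \<otimes>\<^bsub>Q\<^esub> qt (sig 4 1)) [^]\<^bsub>Q\<^esub> (- m) \<otimes>\<^bsub>Q\<^esub> q4.ab.\<zeta> [^]\<^bsub>Q\<^esub> m"
    using h by (simp add: q4.ab.\<zeta>_def q4.ab.\<Delta>_def)
  show "inv\<^bsub>Q\<^esub> (qt \<circ> phi_123) f \<otimes>\<^bsub>Q\<^esub> qt (sig 4 2) \<otimes>\<^bsub>Q\<^esub> (qt (sig 4 2) \<otimes>\<^bsub>Q\<^esub> qt (sig 4 2)) [^]\<^bsub>Q\<^esub> m \<otimes>\<^bsub>Q\<^esub>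
      (qt \<circ> phi_123) f \<otimes>\<^bsub>Q\<^esub> qt (sig 4 1) \<otimes>\<^bsub>Q\<^esub> (qt (sig 4 1) \<otimes>\<^bsub>Q\<^esub> qt (sig 4 1)) [^]\<^bsub>Q\<^esub> m =
      qt (sig 4 2) \<otimes>\<^bsub>Q\<^esub> qt (sig 4 1) \<otimes>\<^bsub>Q\<^esub> (qt (sig 4 2) \<otimes>\<^bsub>Q\<^esub> qt (sig 4 2)) [^]\<^bsub>Q\<^esub> (- m) \<otimes>\<^bsub>Q\<^esub>
      q4.ab.\<zeta> [^]\<^bsub>Q\<^esub> m \<otimes>\<^bsub>Q\<^esub> (qt \<circ> phi_123) f"
    using h by (simp add: q4.ab.\<zeta>_def q4.ab.\<Delta>_def)
  obtain \<iota>' where \<iota>': "\<iota>' \<in> hom (BG 3) (BG 4)" "\<iota>' (sig 3 1) = sig 4 2" "\<iota>' (sig 3 2) = sig 4 3"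
    "\<And>g. g \<in> PB 3 \<Longrightarrow> phi_234 g = \<iota>' g" by (rule phi_234_strand_inclusion) blast
  note h' = hexagon_image[OF \<iota>'(1) \<phi>(2) \<iota>'(4) f hex, simplified \<iota>']
  show "qt (sig 4 2) \<otimes>\<^bsub>Q\<^esub> (qt (sig 4 2) \<otimes>\<^bsub>Q\<^esub> qt (sig 4 2)) [^]\<^bsub>Q\<^esub> m \<otimes>\<^bsub>Q\<^esub> inv\<^bsub>Q\<^esub> (qt \<circ> phi_234) f \<otimes>\<^bsub>Q\<^esub>
      qt (sig 4 3) \<otimes>\<^bsub>Q\<^esub> (qt (sig 4 3) \<otimes>\<^bsub>Q\<^esub> qt (sig 4 3)) [^]\<^bsub>Q\<^esub> m \<otimes>\<^bsub>Q\<^esub> (qt \<circ> phi_234) f =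
      inv\<^bsub>Q\<^esub> (qt \<circ> phi_234) f \<otimes>\<^bsub>Q\<^esub> qt (sig 4 2) \<otimes>\<^bsub>Q\<^esub> qt (sig 4 3) \<otimes>\<^bsub>Q\<^esub>
      (qt (sig 4 2) \<otimes>\<^bsub>Q\<^esub> qt (sig 4 2)) [^]\<^bsub>Q\<^esub> (- m) \<otimes>\<^bsub>Q\<^esub> q4.bc.\<zeta> [^]\<^bsub>Q\<^esub> m"
    using h' by (simp add: q4.bc.\<zeta>_def q4.bc.\<Delta>_def)
  show "inv\<^bsub>Q\<^esub> (qt \<circ> phi_234) f \<otimes>\<^bsub>Q\<^esub> qt (sig 4 3) \<otimes>\<^bsub>Q\<^esub> (qt (sig 4 3) \<otimes>\<^bsub>Q\<^esub> qt (sig 4 3)) [^]\<^bsub>Q\<^esub> m \<otimes>\<^bsub>Q\<^esub>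
      (qt \<circ> phi_234) f \<otimes>\<^bsub>Q\<^esub> qt (sig 4 2) \<otimes>\<^bsub>Q\<^esub> (qt (sig 4 2) \<otimes>\<^bsub>Q\<^esub> qt (sig 4 2)) [^]\<^bsub>Q\<^esub> m =
      qt (sig 4 3) \<otimes>\<^bsub>Q\<^esub> qt (sig 4 2) \<otimes>\<^bsub>Q\<^esub> (qt (sig 4 3) \<otimes>\<^bsub>Q\<^esub> qt (sig 4 3)) [^]\<^bsub>Q\<^esub> (- m) \<otimes>\<^bsub>Q\<^esub>
      q4.bc.\<zeta> [^]\<^bsub>Q\<^esub> m \<otimes>\<^bsub>Q\<^esub> (qt \<circ> phi_234) f"
    using h' by (simp add: q4.bc.\<zeta>_def q4.bc.\<Delta>_def)
  show "f \<in> F2" by (rule f)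
  have "qt (phi_234 f \<otimes>\<^bsub>BG 4\<^esub> phi_1_23_4 f \<otimes>\<^bsub>BG 4\<^esub> phi_123 f) = qt (phi_1_2_34 f \<otimes>\<^bsub>BG 4\<^esub> phi_12_3_4 f)"
    using pent unfolding pentagon_def qt_def by (simp add: PBG_def)
  then show "(qt \<circ> phi_234) f \<otimes>\<^bsub>Q\<^esub> ((qt \<circ> phi_1_23_4) f \<otimes>\<^bsub>Q\<^esub> (qt \<circ> phi_123) f) =
      (qt \<circ> phi_1_2_34) f \<otimes>\<^bsub>Q\<^esub> (qt \<circ> phi_12_3_4) f"
    using f by (simp add: F2_PB Q.m_assoc)
qed (simp_all add: phi_123 phi_234 phi_12_3_4 phi_1_23_4 phi_1_2_34 qt_phi_F2_hom)

end

lemma (in group) conj_by_eq_one: "u \<in> carrier G \<Longrightarrow> x \<in> carrier G \<Longrightarrow> conj_by u x = \<one> \<Longrightarrow> x = \<one>"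
  unfolding conj_by_def by (metis inv_mult_eq_one_iff m_closed r_cancel_one)

lemma E_F2_closed [simp]: "f \<in> F2 \<Longrightarrow> w \<in> F2 \<Longrightarrow> E_F2 m f w \<in> F2"
  using hom_in_carrier[OF E_F2(1)] by simp

context gt_rep
begin

text \<open>\<open>T_B4\<close> is a definite description; it denotes a homomorphism because its
  prescribed values \<open>S.T1\<close>, \<open>S.T2\<close>, \<open>S.T3\<close> satisfy the braid
  relations.\<close>

lemma T_B4_hom:
  obtains T where "T \<in> hom (BG 4) Q" "T (sig 4 1) = S.T1" "T (sig 4 2) = S.T2" "T (sig 4 3) = S.T3"
    "T_B4 N m f = restrict T (carrier (BG 4))"
proof -
  obtain T where T: "T \<in> hom (BG 4) Q" "T (sig 4 1) = S.T1" "T (sig 4 2) = S.T2" "T (sig 4 3) = S.T3"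
    by (rule S.T_hom)
  have f': "f \<in> PB 3" by (rule F2_PB[OF f])
  have "T_B4 N m f = restrict T (carrier (BG 4))"
    unfolding T_B4_def qt_def[symmetric]
  proof (rule the_hom_eqI)
    have "sig 4 ` {1..<4} = {sig 4 1, sig 4 2, sig 4 3}" by (simp add: strands)
    then show "carrier (BG 4) = generate (BG 4) (fst `
      {(sig 4 1, qt (sig 4 1 [^]\<^bsub>BG 4\<^esub> (2 * m + 1))),
       (sig 4 2, qt (inv\<^bsub>BG 4\<^esub> phi_123 f \<otimes>\<^bsub>BG 4\<^esub> sig 4 2 [^]\<^bsub>BG 4\<^esub> (2 * m + 1) \<otimes>\<^bsub>BG 4\<^esub> phi_123 f)),
       (sig 4 3, qt (inv\<^bsub>BG 4\<^esub> phi_12_3_4 f \<otimes>\<^bsub>BG 4\<^esub> sig 4 3 [^]\<^bsub>BG 4\<^esub> (2 * m + 1) \<otimes>\<^bsub>BG 4\<^esub> phi_12_3_4 f))})"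
      using BG_generate[of 4] by simp
  qed (use T f' in \<open>auto simp: S.T1_def S.T2_def S.T3_def Q.conj_by_def qt.hom_int_pow Q.m_assoc\<close>)
  with T that show thesis by blast
qed

lemma source_F2:
  assumes "w \<in> NF2 (gt_source N m f)"
  shows "E_F2 m f w \<in> NF2 N"
proof -
  obtain T where T: "T \<in> hom (BG 4) Q" "T (sig 4 1) = S.T1" "T (sig 4 2) = S.T2" "T (sig 4 3) = S.T3"
    "T_B4 N m f = restrict T (carrier (BG 4))" by (rule T_B4_hom)
  interpret T: group_hom "BG 4" Q T
    using T(1) by (simp add: group_hom_def group_hom_axioms_def Q.group_axioms)
  have w: "w \<in> F2" "w \<in> PB 3" using assms F2_PB by (auto simp: NF2_def)
  have Ew: "E_F2 m f w \<in> F2" "E_F2 m f w \<in> PB 3" using w f F2_PB by auto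
  have source: "gt_source N m f = {g \<in> PB 4. T g = \<one>\<^bsub>Q\<^esub>}"
    using PB_closed[of _ 4] by (auto simp: gt_source_def kernel_def T_PB4_def T one_FactGroup)
  have h: "T \<circ> \<phi> \<in> hom F2G Q" if "\<phi> \<in> hom (PBG 3) (PBG 4)" for \<phi>
    by (rule Group.hom_compose[OF hom_PBG_F2G[OF hom_PBG_BG[OF that]] T(1)])
  have one: "\<phi> (E_F2 m f w) \<in> N"
    if "(T \<circ> \<phi>) w = Q.conj_by u ((qt \<circ> \<phi>) (E_F2 m f w))" "\<phi> w \<in> gt_source N m f"
      "\<phi> \<in> hom (PBG 3) (PBG 4)" "u \<in> carrier Q" for \<phi> u
  proof -
    have c: "\<phi> (E_F2 m f w) \<in> carrier (BG 4)"
      using hom_in_carrier[OF that(3), of "E_F2 m f w"] Ew PB_closed by simp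
    have "Q.conj_by u (qt (\<phi> (E_F2 m f w))) = \<one>\<^bsub>Q\<^esub>" using that by (simp add: source)
    then have "qt (\<phi> (E_F2 m f w)) = \<one>\<^bsub>Q\<^esub>" using Q.conj_by_eq_one[OF that(4)] c by simp
    then show ?thesis using qt_one_iff[OF c] by simp
  qed
  have src: "phi_123 w \<in> gt_source N m f" "phi_234 w \<in> gt_source N m f" "phi_12_3_4 w \<in> gt_source N m f"
    "phi_1_23_4 w \<in> gt_source N m f" "phi_1_2_34 w \<in> gt_source N m f"
    using assms by (auto simp: NF2_def N3_def)
  have "phi_123 (E_F2 m f w) \<in> N"
    by (rule one[OF S.T_phi_123[OF h[OF phi_123(1)] _ _ w(1)] src(1) phi_123(1)])
      (simp_all add: phi_123 T)
  moreover have "phi_234 (E_F2 m f w) \<in> N"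
    by (rule one[OF S.T_phi_234[OF h[OF phi_234(1)] _ _ w(1)] src(2) phi_234(1)])
      (simp_all add: phi_234 T)
  moreover have "phi_12_3_4 (E_F2 m f w) \<in> N"
    by (rule one[OF S.T_phi_12_3_4[OF h[OF phi_12_3_4(1)] _ _ w(1)] src(3) phi_12_3_4(1)])
      (simp_all add: phi_12_3_4 T)
  moreover have "phi_1_23_4 (E_F2 m f w) \<in> N"
    by (rule one[OF S.T_phi_1_23_4[OF h[OF phi_1_23_4(1)] _ _ w(1)] src(4) phi_1_23_4(1)])
      (simp_all add: phi_1_23_4 T F2_PB f)
  moreover have "phi_1_2_34 (E_F2 m f w) \<in> N"
    by (rule one[OF S.T_phi_1_2_34[OF h[OF phi_1_2_34(1)] _ _ w(1)] src(5) phi_1_2_34(1)])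
      (simp_all add: phi_1_2_34 T F2_PB f)
  ultimately show ?thesis using Ew by (simp add: NF2_def N3_def)
qed

end

context quotient4
begin

sublocale rF: group_hom F2G R rt
  using hom_PBG_F2G[OF rt_hom] by (simp add: group_hom_def group_hom_axioms_def R.group_axioms)

lemma gt_class_eqD:
  assumes "gt_class N m f = gt_class N m' f'"
  shows "rt f = rt f'" "\<exists>k. m' = m + int (Nord N) * k"
proof -
  show "rt f = rt f'" using assms by (simp add: gt_class_def rt_def)
  have "m' \<in> {m' + int (Nord N) * k | k. True}" by (auto intro: exI[of _ 0])
  also have "\<dots> = {m + int (Nord N) * k | k. True}" using assms by (simp add: gt_class_def)
  finally show "\<exists>k. m' = m + int (Nord N) * k" by auto
qed

lemma rt_pow_Nord:
  assumes "x \<in> {xF, yF, cB}"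
  shows "rt x [^]\<^bsub>R\<^esub> int (Nord N) = \<one>\<^bsub>R\<^esub>"
proof -
  have "rt x \<in> carrier R" using assms xg_3_PB by auto
  moreover have "R.ord (rt x) dvd Nord N"
    unfolding Nord_def rt_def using assms by (intro dvd_Lcm) blast
  ultimately show ?thesis by (simp add: R.int_pow_eq_id)
qed

lemma rt_pow_cong:
  assumes "x \<in> {xF, yF, cB}" "m' = m + int (Nord N) * k"
  shows "rt x [^]\<^bsub>R\<^esub> m' = rt x [^]\<^bsub>R\<^esub> m"
proof -
  have x: "rt x \<in> carrier R" using assms xg_3_PB by auto
  have "rt x [^]\<^bsub>R\<^esub> m' = rt x [^]\<^bsub>R\<^esub> m \<otimes>\<^bsub>R\<^esub> (rt x [^]\<^bsub>R\<^esub> int (Nord N)) [^]\<^bsub>R\<^esub> k"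
    unfolding assms(2) by (simp only: R.int_pow_mult[OF x] R.int_pow_pow[OF x])
  then show ?thesis using x rt_pow_Nord[OF assms(1)] by simp
qed

lemma rt_E_F2_cong:
  assumes "gt_class N m f = gt_class N m' f'" "f \<in> F2" "f' \<in> F2"
  shows "rt (xF [^]\<^bsub>F2G\<^esub> (2 * m + 1)) = rt (xF [^]\<^bsub>F2G\<^esub> (2 * m' + 1))"
    "rt (inv\<^bsub>F2G\<^esub> f \<otimes>\<^bsub>F2G\<^esub> yF [^]\<^bsub>F2G\<^esub> (2 * m + 1) \<otimes>\<^bsub>F2G\<^esub> f) =
      rt (inv\<^bsub>F2G\<^esub> f' \<otimes>\<^bsub>F2G\<^esub> yF [^]\<^bsub>F2G\<^esub> (2 * m' + 1) \<otimes>\<^bsub>F2G\<^esub> f')"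
proof -
  obtain k where k: "m' = m + int (Nord N) * k" using gt_class_eqD[OF assms(1)] by blast
  \<comment> \<open>A shift of \<open>m\<close> by a multiple of \<open>Nord N\<close> shifts the
    exponent by twice as much, again a multiple.\<close>
  have "2 * m' + 1 = 2 * m + 1 + int (Nord N) * (2 * k)" by (simp add: k algebra_simps)
  note pow = rt_pow_cong[OF _ this]
  show "rt (xF [^]\<^bsub>F2G\<^esub> (2 * m + 1)) = rt (xF [^]\<^bsub>F2G\<^esub> (2 * m' + 1))"
    using pow[of xF] by (simp add: rF.hom_int_pow)
  have cl: "inv\<^bsub>F2G\<^esub> g \<in> F2" "yF [^]\<^bsub>F2G\<^esub> i \<in> F2" "inv\<^bsub>F2G\<^esub> g \<otimes>\<^bsub>F2G\<^esub> yF [^]\<^bsub>F2G\<^esub> i \<in> F2"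
    if "g \<in> F2" for g and i :: int
    using that by (simp_all add: inv_F2G pow_F2G mult_F2G)
  show "rt (inv\<^bsub>F2G\<^esub> f \<otimes>\<^bsub>F2G\<^esub> yF [^]\<^bsub>F2G\<^esub> (2 * m + 1) \<otimes>\<^bsub>F2G\<^esub> f) =
      rt (inv\<^bsub>F2G\<^esub> f' \<otimes>\<^bsub>F2G\<^esub> yF [^]\<^bsub>F2G\<^esub> (2 * m' + 1) \<otimes>\<^bsub>F2G\<^esub> f')"
    using pow[of yF] gt_class_eqD(1)[OF assms(1)] assms(2,3) cl by (simp add: rF.hom_int_pow)
qed

end

section \<open>The action on child's drawings\<close>

declare sym_group_inv_equality [simp del]

section \<open>Surjectivity of the endomorphism modulo \<open>N3 N\<close>\<close>

context gt_rep
begin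

abbreviation "E \<equiv> E_F2 m f"

lemma rt_E_hom: "rt \<circ> E \<in> hom F2G R"
  by (rule Group.hom_compose[OF E_F2(1)[OF f] rF.homh])

sublocale rE: group_hom F2G R "rt \<circ> E"
  using rt_E_hom by (simp add: group_hom_def group_hom_axioms_def R.group_axioms)

lemma rt_centr:
  assumes "w \<in> F2"
  shows "rt (cB [^]\<^bsub>BG 3\<^esub> (k :: int)) \<in> R.centr (rt w)"
proof -
  have "cB [^]\<^bsub>BG 3\<^esub> k \<in> PB 3"
    using B3.subgroup_int_pow_closed[OF subgroup_PB xg_3_PB(3)] .
  then show ?thesis
    using assms F2_commute_cB[OF assms, of k] F2_PB[OF assms]
      rt.hom_mult[of w "cB [^]\<^bsub>BG 3\<^esub> k"] rt.hom_mult[of "cB [^]\<^bsub>BG 3\<^esub> k" w]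
    by (simp add: R.centr_def)
qed

text \<open>The surjectivity condition on shadows reaches \<open>rt f\<close> from
  \<open>PB 3\<close>, not from \<open>F2\<close>. Splitting the preimage into an element of
  \<open>F2\<close> and a power of \<open>cB\<close> separates the two: on \<open>F2\<close> the map
  \<open>T_PB3\<close> is \<open>rt\<close> after \<open>E\<close>, and a power of \<open>cB\<close>
  goes to a power of \<open>cB\<close>.\<close>

lemma rt_f_decompose:
  obtains e and k :: int where "e \<in> F2" "rt f = rt (E e) \<otimes>\<^bsub>R\<^esub> rt (cB [^]\<^bsub>BG 3\<^esub> k)"
proof -
  let ?T = "T_PB3 N m f" and ?n = "2 * m + 1"
  have cPB: "cB [^]\<^bsub>BG 3\<^esub> (k :: int) \<in> PB 3" for k
    using B3.subgroup_int_pow_closed[OF subgroup_PB xg_3_PB(3)] .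
  let ?x = "xF [^]\<^bsub>BG 3\<^esub> ?n" and ?y = "inv\<^bsub>BG 3\<^esub> f \<otimes>\<^bsub>BG 3\<^esub> yF [^]\<^bsub>BG 3\<^esub> ?n \<otimes>\<^bsub>BG 3\<^esub> f"
  have xy: "?x \<in> F2" "?y \<in> F2" using f by simp_all
  interpret T: pure3 R "rt ?x" "rt ?y" "rt (cB [^]\<^bsub>BG 3\<^esub> ?n)"
  proof
    show "rt ?x \<in> carrier R" "rt ?y \<in> carrier R" "rt (cB [^]\<^bsub>BG 3\<^esub> ?n) \<in> carrier R"
      using xy[THEN F2_PB] cPB by simp_all
    show "rt ?x \<otimes>\<^bsub>R\<^esub> rt (cB [^]\<^bsub>BG 3\<^esub> ?n) = rt (cB [^]\<^bsub>BG 3\<^esub> ?n) \<otimes>\<^bsub>R\<^esub> rt ?x"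
      "rt ?y \<otimes>\<^bsub>R\<^esub> rt (cB [^]\<^bsub>BG 3\<^esub> ?n) = rt (cB [^]\<^bsub>BG 3\<^esub> ?n) \<otimes>\<^bsub>R\<^esub> rt ?y"
      using rt_centr[OF xy(1), of ?n] rt_centr[OF xy(2), of ?n] by (simp_all add: R.centr_def)
  qed
  note T = T.PB3_the_hom[folded T_PB3_def[of N m f, folded rt_def]]
  interpret T: group_hom "PBG 3" R ?T
    using T(1) by (simp add: group_hom_def group_hom_axioms_def R.group_axioms)
  have TE: "?T w = rt (E w)" if "w \<in> F2" for w
  proof -
    have "?T w = (rt \<circ> E) w"
      by (rule F2_hom_eqI[OF R.group_axioms hom_PBG_F2G[OF T(1)] rt_E_hom _ _ that])
        (simp_all add: T E_F2[OF f] f pow_F2G inv_F2G mult_F2G)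
    then show ?thesis by simp
  qed
  have "rt f \<in> ?T ` PB 3"
    using rep rt.hom_closed[of f] F2_PB[OF f] by (simp add: is_gt_rep_def)
  then obtain p where p: "p \<in> PB 3" "rt f = ?T p" by blast
  obtain e k where e: "e \<in> F2" "p = e \<otimes>\<^bsub>BG 3\<^esub> cB [^]\<^bsub>BG 3\<^esub> (k :: int)" by (rule PB3_decompose[OF p(1)])
  have "?T (cB [^]\<^bsub>BG 3\<^esub> k) = rt (cB [^]\<^bsub>BG 3\<^esub> ?n) [^]\<^bsub>R\<^esub> k"
    using T.hom_int_pow[of cB k] T(4) by (simp add: xg_3_PB pow_PBG)
  also have "\<dots> = rt (cB [^]\<^bsub>BG 3\<^esub> (?n * k))"
    using rt.hom_int_pow[of "cB [^]\<^bsub>BG 3\<^esub> ?n" k] cPB by (simp add: pow_PBG B3.int_pow_pow)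
  finally have "rt f = rt (E e) \<otimes>\<^bsub>R\<^esub> rt (cB [^]\<^bsub>BG 3\<^esub> (?n * k))"
    using p(2) e T.hom_mult[of e "cB [^]\<^bsub>BG 3\<^esub> k"] cPB TE[OF e(1)] by (simp add: F2_PB)
  with e(1) that show thesis by blast
qed

text \<open>Modulo \<open>N3 N\<close>, the conjugation by \<open>f\<close> is the conjugation by an element \<open>E e\<close> of the image,
  because the central factor drops out. So the image contains the powers with exponent
  \<open>2 * m + 1\<close> of both generators, and these powers generate the same subgroups as the
  generators.\<close>

lemma rt_E_onto:
  assumes "g \<in> F2"
  obtains v where "v \<in> F2" "rt (E v) = rt g"
proof -
  let ?n = "2 * m + 1"
  have bezout: "\<exists>v\<in>F2. rt (E v) = rt x"
    if x: "x = xF \<or> x = yF" and w: "w \<in> F2" "rt (E w) = rt x [^]\<^bsub>R\<^esub> ?n" for x w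
  proof -
    \<comment> \<open>\<open>u\<close> inverts the exponent modulo \<open>Nord N\<close>, so the
      \<open>u\<close>-th power of a preimage of the power of \<open>x\<close> is a preimage of
      \<open>x\<close>.\<close>
    have "coprime ?n (int (Nord N))" using rep by (simp add: is_gt_rep_def)
    then obtain u v where uv: "u * ?n + v * int (Nord N) = 1"
      using bezout_int[of ?n "int (Nord N)"] by (auto simp: coprime_iff_gcd_eq_1)
    have xF2: "x \<in> F2" and xR: "rt x \<in> carrier R" using x by auto
    have "rt (E (w [^]\<^bsub>F2G\<^esub> u)) = rt x [^]\<^bsub>R\<^esub> (?n * u)"
      using rE.hom_int_pow[of w u] w R.int_pow_pow[OF xR, of ?n u] by (simp add: mult.commute)
    also have "\<dots> = rt x [^]\<^bsub>R\<^esub> (u * ?n + v * int (Nord N))"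
      using x by (intro rt_pow_cong[of _ _ _ "- v"]) (auto simp: algebra_simps)
    finally have "rt (E (w [^]\<^bsub>F2G\<^esub> u)) = rt x" using uv xR by simp
    then show ?thesis using w(1) by (intro bexI[of _ "w [^]\<^bsub>F2G\<^esub> u"]) (simp_all add: pow_F2G)
  qed
  have gx: "\<exists>v\<in>F2. rt (E v) = rt xF"
    by (rule bezout[of _ xF]) (simp_all add: E_F2[OF f] rF.hom_int_pow)
  obtain e k where e: "e \<in> F2" "rt f = rt (E e) \<otimes>\<^bsub>R\<^esub> rt (cB [^]\<^bsub>BG 3\<^esub> (k :: int))"
    by (rule rt_f_decompose)
  let ?c = "rt (cB [^]\<^bsub>BG 3\<^esub> k)" and ?Y = "rt yF [^]\<^bsub>R\<^esub> ?n" and ?e = "rt (E e)"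
  have c: "?c \<in> carrier R" using rt_centr[OF e(1), of k] by (rule R.centr_closed)
  have Y: "?Y \<in> carrier R" "?e \<in> carrier R" using e f rF.hom_closed[of "E e"] by simp_all
  have cl: "inv\<^bsub>F2G\<^esub> h \<in> F2" "yF [^]\<^bsub>F2G\<^esub> i \<in> F2" "h \<otimes>\<^bsub>F2G\<^esub> h' \<in> F2"
    if "h \<in> F2" "h' \<in> F2" for h h' and i :: int
    using that by (simp_all add: inv_F2G pow_F2G mult_F2G)
  have Ey: "rt (E yF) = R.conj_by (rt f) ?Y"
    using f cl by (simp add: E_F2(3)[OF f] R.conj_by_def R.m_assoc rF.hom_int_pow)
  have cY: "?c \<in> R.centr (R.conj_by ?e ?Y)"
  proof -
    have "R.conj_by ?e ?Y = rt (inv\<^bsub>F2G\<^esub> E e \<otimes>\<^bsub>F2G\<^esub> (yF [^]\<^bsub>F2G\<^esub> ?n \<otimes>\<^bsub>F2G\<^esub> E e))"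
      using cl e f by (simp add: R.conj_by_def rF.hom_int_pow)
    then show ?thesis using rt_centr[of "inv\<^bsub>F2G\<^esub> E e \<otimes>\<^bsub>F2G\<^esub> (yF [^]\<^bsub>F2G\<^esub> ?n \<otimes>\<^bsub>F2G\<^esub> E e)"] cl e f by simp
  qed
  have Ey': "rt (E yF) = R.conj_by ?e ?Y"
    using Ey c Y R.conj_by_centr[OF cY] by (simp add: e R.conj_by_conj_by)
  \<comment> \<open>\<open>E\<close> sends conjugation by \<open>e\<close> to conjugation by
    \<open>E e\<close>, which undoes the conjugation in \<open>E yF\<close>.\<close>
  have "rt (E (e \<otimes>\<^bsub>F2G\<^esub> (yF \<otimes>\<^bsub>F2G\<^esub> inv\<^bsub>F2G\<^esub> e))) = ?Y"
    using rE.hom_mult[of e "yF \<otimes>\<^bsub>F2G\<^esub> inv\<^bsub>F2G\<^esub> e"] rE.hom_mult[of yF "inv\<^bsub>F2G\<^esub> e"] rE.hom_inv[of e]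
      cl e(1) Ey' Y by (simp add: R.conj_by_def R.m_assoc)
  then have gy: "\<exists>v\<in>F2. rt (E v) = rt yF"
    using e cl by (intro bezout[of yF "e \<otimes>\<^bsub>F2G\<^esub> (yF \<otimes>\<^bsub>F2G\<^esub> inv\<^bsub>F2G\<^esub> e)"]) simp_all
  have "\<exists>v\<in>F2. rt (E v) = rt g" if "g \<in> generate F2G {xF, yF}" for g
    using that
  proof induction
    case one
    show ?case using rE.hom_one rF.hom_one by (intro bexI[of _ "\<one>\<^bsub>F2G\<^esub>"]) (simp_all add: one_F2G)
  next
    case (incl h)
    then show ?case using gx gy by auto
  next
    case (inv h)
    then obtain v where v: "v \<in> F2" "rt (E v) = rt h" using gx gy by auto
    have "h \<in> F2" using inv by auto
    then show ?case using v rE.hom_inv[of v] rF.hom_inv[of h] cl by (intro bexI[of _ "inv\<^bsub>F2G\<^esub> v"]) simp_all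
  next
    case (eng g h)
    then obtain v w where v: "v \<in> F2" "rt (E v) = rt g" "w \<in> F2" "rt (E w) = rt h" by blast
    have "g \<in> F2" "h \<in> F2" using eng.hyps F2_generate by simp_all
    then show ?case using v rE.hom_mult[of v w] rF.hom_mult[of g h] cl
      by (intro bexI[of _ "v \<otimes>\<^bsub>F2G\<^esub> w"]) simp_all
  qed
  then show thesis using assms that F2_generate by auto
qed

end

section \<open>Homomorphisms to symmetric groups and their conjugacy classes\<close>

context quotient4
begin

text \<open>A subordinate \<psi> kills \<open>NF2 N\<close>, so it factors through \<open>rt\<close>
  on \<open>F2\<close>; statements modulo \<open>N3 N\<close> thereby transfer to \<psi>.\<close>

lemma subordinate_cong:
  assumes "\<psi> \<in> hom F2G (sym_group d)" "subordinate N d \<psi>" "u \<in> F2" "v \<in> F2" "rt u = rt v"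
  shows "\<psi> u = \<psi> v"
proof -
  interpret \<psi>: group_hom F2G "sym_group d" \<psi>
    using assms(1) by (simp add: group_hom_def group_hom_axioms_def)
  have "inv\<^bsub>BG 3\<^esub> u \<otimes>\<^bsub>BG 3\<^esub> v \<in> NF2 N"
    using assms rt_eq_iff[of u v] by (simp add: NF2_def F2_PB)
  then have "\<psi> (inv\<^bsub>F2G\<^esub> u \<otimes>\<^bsub>F2G\<^esub> v) = \<one>\<^bsub>sym_group d\<^esub>"
    using assms by (auto simp: subordinate_def kernel_def inv_F2G mult_F2G)
  then have "inv\<^bsub>sym_group d\<^esub> (\<psi> u) \<otimes>\<^bsub>sym_group d\<^esub> \<psi> v = \<one>\<^bsub>sym_group d\<^esub>"
    using assms \<psi>.hom_mult[of "inv\<^bsub>F2G\<^esub> u" v] \<psi>.hom_inv[of u] by (simp add: inv_F2G)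
  then show ?thesis
    using assms \<psi>.hom_closed[of u] \<psi>.hom_closed[of v] by (subst (asm) \<psi>.H.inv_mult_eq_one_iff) simp_all
qed

end

lemma psi_act:
  assumes "\<psi> \<in> hom F2G (sym_group d)" "f \<in> F2"
  shows "psi_act d \<psi> m f = (\<lambda>g\<in>F2. \<psi> (E_F2 m f g))"
    and "psi_act d \<psi> m f \<in> hom F2G (sym_group d)"
    and "psi_act d \<psi> m f xF = \<psi> (xF [^]\<^bsub>F2G\<^esub> (2 * m + 1))"
    and "psi_act d \<psi> m f yF = \<psi> (inv\<^bsub>F2G\<^esub> f \<otimes>\<^bsub>F2G\<^esub> yF [^]\<^bsub>F2G\<^esub> (2 * m + 1) \<otimes>\<^bsub>F2G\<^esub> f)"
proof -
  have h: "\<psi> \<circ> E_F2 m f \<in> hom F2G (sym_group d)"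
    by (rule Group.hom_compose[OF E_F2(1)[OF assms(2)] assms(1)])
  show eq: "psi_act d \<psi> m f = (\<lambda>g\<in>F2. \<psi> (E_F2 m f g))"
    unfolding psi_act_def
    by (subst the_hom_eqI[OF group_F2G group_sym_group h])
      (use E_F2[OF assms(2), of m] F2_generate in \<open>auto simp: restrict_def\<close>)
  show "psi_act d \<psi> m f \<in> hom F2G (sym_group d)"
    using h subgroup.m_closed[OF subgroup_F2] unfolding eq by (auto simp: hom_def mult_F2G Pi_iff)
  show "psi_act d \<psi> m f xF = \<psi> (xF [^]\<^bsub>F2G\<^esub> (2 * m + 1))"
    "psi_act d \<psi> m f yF = \<psi> (inv\<^bsub>F2G\<^esub> f \<otimes>\<^bsub>F2G\<^esub> yF [^]\<^bsub>F2G\<^esub> (2 * m + 1) \<otimes>\<^bsub>F2G\<^esub> f)"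
    using E_F2[OF assms(2), of m] unfolding eq by simp_all
qed

lemma (in quotient4) psi_act_cong:
  assumes "\<psi> \<in> hom F2G (sym_group d)" "subordinate N d \<psi>" "f \<in> F2" "f' \<in> F2"
    and "gt_class N m f = gt_class N m' f'"
  shows "psi_act d \<psi> m f = psi_act d \<psi> m' f'"
proof -
  have "\<psi> (xF [^]\<^bsub>F2G\<^esub> (2 * m + 1)) = \<psi> (xF [^]\<^bsub>F2G\<^esub> (2 * m' + 1))"
    "\<psi> (inv\<^bsub>F2G\<^esub> f \<otimes>\<^bsub>F2G\<^esub> yF [^]\<^bsub>F2G\<^esub> (2 * m + 1) \<otimes>\<^bsub>F2G\<^esub> f) =
      \<psi> (inv\<^bsub>F2G\<^esub> f' \<otimes>\<^bsub>F2G\<^esub> yF [^]\<^bsub>F2G\<^esub> (2 * m' + 1) \<otimes>\<^bsub>F2G\<^esub> f')"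
    by (rule subordinate_cong[OF assms(1,2) _ _ rt_E_F2_cong(1)[OF assms(5,3,4)]],
        simp_all add: pow_F2G,
        rule subordinate_cong[OF assms(1,2) _ _ rt_E_F2_cong(2)[OF assms(5,3,4)], unfolded pow_F2G[OF F2_gens(2)]],
        simp_all add: assms inv_F2G pow_F2G mult_F2G)
  then show ?thesis by (simp add: psi_act_def)
qed

lemma (in gt_rep) psi_act_dessin:
  assumes "dessin_rep d \<psi>" "subordinate N d \<psi>"
  shows "dessin_rep d (psi_act d \<psi> m f)" "subordinate (gt_source N m f) d (psi_act d \<psi> m f)"
proof -
  have \<psi>: "\<psi> \<in> hom F2G (sym_group d)" using assms by (simp add: dessin_rep_def)
  note act = psi_act[OF \<psi> f, of m]
  have "\<exists>v\<in>F2. psi_act d \<psi> m f v = \<psi> g" if g: "g \<in> F2" for g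
  proof -
    obtain v where v: "v \<in> F2" "rt (E v) = rt g" by (rule rt_E_onto[OF g])
    then have "\<psi> (E v) = \<psi> g" using g f by (intro subordinate_cong[OF \<psi> assms(2)]) simp_all
    with v show ?thesis by (auto simp: act(1))
  qed
  then show "dessin_rep d (psi_act d \<psi> m f)"
    using assms(1) act(1,2) unfolding dessin_rep_def by (metis restrict_extensional)
  show "subordinate (gt_source N m f) d (psi_act d \<psi> m f)"
    unfolding subordinate_def
  proof
    fix w assume w: "w \<in> NF2 (gt_source N m f)"
    then have "E w \<in> NF2 N" by (rule source_F2)
    then have "\<psi> (E w) = \<one>\<^bsub>sym_group d\<^esub>" using assms(2) by (auto simp: subordinate_def kernel_def)
    then show "w \<in> kernel F2G (sym_group d) (psi_act d \<psi> m f)"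
      using w by (simp add: kernel_def act(1) NF2_def)
  qed
qed

definition twist :: "nat \<Rightarrow> (nat \<Rightarrow> nat) \<Rightarrow> (braid \<Rightarrow> nat \<Rightarrow> nat) \<Rightarrow> braid \<Rightarrow> nat \<Rightarrow> nat" where
  "twist d \<tau> \<psi> = (\<lambda>g\<in>F2. \<tau> \<otimes>\<^bsub>sym_group d\<^esub> \<psi> g \<otimes>\<^bsub>sym_group d\<^esub> inv\<^bsub>sym_group d\<^esub> \<tau>)"

lemma drawing_of_twist_image: "drawing_of d \<psi> = (d, (\<lambda>\<tau>. twist d \<tau> \<psi>) ` carrier (sym_group d))"
  by (auto simp: drawing_of_def twist_def)

lemma drawing_of_eqD:
  assumes "drawing_of d \<psi> = drawing_of d' \<psi>'" "dessin_rep d \<psi>"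
  shows "d = d'" "\<exists>\<tau>\<in>carrier (sym_group d). \<psi> = twist d \<tau> \<psi>'"
proof -
  interpret S: group "sym_group d" by simp
  show d: "d = d'" using assms by (simp add: drawing_of_def)
  have \<psi>: "\<psi> \<in> hom F2G (sym_group d)" "\<psi> \<in> extensional F2" using assms by (simp_all add: dessin_rep_def)
  \<comment> \<open>\<psi> belongs to its own class. Both functions are extensional, so agreement on
    \<open>F2\<close> suffices.\<close>
  have "\<psi> = twist d \<one>\<^bsub>sym_group d\<^esub> \<psi>"
  proof (rule extensionalityI[of _ F2])
    fix g assume "g \<in> F2"
    then show "\<psi> g = twist d \<one>\<^bsub>sym_group d\<^esub> \<psi> g"
      using hom_in_carrier[OF \<psi>(1), of g] by (simp add: twist_def)
  qed (use \<psi> in \<open>simp_all add: twist_def\<close>)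
  then have "\<psi> \<in> snd (drawing_of d \<psi>)" unfolding drawing_of_twist_image by auto
  then show "\<exists>\<tau>\<in>carrier (sym_group d). \<psi> = twist d \<tau> \<psi>'"
    unfolding assms(1) using d by (auto simp: drawing_of_twist_image)
qed

lemma drawing_of_twist:
  assumes "\<psi> \<in> hom F2G (sym_group d)" "\<tau> \<in> carrier (sym_group d)"
  shows "drawing_of d (twist d \<tau> \<psi>) = drawing_of d \<psi>"
proof -
  interpret S: group "sym_group d" by simp
  have tt: "twist d \<sigma> (twist d \<tau> \<psi>) = twist d (\<sigma> \<otimes>\<^bsub>sym_group d\<^esub> \<tau>) \<psi>"
    if "\<sigma> \<in> carrier (sym_group d)" "\<tau> \<in> carrier (sym_group d)" for \<sigma> \<tau>
    using that hom_in_carrier[OF assms(1)]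
    by (auto simp: twist_def fun_eq_iff S.m_assoc S.inv_mult_group)
  have "(\<lambda>\<sigma>. twist d \<sigma> (twist d \<tau> \<psi>)) ` carrier (sym_group d) = (\<lambda>\<sigma>. twist d \<sigma> \<psi>) ` carrier (sym_group d)"
  proof (intro equalityI subsetI)
    fix \<chi> assume "\<chi> \<in> (\<lambda>\<sigma>. twist d \<sigma> (twist d \<tau> \<psi>)) ` carrier (sym_group d)"
    then show "\<chi> \<in> (\<lambda>\<sigma>. twist d \<sigma> \<psi>) ` carrier (sym_group d)" using tt assms(2) by auto
  next
    fix \<chi> assume "\<chi> \<in> (\<lambda>\<sigma>. twist d \<sigma> \<psi>) ` carrier (sym_group d)"
    then obtain \<sigma> where \<sigma>: "\<sigma> \<in> carrier (sym_group d)" "\<chi> = twist d \<sigma> \<psi>" by auto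
    then have "\<chi> = twist d (\<sigma> \<otimes>\<^bsub>sym_group d\<^esub> inv\<^bsub>sym_group d\<^esub> \<tau>) (twist d \<tau> \<psi>)"
      using assms(2) by (subst tt) (simp_all add: S.m_assoc)
    then show "\<chi> \<in> (\<lambda>\<sigma>. twist d \<sigma> (twist d \<tau> \<psi>)) ` carrier (sym_group d)"
      using \<sigma> assms(2) by blast
  qed
  then show ?thesis by (simp add: drawing_of_twist_image)
qed

text \<open>Conjugation acts on the values and the endomorphism on the arguments, so the two
  commute.\<close>

lemma psi_act_twist:
  assumes "\<psi> \<in> hom F2G (sym_group d)" "twist d \<tau> \<psi> \<in> hom F2G (sym_group d)" "f \<in> F2"
  shows "psi_act d (twist d \<tau> \<psi>) m f = twist d \<tau> (psi_act d \<psi> m f)"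
  using assms by (auto simp: psi_act(1) twist_def fun_eq_iff)

lemma dessin_rep_hom: "dessin_rep d \<psi> \<Longrightarrow> \<psi> \<in> hom F2G (sym_group d)"
  by (simp add: dessin_rep_def)

lemma drawing_of_psi_act_cong:
  assumes "drawing_of d \<psi> = drawing_of d' \<psi>'" "dessin_rep d \<psi>" "dessin_rep d' \<psi>'" "f \<in> F2"
  shows "drawing_of d (psi_act d \<psi> m f) = drawing_of d' (psi_act d' \<psi>' m f)"
proof -
  obtain \<tau> where d: "d = d'" and \<tau>: "\<tau> \<in> carrier (sym_group d)" "\<psi> = twist d \<tau> \<psi>'"
    using drawing_of_eqD[OF assms(1,2)] by blast
  have \<psi>: "\<psi>' \<in> hom F2G (sym_group d)" "twist d \<tau> \<psi>' \<in> hom F2G (sym_group d)"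
    using assms(2,3) dessin_rep_hom d \<tau> by auto
  show ?thesis
    unfolding \<tau>(2) psi_act_twist[OF \<psi> assms(4)] drawing_of_twist[OF psi_act(2)[OF \<psi>(1) assms(4)] \<tau>(1)]
    by (simp add: d)
qed

text \<open>Conjugate homomorphisms have the same kernel, so subordination depends on the drawing
  alone and holds for each of its representatives.\<close>

lemma subordinate_Dessins:
  assumes "drawing_of d \<psi> \<in> Dessins N" "dessin_rep d \<psi>"
  shows "subordinate N d \<psi>"
proof -
  obtain d' \<psi>' where \<psi>': "drawing_of d \<psi> = drawing_of d' \<psi>'" "dessin_rep d' \<psi>'" "subordinate N d' \<psi>'"
    using assms(1) by (auto simp: Dessins_def)
  obtain \<tau> where \<tau>: "d = d'" "\<tau> \<in> carrier (sym_group d)" "\<psi> = twist d \<tau> \<psi>'"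
    using drawing_of_eqD[OF \<psi>'(1) assms(2)] by blast
  interpret S: group "sym_group d" by simp
  show ?thesis
    using \<psi>'(3) \<tau>(2) by (auto simp: subordinate_def kernel_def NF2_def \<tau>(3) twist_def \<tau>(1)[symmetric])
qed

text \<open>The description in \<open>Ash_mor\<close> runs over all representatives of the shadow
  and of the drawing. It has exactly one solution, by \<open>psi_act_cong\<close> for the shadow and
  \<open>drawing_of_psi_act_cong\<close> for the drawing.\<close>

lemma (in quotient4) Ash_mor_drawing_of:
  assumes "dessin_rep d \<psi>" "subordinate N d \<psi>" "f \<in> F2"
  shows "Ash_mor N' N (gt_class N m f) (drawing_of d \<psi>) = drawing_of d (psi_act d \<psi> m f)"
proof -
  have "drawing_of d \<psi> \<in> Dessins N" using assms by (auto simp: Dessins_def)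
  moreover have "(THE D'. \<exists>m' f' d' \<psi>'. f' \<in> F2 \<and> gt_class N m f = gt_class N m' f' \<and>
      dessin_rep d' \<psi>' \<and> drawing_of d \<psi> = drawing_of d' \<psi>' \<and> D' = drawing_of d' (psi_act d' \<psi>' m' f')) =
    drawing_of d (psi_act d \<psi> m f)"
  proof (rule the_equality)
    fix D' assume "\<exists>m' f' d' \<psi>'. f' \<in> F2 \<and> gt_class N m f = gt_class N m' f' \<and>
      dessin_rep d' \<psi>' \<and> drawing_of d \<psi> = drawing_of d' \<psi>' \<and> D' = drawing_of d' (psi_act d' \<psi>' m' f')"
    then obtain m' f' d' \<psi>' where *: "f' \<in> F2" "gt_class N m f = gt_class N m' f'" "dessin_rep d' \<psi>'"
      "drawing_of d \<psi> = drawing_of d' \<psi>'" "D' = drawing_of d' (psi_act d' \<psi>' m' f')" by blast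
    then show "D' = drawing_of d (psi_act d \<psi> m f)"
      using drawing_of_psi_act_cong[OF *(4) assms(1) *(3) *(1), of m']
        psi_act_cong[OF dessin_rep_hom[OF assms(1)] assms(2,3) *(1,2)] by simp
  qed (use assms in blast)
  ultimately show ?thesis by (simp add: Ash_mor_def)
qed

section \<open>Identities, composition and the functor\<close>

lemma psi_act_id:
  assumes "dessin_rep d \<psi>"
  shows "psi_act d \<psi> 0 \<one>\<^bsub>F2G\<^esub> = \<psi>"
proof -
  have "E_F2 0 \<one>\<^bsub>F2G\<^esub> g = g" if "g \<in> F2" for g
  proof -
    have "E_F2 0 \<one>\<^bsub>F2G\<^esub> g = id g"
      by (rule F2_hom_eqI[OF group_F2G E_F2(1) _ _ _ that])
        (simp_all add: E_F2 one_F2G inv_F2G pow_F2G mult_F2G hom_def)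
    then show ?thesis by simp
  qed
  then show ?thesis
    using assms psi_act(1)[OF dessin_rep_hom[OF assms], of "\<one>\<^bsub>F2G\<^esub>" 0]
    by (auto simp: one_F2G dessin_rep_def intro!: extensionalityI[of _ F2])
qed

text \<open>The rule for composing shadows is made for this: the exponents 2 m1 + 1 and 2 m2 + 1
  multiply, and the first endomorphism turns conjugation by \<open>f2\<close> into conjugation by
  its image of \<open>f2\<close>, which comes after the conjugation by \<open>f1\<close>.\<close>

lemma E_F2_comp:
  assumes "f1 \<in> F2" "f2 \<in> F2" "g \<in> F2"
  shows "E_F2 m1 f1 (E_F2 m2 f2 g) = E_F2 (2 * m1 * m2 + m1 + m2) (f1 \<otimes>\<^bsub>F2G\<^esub> E_F2 m1 f1 f2) g"
proof -
  interpret F: group F2G by simp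
  interpret E1: group_hom F2G F2G "E_F2 m1 f1"
    using E_F2(1)[OF assms(1)] by (simp add: group_hom_def group_hom_axioms_def)
  let ?f = "f1 \<otimes>\<^bsub>F2G\<^esub> E_F2 m1 f1 f2" and ?m = "2 * m1 * m2 + m1 + m2"
  have f: "?f \<in> F2" using assms by (simp add: mult_F2G)
  have m: "2 * ?m + 1 = (2 * m1 + 1) * (2 * m2 + 1)" by (simp add: algebra_simps)
  let ?Y = "yF [^]\<^bsub>F2G\<^esub> (2 * m1 + 1)"
  have cl: "f1 \<in> carrier F2G" "f2 \<in> carrier F2G" "E_F2 m1 f1 f2 \<in> carrier F2G" "xF \<in> carrier F2G" "yF \<in> carrier F2G"
    using assms by simp_all
  have "(E_F2 m1 f1 \<circ> E_F2 m2 f2) g = E_F2 ?m ?f g"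
  proof (rule F2_hom_eqI[OF group_F2G _ E_F2(1)[OF f] _ _ assms(3)])
    show "E_F2 m1 f1 \<circ> E_F2 m2 f2 \<in> hom F2G F2G"
      by (rule Group.hom_compose[OF E_F2(1)[OF assms(2)] E_F2(1)[OF assms(1)]])
    show "(E_F2 m1 f1 \<circ> E_F2 m2 f2) xF = E_F2 ?m ?f xF"
      using cl E1.hom_int_pow[OF cl(4), of "2 * m2 + 1"] F.int_pow_pow[OF cl(4), of "2 * m1 + 1" "2 * m2 + 1"]
      unfolding comp_apply E_F2(2)[OF assms(2)] E_F2(2)[OF f] m by (simp only: E_F2(2)[OF assms(1)])
    have Y: "E_F2 m1 f1 (yF [^]\<^bsub>F2G\<^esub> (2 * m2 + 1)) = F.conj_by f1 (yF [^]\<^bsub>F2G\<^esub> ((2 * m1 + 1) * (2 * m2 + 1)))"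
      using cl E1.hom_int_pow[OF cl(5), of "2 * m2 + 1"] F.int_pow_pow[OF cl(5), of "2 * m1 + 1" "2 * m2 + 1"]
        F.conj_by_pow[OF cl(1) F.int_pow_closed[OF cl(5)], of "2 * m1 + 1" "2 * m2 + 1"]
      by (simp add: E_F2(3)[OF assms(1)] F.conj_by_def F.m_assoc del: carrier_F2G)
    have "E_F2 m2 f2 yF = F.conj_by f2 (yF [^]\<^bsub>F2G\<^esub> (2 * m2 + 1))"
      using cl by (simp add: E_F2(3)[OF assms(2)] F.conj_by_def F.m_assoc del: carrier_F2G)
    then have "E_F2 m1 f1 (E_F2 m2 f2 yF) = F.conj_by (E_F2 m1 f1 f2) (E_F2 m1 f1 (yF [^]\<^bsub>F2G\<^esub> (2 * m2 + 1)))"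
      using cl by (simp add: F.conj_by_def del: carrier_F2G)
    also have "\<dots> = F.conj_by ?f (yF [^]\<^bsub>F2G\<^esub> (2 * ?m + 1))"
      unfolding Y m by (rule F.conj_by_conj_by[symmetric]) (use cl in \<open>auto simp del: carrier_F2G\<close>)
    also have "\<dots> = E_F2 ?m ?f yF"
      using cl by (simp add: E_F2(3)[OF f] F.conj_by_def F.m_assoc del: carrier_F2G)
    finally show "(E_F2 m1 f1 \<circ> E_F2 m2 f2) yF = E_F2 ?m ?f yF" by simp
  qed
  then show ?thesis by simp
qed

text \<open>Acting by the first shadow and then by the second yields \<psi> after the first
  endomorphism after the second. So the shadow applied first is the left factor of the composition,
  whence the contravariance.\<close>

lemma psi_act_comp:
  assumes "\<psi> \<in> hom F2G (sym_group d)" "f1 \<in> F2" "f2 \<in> F2"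
  shows "psi_act d (psi_act d \<psi> m1 f1) m2 f2 =
    psi_act d \<psi> (2 * m1 * m2 + m1 + m2) (f1 \<otimes>\<^bsub>F2G\<^esub> E_F2 m1 f1 f2)"
proof -
  have "f1 \<otimes>\<^bsub>F2G\<^esub> E_F2 m1 f1 f2 \<in> F2" using assms by (simp add: mult_F2G)
  moreover have "psi_act d (psi_act d \<psi> m1 f1) m2 f2 = (\<lambda>g\<in>F2. psi_act d \<psi> m1 f1 (E_F2 m2 f2 g))"
    by (rule psi_act(1)[OF psi_act(2)[OF assms(1,2)] assms(3)])
  ultimately show ?thesis
    using assms by (auto simp: psi_act(1)[OF assms(1)] E_F2_comp fun_eq_iff)
qed

lemma quotient4_NFI: "N \<in> NFI \<Longrightarrow> quotient4 N"
  by (simp add: NFI_def quotient4_def)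

lemma GTSh_homE:
  assumes "s \<in> GTSh_hom N2 N1" "N1 \<in> NFI"
  obtains m f where "s = gt_class N1 m f" "gt_rep N1 m f" "N2 = gt_source N1 m f"
  using assms quotient4_NFI[OF assms(2)] by (auto simp: GTSh_hom_def gt_rep_def gt_rep_axioms_def)

text \<open>An element of the class \<open>s\<close> is not assumed to satisfy
  \<open>is_gt_rep\<close>. It acts like the representative that makes \<open>s\<close> a morphism,
  and that one has the required properties.\<close>

lemma GTSh_hom_action:
  assumes "N1 \<in> NFI" "s \<in> GTSh_hom N2 N1" "dessin_rep d \<psi>" "subordinate N1 d \<psi>"
    and "f \<in> F2" "s = gt_class N1 m f"
  shows "dessin_rep d (psi_act d \<psi> m f)" "subordinate N2 d (psi_act d \<psi> m f)"
    "Ash_mor N2 N1 s (drawing_of d \<psi>) = drawing_of d (psi_act d \<psi> m f)"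
proof -
  interpret quotient4 N1 by (rule quotient4_NFI) fact
  obtain m' f' where s': "s = gt_class N1 m' f'" "gt_rep N1 m' f'" "N2 = gt_source N1 m' f'"
    using assms by (auto elim: GTSh_homE)
  interpret gt_rep N1 m' f' by fact
  have "psi_act d \<psi> m f = psi_act d \<psi> m' f'"
    using psi_act_cong[OF dessin_rep_hom[OF assms(3)] assms(4,5) gt_rep.f[OF s'(2)]] assms(6) s'(1) by simp
  then show "dessin_rep d (psi_act d \<psi> m f)" "subordinate N2 d (psi_act d \<psi> m f)"
    using psi_act_dessin[OF assms(3,4)] s'(3) by simp_all
  show "Ash_mor N2 N1 s (drawing_of d \<psi>) = drawing_of d (psi_act d \<psi> m f)"
    unfolding assms(6) by (rule Ash_mor_drawing_of) fact+
qed

lemma Ash_mor_PiE: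
  assumes "N1 \<in> NFI" "s \<in> GTSh_hom N2 N1"
  shows "Ash_mor N2 N1 s \<in> Dessins N1 \<rightarrow>\<^sub>E Dessins N2"
proof (rule PiE_I)
  fix D assume "D \<in> Dessins N1"
  then obtain d \<psi> where D: "D = drawing_of d \<psi>" "dessin_rep d \<psi>" "subordinate N1 d \<psi>"
    by (auto simp: Dessins_def)
  obtain m f where s: "s = gt_class N1 m f" "gt_rep N1 m f"
    using assms by (auto elim: GTSh_homE)
  show "Ash_mor N2 N1 s D \<in> Dessins N2"
    using GTSh_hom_action[OF assms D(2,3) gt_rep.f[OF s(2)] s(1)] unfolding D(1) Dessins_def by auto
qed (simp add: Ash_mor_def)

lemma Ash_mor_id:
  assumes "N \<in> NFI"
  shows "Ash_mor N N (gt_class N 0 \<one>\<^bsub>F2G\<^esub>) = (\<lambda>D\<in>Dessins N. D)"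
proof (rule extensionalityI[of _ "Dessins N"])
  interpret quotient4 N by (rule quotient4_NFI) fact
  fix D assume D: "D \<in> Dessins N"
  then obtain d \<psi> where "D = drawing_of d \<psi>" "dessin_rep d \<psi>" "subordinate N d \<psi>"
    by (auto simp: Dessins_def)
  then show "Ash_mor N N (gt_class N 0 \<one>\<^bsub>F2G\<^esub>) D = (\<lambda>D\<in>Dessins N. D) D"
    using D Ash_mor_drawing_of[of d \<psi> "\<one>\<^bsub>F2G\<^esub>" N 0] by (simp add: psi_act_id[unfolded one_F2G] one_F2G)
qed (simp_all add: Ash_mor_def)

lemma Ash_mor_comp:
  assumes "N1 \<in> NFI" "N2 \<in> NFI" "s2 \<in> GTSh_hom N' N2" "s1 \<in> GTSh_hom N2 N1"
  shows "Ash_mor N' N1 (gt_comp N1 N2 s1 s2) = compose (Dessins N1) (Ash_mor N' N2 s2) (Ash_mor N2 N1 s1)"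
proof (rule extensionalityI[of _ "Dessins N1"])
  interpret N1: quotient4 N1 by (rule quotient4_NFI) fact
  let ?P = "\<lambda>s. \<exists>m1 f1 m2 f2. f1 \<in> F2 \<and> f2 \<in> F2 \<and> s1 = gt_class N1 m1 f1 \<and> s2 = gt_class N2 m2 f2 \<and>
     s = gt_class N1 (2 * m1 * m2 + m1 + m2) (f1 \<otimes>\<^bsub>F2G\<^esub> E_F2 m1 f1 f2)"
  obtain m1 f1 m2 f2 where "s1 = gt_class N1 m1 f1" "gt_rep N1 m1 f1" "s2 = gt_class N2 m2 f2" "gt_rep N2 m2 f2"
    using assms by (metis GTSh_homE)
  then have "\<exists>s. ?P s" using gt_rep.f by blast
  then have "?P (gt_comp N1 N2 s1 s2)" unfolding gt_comp_def by (rule someI_ex)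
  \<comment> \<open>These representatives come from the choice in \<open>gt_comp\<close>. They are
    known to lie in \<open>F2\<close> and in the right classes, which is what
    \<open>GTSh_hom_action\<close> asks for.\<close>
  then obtain m1 f1 m2 f2 where f: "f1 \<in> F2" "f2 \<in> F2" and s: "s1 = gt_class N1 m1 f1" "s2 = gt_class N2 m2 f2"
    and comp: "gt_comp N1 N2 s1 s2 = gt_class N1 (2 * m1 * m2 + m1 + m2) (f1 \<otimes>\<^bsub>F2G\<^esub> E_F2 m1 f1 f2)"
    by blast
  have f12: "f1 \<otimes>\<^bsub>F2G\<^esub> E_F2 m1 f1 f2 \<in> F2" using f by (simp add: mult_F2G)
  fix D assume D: "D \<in> Dessins N1"
  then obtain d \<psi> where \<psi>: "D = drawing_of d \<psi>" "dessin_rep d \<psi>" "subordinate N1 d \<psi>"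
    by (auto simp: Dessins_def)
  note act1 = GTSh_hom_action[OF assms(1,4) \<psi>(2,3) f(1) s(1)]
  note act2 = GTSh_hom_action[OF assms(2,3) act1(1,2) f(2) s(2)]
  show "Ash_mor N' N1 (gt_comp N1 N2 s1 s2) D = compose (Dessins N1) (Ash_mor N' N2 s2) (Ash_mor N2 N1 s1) D"
    using D N1.Ash_mor_drawing_of[OF \<psi>(2,3) f12]
    by (simp add: comp compose_def \<psi>(1) act1(3) act2(3) psi_act_comp[OF dessin_rep_hom[OF \<psi>(2)] f])
qed (simp_all add: Ash_mor_def compose_def)

theorem theorem3p1:
  shows "(\<forall>N1\<in>NFI. \<forall>N2\<in>NFI. \<forall>s\<in>Hom GTSh N2 N1. \<forall>d \<psi>.
           dessin_rep d \<psi> \<and> drawing_of d \<psi> \<in> Dessins N1 \<longrightarrow>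
             (\<forall>m. \<forall>f\<in>F2. \<forall>m'. \<forall>f'\<in>F2. s = gt_class N1 m f \<and> s = gt_class N1 m' f' \<longrightarrow>
                psi_act d \<psi> m f = psi_act d \<psi> m' f') \<and>
             (\<forall>m. \<forall>f\<in>F2. s = gt_class N1 m f \<longrightarrow>
                psi_act d \<psi> m f \<in> hom F2G (sym_group d) \<and>
                psi_act d \<psi> m f xF = \<psi> (xF [^]\<^bsub>F2G\<^esub> (2 * m + 1)) \<and>
                psi_act d \<psi> m f yF = \<psi> (inv\<^bsub>F2G\<^esub> f \<otimes>\<^bsub>F2G\<^esub> yF [^]\<^bsub>F2G\<^esub> (2 * m + 1) \<otimes>\<^bsub>F2G\<^esub> f) \<and>
                dessin_rep d (psi_act d \<psi> m f) \<and>
                subordinate N2 d (psi_act d \<psi> m f) \<and>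
                Ash_mor N2 N1 s (drawing_of d \<psi>) = drawing_of d (psi_act d \<psi> m f))) \<and>
         contravariant_functor GTSh Dessin Ash_obj Ash_mor"
proof (rule conjI)
  show "\<forall>N1\<in>NFI. \<forall>N2\<in>NFI. \<forall>s\<in>Hom GTSh N2 N1. \<forall>d \<psi>.
           dessin_rep d \<psi> \<and> drawing_of d \<psi> \<in> Dessins N1 \<longrightarrow>
             (\<forall>m. \<forall>f\<in>F2. \<forall>m'. \<forall>f'\<in>F2. s = gt_class N1 m f \<and> s = gt_class N1 m' f' \<longrightarrow>
                psi_act d \<psi> m f = psi_act d \<psi> m' f') \<and>
             (\<forall>m. \<forall>f\<in>F2. s = gt_class N1 m f \<longrightarrow>
                psi_act d \<psi> m f \<in> hom F2G (sym_group d) \<and>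
                psi_act d \<psi> m f xF = \<psi> (xF [^]\<^bsub>F2G\<^esub> (2 * m + 1)) \<and>
                psi_act d \<psi> m f yF = \<psi> (inv\<^bsub>F2G\<^esub> f \<otimes>\<^bsub>F2G\<^esub> yF [^]\<^bsub>F2G\<^esub> (2 * m + 1) \<otimes>\<^bsub>F2G\<^esub> f) \<and>
                dessin_rep d (psi_act d \<psi> m f) \<and>
                subordinate N2 d (psi_act d \<psi> m f) \<and>
                Ash_mor N2 N1 s (drawing_of d \<psi>) = drawing_of d (psi_act d \<psi> m f))"
  proof (intro ballI allI impI)
    fix N1 N2 s d \<psi>
    assume N1: "N1 \<in> NFI" and s: "s \<in> Hom GTSh N2 N1" and "dessin_rep d \<psi> \<and> drawing_of d \<psi> \<in> Dessins N1"
    then have \<psi>: "dessin_rep d \<psi>" "subordinate N1 d \<psi>" and s': "s \<in> GTSh_hom N2 N1"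
      using subordinate_Dessins by (auto simp: GTSh_def)
    note hom = dessin_rep_hom[OF \<psi>(1)]
    have cong: "psi_act d \<psi> m f = psi_act d \<psi> m' f'"
      if "f \<in> F2" "f' \<in> F2" "s = gt_class N1 m f" "s = gt_class N1 m' f'" for m f m' f'
      using quotient4.psi_act_cong[OF quotient4_NFI[OF N1] hom \<psi>(2) that(1,2)] that(3,4) by simp
    note act = psi_act(2-4)[OF hom] GTSh_hom_action[OF N1 s' \<psi>]
    show "(\<forall>m. \<forall>f\<in>F2. \<forall>m'. \<forall>f'\<in>F2. s = gt_class N1 m f \<and> s = gt_class N1 m' f' \<longrightarrow>
                psi_act d \<psi> m f = psi_act d \<psi> m' f') \<and>
             (\<forall>m. \<forall>f\<in>F2. s = gt_class N1 m f \<longrightarrow>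
                psi_act d \<psi> m f \<in> hom F2G (sym_group d) \<and>
                psi_act d \<psi> m f xF = \<psi> (xF [^]\<^bsub>F2G\<^esub> (2 * m + 1)) \<and>
                psi_act d \<psi> m f yF = \<psi> (inv\<^bsub>F2G\<^esub> f \<otimes>\<^bsub>F2G\<^esub> yF [^]\<^bsub>F2G\<^esub> (2 * m + 1) \<otimes>\<^bsub>F2G\<^esub> f) \<and>
                dessin_rep d (psi_act d \<psi> m f) \<and>
                subordinate N2 d (psi_act d \<psi> m f) \<and>
                Ash_mor N2 N1 s (drawing_of d \<psi>) = drawing_of d (psi_act d \<psi> m f))"
      by (intro conjI allI ballI impI act) (use cong in blast)+
  qed
  show "contravariant_functor GTSh Dessin Ash_obj Ash_mor"
    unfolding contravariant_functor_def
    using Ash_mor_PiE Ash_mor_id Ash_mor_comp by (simp add: GTSh_def Dessin_def Ash_obj_def)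
qed

end
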